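(* Let $k$ be a field of characteristic $3$ and let $R$ be the localization at the ideal $(x_1,\ldots,x_4)$ of the ring $$\frac{k[x_1,\ldots,x_4]}{(x_1^7+x_2^7+x_3^7+x_4^7)}.$$ Let $\tau$ be the test ideal of $R$. Then $\tau$ is not integrally closed: the integral closure of $\tau$ is $(x_1,\ldots,x_4)^4\neq\tau$, and for example $x_1x_2^3\in(x_1,\ldots,x_4)^4\setminus\tau$.
   Context: Let $R$ be a commutative Noetherian ring of prime characteristic $p>0$; the letter $q$ always denotes a power $p^e$, $e\in\mathbb{N}$. For an ideal $I\subseteq R$, $I^{[q]}$ is the ideal generated by the $q$th powers of all elements of $I$. An element $u\in R$ is in the tight closure $I^*$ of $I$ if there exists $c\in R$, not in any minimal prime of $R$, such that $cu^q\in I^{[q]}$ for all large $q=p^e$. The test ideal $\tau$ of $R$ is the ideal of all $c\in R$ such that for every ideal $I\subseteq R$ and every $u\in I^*$ one has $cu^q\in I^{[q]}$ for all $q=p^e$. *)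

theory Defs
  imports Complex_Main "HOL-Library.Poly_Mapping" "HOL-Library.Numeral_Type"
begin

section \<open>Ideals of a commutative ring\<close>

text \<open>Ideals are the submodules of the ring over itself: \<open>ideal.subspace I\<close> says that
  \<open>I\<close> is an ideal and \<open>ideal.span S\<close> is the ideal generated by \<open>S\<close>.\<close>

interpretation ideal: module "(*) :: 'a::comm_ring_1 \<Rightarrow> 'a \<Rightarrow> 'a"
  by standard (simp_all add: algebra_simps)

definition prime_ideal :: "'a::comm_ring_1 set \<Rightarrow> bool" where
  "prime_ideal P \<longleftrightarrow>
     ideal.subspace P \<and> P \<noteq> UNIV \<and> (\<forall>a b. a * b \<in> P \<longrightarrow> a \<in> P \<or> b \<in> P)"

definition minimal_prime :: "'a::comm_ring_1 set \<Rightarrow> bool" where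
  "minimal_prime P \<longleftrightarrow> prime_ideal P \<and> (\<forall>Q. prime_ideal Q \<and> Q \<subseteq> P \<longrightarrow> Q = P)"

definition ideal_mult :: "'a::comm_ring_1 set \<Rightarrow> 'a set \<Rightarrow> 'a set" where
  "ideal_mult I J = ideal.span {a * b |a b. a \<in> I \<and> b \<in> J}"

primrec ideal_power :: "'a::comm_ring_1 set \<Rightarrow> nat \<Rightarrow> 'a set" where
  "ideal_power I 0 = UNIV"
| "ideal_power I (Suc n) = ideal_mult I (ideal_power I n)"

definition integral_closure :: "'a::comm_ring_1 set \<Rightarrow> 'a set" where
  "integral_closure I =
     {u. \<exists>n\<ge>1. \<exists>a. (\<forall>i\<in>{1..n}. a i \<in> ideal_power I i) \<and>
           u ^ n + (\<Sum>i = 1..n. a i * u ^ (n - i)) = 0}"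

definition integrally_closed :: "'a::comm_ring_1 set \<Rightarrow> bool" where
  "integrally_closed I \<longleftrightarrow> integral_closure I = I"


section \<open>Tight closure and the test ideal\<close>

text \<open>The prime characteristic \<open>p\<close> of the ring is \<open>CHAR('a)\<close>; the exponent \<open>e\<close> in
  \<open>q = p ^ e\<close> ranges over all natural numbers, including \<open>0\<close>.\<close>

definition frobenius_power :: "'a::comm_ring_1 set \<Rightarrow> nat \<Rightarrow> 'a set" where
  "frobenius_power I q = ideal.span ((\<lambda>a. a ^ q) ` I)"

definition tight_closure :: "'a::comm_ring_1 set \<Rightarrow> 'a set" where
  "tight_closure I =
     {u. \<exists>c. (\<forall>P. minimal_prime P \<longrightarrow> c \<notin> P) \<and>
           (\<exists>e0. \<forall>e\<ge>e0. c * u ^ (CHAR('a) ^ e) \<in> frobenius_power I (CHAR('a) ^ e))}"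

definition test_ideal :: "'a::comm_ring_1 set" where
  "test_ideal =
     {c. \<forall>I u. ideal.subspace I \<longrightarrow> u \<in> tight_closure I \<longrightarrow>
           (\<forall>e. c * u ^ (CHAR('a) ^ e) \<in> frobenius_power I (CHAR('a) ^ e))}"

lemma subspace_test_ideal: "ideal.subspace (test_ideal :: 'a::comm_ring_1 set)"
proof (rule ideal.subspaceI)
  show "0 \<in> (test_ideal :: 'a set)"
    by (simp add: test_ideal_def frobenius_power_def ideal.span_zero)
next
  fix c d :: 'a
  assume "c \<in> test_ideal" "d \<in> test_ideal"
  then show "c + d \<in> test_ideal"
    unfolding test_ideal_def mem_Collect_eq frobenius_power_def distrib_right
    by (metis ideal.span_add)
next
  fix r c :: 'a
  assume "c \<in> test_ideal"
  then show "r * c \<in> test_ideal"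
    unfolding test_ideal_def mem_Collect_eq frobenius_power_def mult.assoc
    by (metis ideal.span_scale)
qed


section \<open>The diagonal hypersurface ring\<close>

text \<open>A monomial in four variables is a finitely supported map \<open>4 \<Rightarrow>\<^sub>0 nat\<close> from the
  four-element index type to exponents. The elements of the type \<open>4\<close> are the residues
  \<open>1, 2, 3\<close> and \<open>4 = 0\<close>.\<close>

type_synonym 'k mpoly4 = "(4 \<Rightarrow>\<^sub>0 nat) \<Rightarrow>\<^sub>0 'k"

definition pvar :: "4 \<Rightarrow> 'k::field mpoly4" where
  "pvar i = Poly_Mapping.single (Poly_Mapping.single i 1) 1"

definition diag_poly :: "'k::field mpoly4" where
  "diag_poly = pvar 1 ^ 7 + pvar 2 ^ 7 + pvar 3 ^ 7 + pvar 4 ^ 7"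

definition diag_rel :: "'k::field mpoly4 \<Rightarrow> 'k mpoly4 \<Rightarrow> bool" where
  "diag_rel f g \<longleftrightarrow> f - g \<in> ideal.span {diag_poly}"

lemma diag_rel_eqI: "f = g \<Longrightarrow> diag_rel f g"
  by (simp add: diag_rel_def ideal.span_zero)

lemma equivp_diag_rel: "equivp (diag_rel :: 'k::field mpoly4 \<Rightarrow> _)"
proof (rule equivpI)
  show "reflp (diag_rel :: 'k mpoly4 \<Rightarrow> _)"
    by (auto simp: reflp_def diag_rel_def ideal.span_zero)
  show "symp (diag_rel :: 'k mpoly4 \<Rightarrow> _)"
  proof (rule sympI)
    fix f g :: "'k mpoly4"
    assume "diag_rel f g"
    then have "- (f - g) \<in> ideal.span {diag_poly}"
      unfolding diag_rel_def by (rule ideal.span_neg)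
    then show "diag_rel g f"
      by (simp add: diag_rel_def)
  qed
  show "transp (diag_rel :: 'k mpoly4 \<Rightarrow> _)"
  proof (rule transpI)
    fix f g h :: "'k mpoly4"
    assume "diag_rel f g" "diag_rel g h"
    then have "(f - g) + (g - h) \<in> ideal.span {diag_poly}"
      unfolding diag_rel_def by (rule ideal.span_add)
    then show "diag_rel f h"
      by (simp add: diag_rel_def)
  qed
qed

quotient_type (overloaded) 'k diag_ring = "'k::field mpoly4" / diag_rel
  morphisms rep_diag diag_class
  by (rule equivp_diag_rel)

text \<open>The constant coefficient is multiplicative and vanishes on the defining equation, so the
  ideal generated by the variables is a proper prime ideal of the quotient.\<close>

lemma lookup_mult_0:
  "Poly_Mapping.lookup (f * g) 0 = Poly_Mapping.lookup f 0 * Poly_Mapping.lookup (g :: 'k::field mpoly4) 0"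
proof -
  have zero: "k = 0 \<and> l = 0" if "0 = k + l" for k l :: "4 \<Rightarrow>\<^sub>0 nat"
  proof -
    have "Poly_Mapping.lookup k i = 0 \<and> Poly_Mapping.lookup l i = 0" for i
      using arg_cong[OF that, of "\<lambda>m. Poly_Mapping.lookup m i"] by (simp add: lookup_add)
    then show ?thesis by (auto intro: poly_mapping_eqI)
  qed
  have "(Poly_Mapping.lookup g l when 0 = k + l) =
      ((Poly_Mapping.lookup g 0 when l = 0) when k = 0)" for k l
    using zero[of k l] by (cases "k = 0"; cases "l = 0") (auto simp: when_def)
  moreover have "Sum_any (\<lambda>l :: 4 \<Rightarrow>\<^sub>0 nat. (Poly_Mapping.lookup g 0 when l = 0) when k = 0) =
      (Poly_Mapping.lookup g 0 when k = 0)" for k :: "4 \<Rightarrow>\<^sub>0 nat"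
    by (cases "k = 0") simp_all
  moreover note lookup_mult[of f g 0]
  ultimately have "Poly_Mapping.lookup (f * g) 0 =
      Sum_any (\<lambda>k. Poly_Mapping.lookup f k * (Poly_Mapping.lookup g 0 when k = 0))"
    by simp
  then show ?thesis by (simp add: mult_when)
qed

lemma lookup_power_0: "Poly_Mapping.lookup (f ^ n) 0 = Poly_Mapping.lookup (f :: 'k::field mpoly4) 0 ^ n"
  by (induction n) (simp_all add: lookup_mult_0)

lemma lookup_pvar_0: "Poly_Mapping.lookup (pvar i :: 'k::field mpoly4) 0 = 0"
proof -
  have "Poly_Mapping.single i (1::nat) \<noteq> 0"
    by (metis lookup_single_eq lookup_zero zero_neq_one)
  then show ?thesis by (simp add: pvar_def lookup_single_not_eq)
qed

lemma lookup_diag_poly_0: "Poly_Mapping.lookup (diag_poly :: 'k::field mpoly4) 0 = 0"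
  by (simp add: diag_poly_def lookup_add lookup_power_0 lookup_pvar_0)

lemma diag_rel_lookup_0: "diag_rel f g \<Longrightarrow> Poly_Mapping.lookup f 0 = Poly_Mapping.lookup g 0"
  by (auto simp: diag_rel_def ideal.span_singleton lookup_mult_0 lookup_diag_poly_0
      dest!: arg_cong[of _ _ "\<lambda>h. Poly_Mapping.lookup h 0"] simp: lookup_minus)

instantiation diag_ring :: (field) comm_ring_1
begin

lift_definition zero_diag_ring :: "'a diag_ring" is 0 .

lift_definition one_diag_ring :: "'a diag_ring" is 1 .

lift_definition plus_diag_ring :: "'a diag_ring \<Rightarrow> 'a diag_ring \<Rightarrow> 'a diag_ring" is "(+)"
proof -
  fix f f' g g' :: "'a mpoly4"
  assume "diag_rel f f'" "diag_rel g g'"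
  then have "(f - f') + (g - g') \<in> ideal.span {diag_poly}"
    unfolding diag_rel_def by (rule ideal.span_add)
  then show "diag_rel (f + g) (f' + g')"
    by (simp add: diag_rel_def algebra_simps)
qed

lift_definition uminus_diag_ring :: "'a diag_ring \<Rightarrow> 'a diag_ring" is uminus
proof -
  fix f f' :: "'a mpoly4"
  assume "diag_rel f f'"
  then have "- (f - f') \<in> ideal.span {diag_poly}"
    unfolding diag_rel_def by (rule ideal.span_neg)
  then show "diag_rel (- f) (- f')"
    by (simp add: diag_rel_def)
qed

lift_definition minus_diag_ring :: "'a diag_ring \<Rightarrow> 'a diag_ring \<Rightarrow> 'a diag_ring" is "(-)"
proof -
  fix f f' g g' :: "'a mpoly4"
  assume "diag_rel f f'" "diag_rel g g'"
  then have "(f - f') - (g - g') \<in> ideal.span {diag_poly}"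
    unfolding diag_rel_def by (rule ideal.span_diff)
  then show "diag_rel (f - g) (f' - g')"
    by (simp add: diag_rel_def algebra_simps)
qed

lift_definition times_diag_ring :: "'a diag_ring \<Rightarrow> 'a diag_ring \<Rightarrow> 'a diag_ring" is "(*)"
proof -
  fix f f' g g' :: "'a mpoly4"
  assume "diag_rel f f'" "diag_rel g g'"
  then have "g * (f - f') + f' * (g - g') \<in> ideal.span {diag_poly}"
    unfolding diag_rel_def by (intro ideal.span_add ideal.span_scale)
  then show "diag_rel (f * g) (f' * g')"
    by (simp add: diag_rel_def algebra_simps)
qed

instance
proof
  have "\<not> diag_rel 0 (1 :: 'a mpoly4)"
    by (metis diag_rel_lookup_0 lookup_one_zero lookup_zero zero_neq_one)
  then show "(0 :: 'a diag_ring) \<noteq> 1"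
    by transfer
  fix a b c :: "'a diag_ring"
  show "a * b * c = a * (b * c)"
    by (transfer, rule diag_rel_eqI) (rule mult.assoc)
  show "a * b = b * a"
    by (transfer, rule diag_rel_eqI) (rule mult.commute)
  show "1 * a = a"
    by (transfer, rule diag_rel_eqI) simp
  show "a + b + c = a + (b + c)"
    by (transfer, rule diag_rel_eqI) (rule add.assoc)
  show "a + b = b + a"
    by (transfer, rule diag_rel_eqI) (rule add.commute)
  show "0 + a = a"
    by (transfer, rule diag_rel_eqI) simp
  show "- a + a = 0"
    by (transfer, rule diag_rel_eqI) simp
  show "a - b = a + - b"
    by (transfer, rule diag_rel_eqI) simp
  show "(a + b) * c = a * c + b * c"
    by (transfer, rule diag_rel_eqI) (rule distrib_right)
qed

end

definition diag_var :: "4 \<Rightarrow> 'k::field diag_ring" where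
  "diag_var i = diag_class (pvar i)"

definition diag_max_ideal :: "'k::field diag_ring set" where
  "diag_max_ideal = ideal.span {diag_var 1, diag_var 2, diag_var 3, diag_var 4}"

lift_definition const_coeff :: "'k::field diag_ring \<Rightarrow> 'k" is "\<lambda>f. Poly_Mapping.lookup f 0"
  by (rule diag_rel_lookup_0)

lemma const_coeff_add: "const_coeff (a + b) = const_coeff a + const_coeff b"
  by transfer (rule lookup_add)

lemma const_coeff_mult: "const_coeff (a * b) = const_coeff a * const_coeff b"
  by transfer (rule lookup_mult_0)

lemma const_coeff_0 [simp]: "const_coeff 0 = 0"
  by transfer simp

lemma const_coeff_1 [simp]: "const_coeff 1 = 1"
  by transfer simp

lemma const_coeff_var [simp]: "const_coeff (diag_var i) = 0"
  by (simp add: diag_var_def const_coeff.abs_eq lookup_pvar_0)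

lemma diag_class_exhaust: obtains f where "a = diag_class f"
  by (metis Quotient3_def Quotient3_diag_ring)

lemma diag_class_add: "diag_class (f + g) = diag_class f + diag_class g"
  by (simp add: plus_diag_ring.abs_eq)

lemma diag_class_mult: "diag_class (f * g) = diag_class f * diag_class g"
  by (simp add: times_diag_ring.abs_eq)

lemma diag_var_in_max_ideal: "diag_var i \<in> diag_max_ideal"
proof -
  have "i \<in> {1, 2, 3, 4}"
  proof (induct i)
    case (of_int z)
    then have "0 \<le> z" "z < 4" by simp_all
    then have "z = 0 \<or> z = 1 \<or> z = 2 \<or> z = 3" by arith
    then show ?case by auto
  qed
  then show ?thesis
    unfolding diag_max_ideal_def by (intro ideal.span_base) auto
qed

lemma diag_class_minus_const:
  "\<exists>m\<in>diag_max_ideal. diag_class f = diag_class (Poly_Mapping.single 0 (Poly_Mapping.lookup f 0)) + m"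
proof (induction f rule: update_induct)
  case const
  then show ?case
    by (auto simp: diag_max_ideal_def ideal.span_zero)
next
  case (update f a b)
  have upd: "Poly_Mapping.update a b f = f + Poly_Mapping.single a b"
    using update(1) by (intro poly_mapping_eqI)
      (auto simp: lookup_update lookup_add lookup_single in_keys_iff when_def)
  obtain m where m: "m \<in> diag_max_ideal"
    "diag_class f = diag_class (Poly_Mapping.single 0 (Poly_Mapping.lookup f 0)) + m"
    using update by blast
  show ?case
  proof (cases "a = 0")
    case True
    then show ?thesis
      using m unfolding upd
      by (intro bexI[of _ m]) (simp_all add: lookup_add single_add diag_class_add)
  next
    case False
    then obtain i where i: "Poly_Mapping.lookup a i \<noteq> 0"
      by (metis lookup_zero poly_mapping_eqI)
    have "a = (a - Poly_Mapping.single i 1) + Poly_Mapping.single i 1"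
      using i by (intro poly_mapping_eqI)
        (auto simp: lookup_add lookup_minus lookup_single when_def)
    then have "Poly_Mapping.single a b = Poly_Mapping.single (a - Poly_Mapping.single i 1) b * pvar i"
      by (simp add: pvar_def mult_single)
    then have "diag_class (Poly_Mapping.single a b) \<in> diag_max_ideal"
      using ideal.span_scale[OF diag_var_in_max_ideal[unfolded diag_max_ideal_def]]
      by (simp only: diag_class_mult diag_max_ideal_def flip: diag_var_def)
    then show ?thesis
      using m False
      by (intro bexI[of _ "m + diag_class (Poly_Mapping.single a b)"])
        (auto simp: upd lookup_add lookup_single_not_eq diag_class_add diag_max_ideal_def
          intro: ideal.span_add)
  qed
qed

lemma diag_max_ideal_iff: "a \<in> diag_max_ideal \<longleftrightarrow> const_coeff a = 0"
proof
  have "ideal.subspace {a :: 'a diag_ring. const_coeff a = 0}"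
    by (auto simp: ideal.subspace_def const_coeff_add const_coeff_mult)
  then show "const_coeff a = 0" if "a \<in> diag_max_ideal"
    using that ideal.span_minimal[of "{diag_var 1, diag_var 2, diag_var 3, diag_var 4}"
        "{a :: 'a diag_ring. const_coeff a = 0}"]
    unfolding diag_max_ideal_def by auto
next
  assume *: "const_coeff a = 0"
  obtain f where f: "a = diag_class f"
    by (rule diag_class_exhaust)
  obtain m where m: "m \<in> diag_max_ideal"
    "diag_class f = diag_class (Poly_Mapping.single 0 (Poly_Mapping.lookup f 0)) + m"
    using diag_class_minus_const by blast
  have "Poly_Mapping.lookup f 0 = 0"
    using * by (simp add: f const_coeff.abs_eq)
  then show "a \<in> diag_max_ideal"
    using m f by (simp flip: zero_diag_ring_def)
qed

lemma one_notin_diag_max_ideal: "1 \<notin> diag_max_ideal"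
  by (simp add: diag_max_ideal_iff)

lemma mult_notin_diag_max_ideal:
  "s \<notin> diag_max_ideal \<Longrightarrow> t \<notin> diag_max_ideal \<Longrightarrow> s * t \<notin> diag_max_ideal"
  by (simp add: diag_max_ideal_iff const_coeff_mult)


section \<open>The local ring of the hypersurface at the origin\<close>

definition loc_rel ::
  "'k::field diag_ring \<times> 'k diag_ring \<Rightarrow> 'k diag_ring \<times> 'k diag_ring \<Rightarrow> bool" where
  "loc_rel = (\<lambda>(a, s) (b, t). s \<notin> diag_max_ideal \<and> t \<notin> diag_max_ideal \<and>
     (\<exists>w. w \<notin> diag_max_ideal \<and> w * (a * t - b * s) = 0))"

lemma loc_rel_iff:
  "loc_rel x y \<longleftrightarrow> snd x \<notin> diag_max_ideal \<and> snd y \<notin> diag_max_ideal \<and>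
     (\<exists>w. w \<notin> diag_max_ideal \<and> w * (fst x * snd y - fst y * snd x) = 0)"
  by (simp add: loc_rel_def case_prod_unfold)

lemma loc_relE:
  assumes "loc_rel x y"
  obtains w where "snd x \<notin> diag_max_ideal" "snd y \<notin> diag_max_ideal" "w \<notin> diag_max_ideal"
    "w * (fst x * snd y - fst y * snd x) = 0"
  using assms unfolding loc_rel_iff by blast

lemma loc_rel_eqI:
  assumes "snd x \<notin> diag_max_ideal" "snd y \<notin> diag_max_ideal" "fst x * snd y = fst y * snd x"
  shows "loc_rel x y"
  unfolding loc_rel_iff using assms
  by (intro conjI exI[of _ 1] one_notin_diag_max_ideal) simp_all

lemma loc_rel_self_iff: "loc_rel x x \<longleftrightarrow> snd x \<notin> diag_max_ideal"
  using loc_rel_eqI[of x x] by (auto simp: loc_rel_iff)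

lemma part_equivp_loc_rel: "part_equivp (loc_rel :: 'k::field diag_ring \<times> _ \<Rightarrow> _)"
proof (rule part_equivpI)
  show "\<exists>x :: 'k diag_ring \<times> 'k diag_ring. loc_rel x x"
    by (rule exI[of _ "(0, 1)"]) (simp add: loc_rel_self_iff one_notin_diag_max_ideal)
  show "symp (loc_rel :: 'k diag_ring \<times> _ \<Rightarrow> _)"
  proof (rule sympI)
    fix x y :: "'k diag_ring \<times> 'k diag_ring"
    assume "loc_rel x y"
    then obtain w where w: "snd x \<notin> diag_max_ideal" "snd y \<notin> diag_max_ideal"
      "w \<notin> diag_max_ideal" "w * (fst x * snd y - fst y * snd x) = 0"
      by (rule loc_relE)
    have "w * (fst y * snd x - fst x * snd y) = - (w * (fst x * snd y - fst y * snd x))"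
      by (simp add: right_diff_distrib)
    also have "\<dots> = 0"
      by (simp only: w(4) minus_zero)
    finally show "loc_rel y x"
      unfolding loc_rel_iff using w(1-3) by (intro conjI exI[of _ w])
  qed
  show "transp (loc_rel :: 'k diag_ring \<times> _ \<Rightarrow> _)"
  proof (rule transpI)
    fix x y z :: "'k diag_ring \<times> 'k diag_ring"
    assume xy: "loc_rel x y" and yz: "loc_rel y z"
    from xy obtain v where v: "snd x \<notin> diag_max_ideal" "snd y \<notin> diag_max_ideal"
      "v \<notin> diag_max_ideal" "v * (fst x * snd y - fst y * snd x) = 0"
      by (rule loc_relE)
    from yz obtain w where w: "snd y \<notin> diag_max_ideal" "snd z \<notin> diag_max_ideal"
      "w \<notin> diag_max_ideal" "w * (fst y * snd z - fst z * snd y) = 0"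
      by (rule loc_relE)
    have "(v * w * snd y) * (fst x * snd z - fst z * snd x) =
        (w * snd z) * (v * (fst x * snd y - fst y * snd x)) +
        (v * snd x) * (w * (fst y * snd z - fst z * snd y))"
      by (simp only: algebra_simps)
    also have "\<dots> = 0"
      by (simp only: v(4) w(4) mult_zero_right add_0)
    finally show "loc_rel x z"
      unfolding loc_rel_iff using v(1-3) w(1-3)
      by (intro conjI exI[of _ "v * w * snd y"] mult_notin_diag_max_ideal)
  qed
qed

quotient_type (overloaded) 'k diag_local = "'k::field diag_ring \<times> 'k diag_ring" / partial: loc_rel
  morphisms rep_local local_class
  by (rule part_equivp_loc_rel)

instantiation diag_local :: (field) comm_ring_1
begin

lift_definition zero_diag_local :: "'a diag_local" is "(0, 1)"
  by (simp add: loc_rel_self_iff one_notin_diag_max_ideal)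

lift_definition one_diag_local :: "'a diag_local" is "(1, 1)"
  by (simp add: loc_rel_self_iff one_notin_diag_max_ideal)

lift_definition plus_diag_local :: "'a diag_local \<Rightarrow> 'a diag_local \<Rightarrow> 'a diag_local"
  is "\<lambda>x y. (fst x * snd y + fst y * snd x, snd x * snd y)"
proof -
  fix x x' y y' :: "'a diag_ring \<times> 'a diag_ring"
  assume xx: "loc_rel x x'" and yy: "loc_rel y y'"
  from xx obtain v where v: "snd x \<notin> diag_max_ideal" "snd x' \<notin> diag_max_ideal"
    "v \<notin> diag_max_ideal" "v * (fst x * snd x' - fst x' * snd x) = 0"
    by (rule loc_relE)
  from yy obtain w where w: "snd y \<notin> diag_max_ideal" "snd y' \<notin> diag_max_ideal"
    "w \<notin> diag_max_ideal" "w * (fst y * snd y' - fst y' * snd y) = 0"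
    by (rule loc_relE)
  have "(v * w) * ((fst x * snd y + fst y * snd x) * (snd x' * snd y') -
        (fst x' * snd y' + fst y' * snd x') * (snd x * snd y)) =
      (w * snd y * snd y') * (v * (fst x * snd x' - fst x' * snd x)) +
      (v * snd x * snd x') * (w * (fst y * snd y' - fst y' * snd y))"
    by (simp only: algebra_simps)
  also have "\<dots> = 0"
    by (simp only: v(4) w(4) mult_zero_right add_0)
  finally show "loc_rel (fst x * snd y + fst y * snd x, snd x * snd y)
      (fst x' * snd y' + fst y' * snd x', snd x' * snd y')"
    unfolding loc_rel_iff fst_conv snd_conv using v(1-3) w(1-3)
    by (intro conjI exI[of _ "v * w"] mult_notin_diag_max_ideal)
qed

lift_definition uminus_diag_local :: "'a diag_local \<Rightarrow> 'a diag_local"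
  is "\<lambda>x. (- fst x, snd x)"
proof -
  fix x x' :: "'a diag_ring \<times> 'a diag_ring"
  assume "loc_rel x x'"
  then obtain w where w: "snd x \<notin> diag_max_ideal" "snd x' \<notin> diag_max_ideal"
    "w \<notin> diag_max_ideal" "w * (fst x * snd x' - fst x' * snd x) = 0"
    by (rule loc_relE)
  have "w * (- fst x * snd x' - (- fst x') * snd x) = - (w * (fst x * snd x' - fst x' * snd x))"
    by (simp add: right_diff_distrib)
  also have "\<dots> = 0"
    by (simp only: w(4) minus_zero)
  finally show "loc_rel (- fst x, snd x) (- fst x', snd x')"
    unfolding loc_rel_iff fst_conv snd_conv using w(1-3) by (intro conjI exI[of _ w])
qed

definition minus_diag_local :: "'a diag_local \<Rightarrow> 'a diag_local \<Rightarrow> 'a diag_local" where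
  "minus_diag_local x y = x + - y"

lift_definition times_diag_local :: "'a diag_local \<Rightarrow> 'a diag_local \<Rightarrow> 'a diag_local"
  is "\<lambda>x y. (fst x * fst y, snd x * snd y)"
proof -
  fix x x' y y' :: "'a diag_ring \<times> 'a diag_ring"
  assume xx: "loc_rel x x'" and yy: "loc_rel y y'"
  from xx obtain v where v: "snd x \<notin> diag_max_ideal" "snd x' \<notin> diag_max_ideal"
    "v \<notin> diag_max_ideal" "v * (fst x * snd x' - fst x' * snd x) = 0"
    by (rule loc_relE)
  from yy obtain w where w: "snd y \<notin> diag_max_ideal" "snd y' \<notin> diag_max_ideal"
    "w \<notin> diag_max_ideal" "w * (fst y * snd y' - fst y' * snd y) = 0"
    by (rule loc_relE)
  have "(v * w) * ((fst x * fst y) * (snd x' * snd y') -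
        (fst x' * fst y') * (snd x * snd y)) =
      (w * fst y * snd y') * (v * (fst x * snd x' - fst x' * snd x)) +
      (v * fst x' * snd x) * (w * (fst y * snd y' - fst y' * snd y))"
    by (simp only: algebra_simps)
  also have "\<dots> = 0"
    by (simp only: v(4) w(4) mult_zero_right add_0)
  finally show "loc_rel (fst x * fst y, snd x * snd y)
      (fst x' * fst y', snd x' * snd y')"
    unfolding loc_rel_iff fst_conv snd_conv using v(1-3) w(1-3)
    by (intro conjI exI[of _ "v * w"] mult_notin_diag_max_ideal)
qed

lemmas local_simps =
  loc_rel_self_iff fst_conv snd_conv mult_notin_diag_max_ideal one_notin_diag_max_ideal
  not_False_eq_True algebra_simps mult_1_left mult_1_right mult_zero_left add_0_left add_0_right

instance
proof
  show "(0 :: 'a diag_local) \<noteq> 1"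
    by transfer (simp add: loc_rel_iff diag_max_ideal_iff)
  fix a b c :: "'a diag_local"
  show "a - b = a + - b"
    by (rule minus_diag_local_def)
  show "a * b * c = a * (b * c)"
    by (transfer, rule loc_rel_eqI)
      (simp_all only: local_simps)
  show "a * b = b * a"
    by (transfer, rule loc_rel_eqI)
      (simp_all only: local_simps)
  show "1 * a = a"
    by (transfer, rule loc_rel_eqI)
      (simp_all only: local_simps)
  show "a + b + c = a + (b + c)"
    by (transfer, rule loc_rel_eqI)
      (simp_all only: local_simps)
  show "a + b = b + a"
    by (transfer, rule loc_rel_eqI)
      (simp_all only: local_simps)
  show "0 + a = a"
    by (transfer, rule loc_rel_eqI)
      (simp_all only: local_simps)
  show "- a + a = 0"
    by (transfer, rule loc_rel_eqI)
      (simp_all add: loc_rel_self_iff mult_notin_diag_max_ideal one_notin_diag_max_ideal)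
  show "(a + b) * c = a * c + b * c"
    by (transfer, rule loc_rel_eqI)
      (simp_all only: local_simps)
qed

end

text \<open>The localization map, with the properties that characterize the localization at the
  complement of \<open>diag_max_ideal\<close>.\<close>

definition to_local :: "'k::field diag_ring \<Rightarrow> 'k diag_local" where
  "to_local a = local_class (a, 1)"

lemma loc_rel_refl: "s \<notin> diag_max_ideal \<Longrightarrow> loc_rel (a, s) (a, s)"
  by (rule loc_rel_eqI) auto

lemma local_class_eq_iff:
  assumes "s \<notin> diag_max_ideal" "t \<notin> diag_max_ideal"
  shows "local_class (a, s) = local_class (b, t) \<longleftrightarrow> loc_rel (a, s) (b, t)"
  using Quotient3_rel[OF Quotient3_diag_local, of "(a, s)" "(b, t)"] loc_rel_refl assms by blast

lemma to_local_eq_iff: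
  "to_local a = to_local b \<longleftrightarrow> (\<exists>w. w \<notin> diag_max_ideal \<and> w * (a - b) = 0)"
  by (simp add: to_local_def local_class_eq_iff one_notin_diag_max_ideal)
    (simp add: loc_rel_def one_notin_diag_max_ideal)

lemma to_local_add: "to_local (a + b) = to_local a + to_local b"
  by (simp add: to_local_def plus_diag_local.abs_eq loc_rel_refl one_notin_diag_max_ideal)

lemma to_local_mult: "to_local (a * b) = to_local a * to_local b"
  by (simp add: to_local_def times_diag_local.abs_eq loc_rel_refl one_notin_diag_max_ideal)

lemma to_local_1: "to_local 1 = 1"
  by (simp add: to_local_def one_diag_local_def)

lemma to_local_unit: "s \<notin> diag_max_ideal \<Longrightarrow> to_local s * local_class (1, s) = 1"
  by (simp add: to_local_def one_diag_local_def times_diag_local.abs_eq loc_rel_refl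
      one_notin_diag_max_ideal local_class_eq_iff loc_rel_eqI)

lemma local_fraction: "\<exists>a s. s \<notin> diag_max_ideal \<and> x * to_local s = to_local a"
proof -
  obtain a s where *: "x = local_class (a, s)" "s \<notin> diag_max_ideal"
  proof -
    have "loc_rel (rep_local x) (rep_local x)" "local_class (rep_local x) = x"
      using Quotient3_diag_local by (auto simp: Quotient3_def)
    then show ?thesis
      using that by (cases "rep_local x") (auto simp: loc_rel_def)
  qed
  have "x * to_local s = to_local a"
    using * by (simp add: to_local_def times_diag_local.abs_eq loc_rel_refl
        one_notin_diag_max_ideal local_class_eq_iff loc_rel_eqI)
  with * show ?thesis by blast
qed

definition local_var :: "4 \<Rightarrow> 'k::field diag_local" where
  "local_var i = to_local (diag_var i)"

definition local_max_ideal :: "'k::field diag_local set" where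
  "local_max_ideal = ideal.span {local_var 1, local_var 2, local_var 3, local_var 4}"

end

(* For f = x1^7 + x2^7 + x3^7 + x4^7 in S = k[x1,...,x4] and R the local ring of S/(f), a
   q-inverse-linear operator psi on S gives the operator psi(f^(q-1) _) on R (Fedder), and these
   operators map the test ideal into itself. A multiplier of tight closure has a nonzero multiple
   free of x1, because S/(f) is a domain that is module-finite over k[x2,x3,x4]; a suitable
   operator sends a multiple of it to x1^6, so x1^6 is in the test ideal. For q = 3 the terms
   xi^14 and xi^7 xj^7 of f^2 then yield all xi^4 and xi^2 xj^2, but never x1 x2^3. As squares of
   monomials of degree 4 are products of two of these, m^4 lies in the integral closure.

   Conversely, if |alpha| <= 3, or x^alpha = x1 x2^3, then u = x1^(6 - alpha1) satisfies
   u^3 in I^[3] for I = (x2^(alpha2+1), x3^(alpha3+1), x4^(alpha4+1)), hence u is in I^*. Modulo f,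
   this ideal is monomial, and c u in I forces the coefficient of x^alpha in c to vanish. So the
   test ideal lies in m^4 and misses x1 x2^3. Finally m^4 is integrally closed because f divides
   no power of a nonzero form of degree less than 7. *)

theory Submission
  imports Defs "HOL-Computational_Algebra.Polynomial" "HOL-Computational_Algebra.Primes"
begin

text \<open>The stability of the test ideal under the operators rests on quantifying over all ideals
  and all q: if c multiplies u^(q q') into I^[q q'], which lies in (I^[q])^[q'], the q'-operator
  pulls this back to a statement about u^q and I^[q]. The field k may have infinite degree over its
  cubes, so no distinguished trace is at hand; psi is built from a Frobenius-inverse-linear
  functional on k that takes the value 1 at one chosen coefficient. The exponent 6 arises because
  7(q-1) + 6 = 6q + (q-1), and because q is prime to 7 only the top power of x1^7 in f^(q-1) can
  meet this residue. Primality of f identifies the kernel of S -> R, makes every tight closure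
  multiplier nonzero and allows the cancellation of denominators and of powers of initial forms. It
  comes from a degree trick: in characteristic 3 the form x2^7 + x3^7 + x4^7 drops to degree 6 in a
  suitable variable, and 6 is prime to 7. Starting from x1^6, new monomials for q = 3 come from
  exponent inequalities alone, since 7 = 1 modulo 3 keeps the terms of f^2 apart.\<close>

abbreviation "lookup \<equiv> Poly_Mapping.lookup"
abbreviation "single \<equiv> Poly_Mapping.single"
abbreviation "keys \<equiv> Poly_Mapping.keys"

declare ideal.scale_scale [simp del] \<comment> \<open>loops with \<open>mult.assoc\<close>\<close>

section \<open>Ring homomorphisms and evaluation\<close>

locale ring_map =
  fixes h :: "'a::comm_ring_1 \<Rightarrow> 'b::comm_ring_1"
  assumes one: "h 1 = 1"
    and add: "h (x + y) = h x + h y"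
    and mult: "h (x * y) = h x * h y"
begin

lemma zero: "h 0 = 0"
  using add[of 0 0] by simp

lemma uminus: "h (- x) = - h x"
  using add[of x "- x"] by (simp add: zero eq_neg_iff_add_eq_0 add.commute)

lemma diff: "h (x - y) = h x - h y"
  using add[of x "- y"] by (simp add: uminus)

lemma power: "h (x ^ n) = h x ^ n"
  by (induction n) (simp_all add: one mult)

lemma sum: "h (sum F A) = (\<Sum>x\<in>A. h (F x))"
  by (induction A rule: infinite_finite_induct) (simp_all add: zero add)

lemma prod: "h (prod F A) = (\<Prod>x\<in>A. h (F x))"
  by (induction A rule: infinite_finite_induct) (simp_all add: one mult)

lemma dvd: "x dvd y \<Longrightarrow> h x dvd h y"
  by (auto simp: dvd_def mult)

end

text \<open>Exponent vectors and polynomials are both finitely supported maps, so this one rule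
  serves on both levels.\<close>

lemma poly_mapping_add_induct [case_names single add]:
  assumes "\<And>m c. P (single m c)" and "\<And>a b. P a \<Longrightarrow> P b \<Longrightarrow> P (a + b)"
  shows "P (s :: 'a \<Rightarrow>\<^sub>0 'b::comm_monoid_add)"
proof (induction s rule: update_induct)
  case const
  then show ?case using assms(1)[of undefined 0] by simp
next
  case (update f a b)
  have "Poly_Mapping.update a b f = f + single a b"
    using update(1) by (intro poly_mapping_eqI)
      (auto simp: lookup_update lookup_add lookup_single in_keys_iff when_def)
  then show ?case using assms update by metis
qed

definition monom_at :: "('n::finite \<Rightarrow> 'b::comm_ring_1) \<Rightarrow> ('n \<Rightarrow>\<^sub>0 nat) \<Rightarrow> 'b" where
  "monom_at \<theta> m = (\<Prod>i\<in>UNIV. \<theta> i ^ lookup m i)"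

definition mpoly_eval ::
  "('a::comm_ring_1 \<Rightarrow> 'b::comm_ring_1) \<Rightarrow> ('n::finite \<Rightarrow> 'b) \<Rightarrow> (('n \<Rightarrow>\<^sub>0 nat) \<Rightarrow>\<^sub>0 'a) \<Rightarrow> 'b"
  where "mpoly_eval h \<theta> s = (\<Sum>m\<in>keys s. h (lookup s m) * monom_at \<theta> m)"

lemma monom_at_0: "monom_at \<theta> 0 = 1"
  by (simp add: monom_at_def)

lemma monom_at_add: "monom_at \<theta> (m + n) = monom_at \<theta> m * monom_at \<theta> n"
  by (simp add: monom_at_def lookup_add power_add prod.distrib)

lemma monom_at_single: "monom_at \<theta> (single i n) = \<theta> i ^ n"
proof -
  have "monom_at \<theta> (single i n) = (\<Prod>j\<in>UNIV. if j = i then \<theta> i ^ n else 1)"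
    unfolding monom_at_def by (intro prod.cong) (auto simp: lookup_single when_def)
  then show ?thesis by simp
qed

context
  fixes h :: "'a::comm_ring_1 \<Rightarrow> 'b::comm_ring_1" and \<theta> :: "'n::finite \<Rightarrow> 'b"
  assumes h: "ring_map h"
begin

interpretation h: ring_map h by (rule h)

lemma mpoly_eval_single: "mpoly_eval h \<theta> (single m c) = h c * monom_at \<theta> m"
  by (simp add: mpoly_eval_def h.zero)

lemma mpoly_eval_superset:
  assumes "finite K" "keys s \<subseteq> K"
  shows "mpoly_eval h \<theta> s = (\<Sum>m\<in>K. h (lookup s m) * monom_at \<theta> m)"
  unfolding mpoly_eval_def using assms
  by (intro sum.mono_neutral_left) (auto simp: in_keys_iff h.zero)

lemma mpoly_eval_add: "mpoly_eval h \<theta> (s + t) = mpoly_eval h \<theta> s + mpoly_eval h \<theta> t"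
proof -
  let ?K = "keys s \<union> keys t"
  have "mpoly_eval h \<theta> (s + t) = (\<Sum>m\<in>?K. h (lookup (s + t) m) * monom_at \<theta> m)"
    by (intro mpoly_eval_superset) (auto simp: keys_add)
  also have "\<dots> = mpoly_eval h \<theta> s + mpoly_eval h \<theta> t"
    by (subst (1 2) mpoly_eval_superset[of ?K])
      (auto simp: lookup_add h.add distrib_right sum.distrib)
  finally show ?thesis .
qed

lemma mpoly_eval_mult: "mpoly_eval h \<theta> (s * t) = mpoly_eval h \<theta> s * mpoly_eval h \<theta> t"
proof (induction s rule: poly_mapping_add_induct)
  case (single m c)
  show ?case
    by (induction t rule: poly_mapping_add_induct)
      (simp_all add: mult_single mpoly_eval_single monom_at_add h.mult distrib_left mpoly_eval_add)
qed (simp add: distrib_right mpoly_eval_add)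

lemma ring_map_mpoly_eval: "ring_map (mpoly_eval h \<theta>)"
  by standard (simp_all add: mpoly_eval_add mpoly_eval_mult mpoly_eval_single monom_at_0 h.one
      flip: single_one)

lemma mpoly_eval_var: "mpoly_eval h \<theta> (single (single i 1) 1) = \<theta> i"
  by (simp add: mpoly_eval_single monom_at_single h.one del: One_nat_def)

lemma mpoly_eval_const: "mpoly_eval h \<theta> (single 0 c) = h c"
  by (simp add: mpoly_eval_single monom_at_0)

end


lemma ring_map_const: "ring_map (single 0 :: 'a::comm_ring_1 \<Rightarrow> ('n \<Rightarrow>\<^sub>0 nat) \<Rightarrow>\<^sub>0 'a)"
  by standard (simp_all add: single_add mult_single)

lemma ring_map_eq_mpoly_eval:
  fixes H :: "(('n::finite \<Rightarrow>\<^sub>0 nat) \<Rightarrow>\<^sub>0 'a::comm_ring_1) \<Rightarrow> 'b::comm_ring_1"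
  assumes H: "ring_map H"
  shows "H s = mpoly_eval (\<lambda>c. H (single 0 c)) (\<lambda>i. H (single (single i 1) 1)) s"
    (is "_ = mpoly_eval ?h ?\<theta> s")
proof -
  interpret H: ring_map H by fact
  have h: "ring_map ?h"
    by standard (simp_all add: single_add H.add H.one flip: H.mult, simp add: mult_single)
  have mon: "H (single m 1) = monom_at ?\<theta> m" for m
  proof (induction m rule: poly_mapping_add_induct)
    case (single i n)
    show ?case
    proof (induction n)
      case (Suc n)
      have "single (single i (Suc n)) (1::'a) = single (single i 1) 1 * single (single i n) 1"
        by (simp add: mult_single flip: single_add)
      then show ?case using Suc by (simp add: H.mult monom_at_single)
    qed (simp add: H.one monom_at_0)
  next
    case (add a b)
    have "single (a + b) (1::'a) = single a 1 * single b 1"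
      by (simp add: mult_single)
    then show ?case using add by (simp add: H.mult monom_at_add)
  qed
  show ?thesis
  proof (induction s rule: poly_mapping_add_induct)
    case (single m c)
    have "H (single m c) = H (single 0 c * single m 1)" by (simp add: mult_single)
    also have "\<dots> = H (single 0 c) * H (single m 1)" by (rule H.mult)
    finally show ?case by (simp only: mon[of m] mpoly_eval_single[OF h])
  qed (simp add: H.add mpoly_eval_add[OF h])
qed

lemma mpoly_eval_id:
  fixes H :: "(('n::finite \<Rightarrow>\<^sub>0 nat) \<Rightarrow>\<^sub>0 'a::comm_ring_1) \<Rightarrow> ('n \<Rightarrow>\<^sub>0 nat) \<Rightarrow>\<^sub>0 'a"
  assumes H: "ring_map H" and "\<And>c. H (single 0 c) = single 0 c"
    and "\<And>i. H (single (single i 1) 1) = single (single i 1) 1"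
  shows "H s = s"
proof -
  have "ring_map (\<lambda>s :: ('n \<Rightarrow>\<^sub>0 nat) \<Rightarrow>\<^sub>0 'a. s)" by standard auto
  from ring_map_eq_mpoly_eval[OF this, of s] ring_map_eq_mpoly_eval[OF H, of s] assms(2,3)
  show ?thesis by simp
qed

text \<open>Horner evaluation with a simultaneous change of coefficients along \<open>h\<close>. Its
  values lie in another ring, so it can be iterated through nested polynomial rings.\<close>

definition poly_eval :: "('a::comm_ring_1 \<Rightarrow> 'b::comm_ring_1) \<Rightarrow> 'b \<Rightarrow> 'a poly \<Rightarrow> 'b"
  where "poly_eval h t p = fold_coeffs (\<lambda>a b. h a + t * b) p 0"

context
  fixes h :: "'a::comm_ring_1 \<Rightarrow> 'b::comm_ring_1" and t :: 'b
  assumes h: "ring_map h"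
begin

interpretation h: ring_map h by (rule h)

lemma poly_eval_0: "poly_eval h t 0 = 0"
  by (simp add: poly_eval_def)

lemma poly_eval_pCons: "poly_eval h t (pCons a p) = h a + t * poly_eval h t p"
  by (cases "p = 0 \<and> a = 0") (auto simp: poly_eval_def h.zero)

lemma poly_eval_add: "poly_eval h t (p + q) = poly_eval h t p + poly_eval h t q"
proof (induction p arbitrary: q)
  case (pCons a p)
  show ?case
    by (cases q) (simp add: poly_eval_pCons pCons.IH h.add distrib_left)
qed (simp add: poly_eval_0)

lemma poly_eval_smult: "poly_eval h t (smult a q) = h a * poly_eval h t q"
proof (induction q)
  case (pCons b q)
  then show ?case by (simp add: poly_eval_pCons h.mult distrib_left mult.left_commute)
qed (simp add: poly_eval_0)

lemma poly_eval_mult: "poly_eval h t (p * q) = poly_eval h t p * poly_eval h t q"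
proof (induction p)
  case (pCons a p)
  have "poly_eval h t (pCons a p * q) = h a * poly_eval h t q + t * poly_eval h t (p * q)"
    unfolding mult_pCons_left poly_eval_add poly_eval_smult poly_eval_pCons h.zero by simp
  also have "\<dots> = poly_eval h t (pCons a p) * poly_eval h t q"
    unfolding pCons.IH poly_eval_pCons distrib_right mult.assoc ..
  finally show ?case .
qed (simp add: poly_eval_0)

lemma ring_map_poly_eval: "ring_map (poly_eval h t)"
  by standard (simp_all add: poly_eval_add poly_eval_mult poly_eval_pCons poly_eval_0 h.one
      flip: pCons_one)

end

section \<open>An Eisenstein-type criterion by degrees\<close>

text \<open>Modulo \<open>n\<close> the weight at index \<open>i\<close> is \<open>d * i\<close>,
  and \<open>d\<close> is invertible modulo \<open>n\<close>. Indices below \<open>n\<close>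
  therefore have distinct weights, and the largest weight is attained only once.\<close>

lemma unique_weight_maximum:
  fixes P :: "'a::idom poly poly"
  assumes "coprime d n" "degree P < n" "P \<noteq> 0"
  obtains i0 where "coeff P i0 \<noteq> 0" "i0 < n"
    "\<And>i. i \<noteq> i0 \<Longrightarrow> coeff P i \<noteq> 0 \<Longrightarrow>
      n * degree (coeff P i) + d * i < n * degree (coeff P i0) + d * i0"
proof -
  define A where "A = {i. coeff P i \<noteq> 0}"
  define w where "w i = n * degree (coeff P i) + d * i" for i
  have A: "finite A" "A \<noteq> {}" "A \<subseteq> {..<n}"
  proof -
    show sub: "A \<subseteq> {..<n}"
      using assms(2) le_degree[of P] by (auto simp: A_def intro: le_less_trans)
    then show "finite A" by (rule finite_subset) simp
    show "A \<noteq> {}"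
      using assms(3) leading_coeff_neq_0[of P] unfolding A_def by blast
  qed
  have "Max (w ` A) \<in> w ` A" using A by (intro Max_in) auto
  then obtain i0 where i0: "i0 \<in> A" "w i0 = Max (w ` A)" by auto
  have le: "w i \<le> w i0" if "i \<in> A" for i using that A i0 by auto
  have "i = i0" if "i \<in> A" "w i = w i0" for i
  proof -
    have "int d * (int i - int i0) = int n * (int (degree (coeff P i0)) - int (degree (coeff P i)))"
      using that(2) unfolding w_def by (simp add: algebra_simps flip: of_nat_mult of_nat_add)
    then have "int n dvd int d * (int i - int i0)" by simp
    then have "int n dvd int i - int i0"
      using assms(1) by (simp add: coprime_dvd_mult_right_iff coprime_commute)
    moreover have "i < n" "i0 < n" using A(3) that(1) i0(1) by auto
    then have "\<bar>int i - int i0\<bar> < int n" by linarith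
    ultimately show ?thesis using dvd_imp_le_int[of "int i - int i0" "int n"] by linarith
  qed
  with le have "w i < w i0" if "i \<noteq> i0" "i \<in> A" for i using that le_neq_implies_less by metis
  with i0(1) A(3) show ?thesis by (intro that[of i0]) (auto simp: A_def w_def)
qed

text \<open>For degree reasons \<open>H\<close> has no terms from degree \<open>n\<close> on. Hence
  the coefficients of the product at \<open>k\<close> and \<open>k + n\<close> are
  \<open>g * coeff H k\<close> and \<open>coeff H k\<close>.\<close>

lemma coeff_mod_monic_product:
  fixes g :: "'a::idom" and P Q H :: "'a poly"
  assumes "degree P < n" "degree Q < n" "P * Q = (monom 1 n + [:g:]) * H" "k < n"
  shows "coeff (P * Q) k = g * coeff (P * Q) (k + n)"
proof -
  have deg: "degree (monom 1 n + [:g:] :: 'a poly) = n"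
    using assms(1) by (subst degree_add_eq_left) (simp_all add: degree_monom_eq)
  have H: "coeff H j = 0" if "j \<ge> n" for j
  proof (cases "H = 0")
    case False
    have "monom 1 n + [:g:] \<noteq> (0 :: 'a poly)" using deg assms(1) by force
    with False have "n + degree H = degree (P * Q)"
      unfolding assms(3) by (simp add: degree_mult_eq deg)
    also have "\<dots> \<le> degree P + degree Q" by (rule degree_mult_le)
    also have "\<dots> < n + n" using assms(1,2) by simp
    finally show ?thesis using that by (intro coeff_eq_0) simp
  qed simp
  have c: "coeff (P * Q) j = (if j < n then 0 else coeff H (j - n)) + g * coeff H j" for j
    unfolding assms(3) by (simp add: distrib_right coeff_monom_mult not_less)
  show ?thesis using assms(4) by (simp add: c H)
qed

text \<open>Give the element \<open>a T\<^sup>i\<close> (\<open>i < n\<close>, \<open>a\<close> a polynomial in a second variable) the weight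
  \<open>n deg a + deg g i\<close>. Since \<open>deg g\<close> is prime to \<open>n\<close>, distinct powers of \<open>T\<close> have
  distinct weights, and reduction modulo \<open>T\<^sup>n + g\<close> preserves weights. Hence the weight of a
  product is the sum of the weights.\<close>

lemma monic_binomial_prime_aux:
  fixes g :: "'a::idom poly" and P Q H :: "'a poly poly"
  assumes cop: "coprime (degree g) n" and g: "degree g > 0"
    and P: "degree P < n" and Q: "degree Q < n"
    and eq: "P * Q = (monom 1 n + [:g:]) * H"
  shows "P = 0 \<or> Q = 0"
proof (rule ccontr)
  assume "\<not> ?thesis"
  then have "P \<noteq> 0" "Q \<noteq> 0" by auto
  define d where "d = degree g"
  obtain i0 where i0: "coeff P i0 \<noteq> 0" "i0 < n" "\<And>i. i \<noteq> i0 \<Longrightarrow> coeff P i \<noteq> 0 \<Longrightarrow>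
      n * degree (coeff P i) + d * i < n * degree (coeff P i0) + d * i0"
    using unique_weight_maximum[OF _ P \<open>P \<noteq> 0\<close>] cop d_def by metis
  obtain j0 where j0: "coeff Q j0 \<noteq> 0" "j0 < n" "\<And>j. j \<noteq> j0 \<Longrightarrow> coeff Q j \<noteq> 0 \<Longrightarrow>
      n * degree (coeff Q j) + d * j < n * degree (coeff Q j0) + d * j0"
    using unique_weight_maximum[OF _ Q \<open>Q \<noteq> 0\<close>] cop d_def by metis
  define e where "e = degree (coeff P i0) + degree (coeff Q j0)"
  define W where "W = n * e + d * (i0 + j0)"
  define c where "c k = coeff (P * Q) k" for k
  have n: "n > 0" using P by simp
  have g0: "g \<noteq> 0" using g by auto
  have red: "c k = g * c (k + n)" if "k < n" for k
    unfolding c_def using P Q eq that by (rule coeff_mod_monic_product)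
  \<comment> \<open>Every pair other than \<open>(i0, j0)\<close> has a strictly smaller sum of
    weights, so it cannot contribute in weight \<open>W\<close> or above.\<close>
  have small: "coeff (coeff P i * coeff Q j) e' = 0"
    if "n * e' + d * (i + j) \<ge> W" "\<not> (i = i0 \<and> j = j0)" for i j e'
  proof (cases "coeff P i = 0 \<or> coeff Q j = 0")
    case False
    have "n * degree (coeff P i) + d * i \<le> n * degree (coeff P i0) + d * i0"
      using i0(3)[of i] False by (cases "i = i0") auto
    moreover have "n * degree (coeff Q j) + d * j \<le> n * degree (coeff Q j0) + d * j0"
      using j0(3)[of j] False by (cases "j = j0") auto
    moreover have "n * degree (coeff P i) + d * i < n * degree (coeff P i0) + d * i0 \<or>
        n * degree (coeff Q j) + d * j < n * degree (coeff Q j0) + d * j0"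
      using i0(3)[of i] j0(3)[of j] False that(2) by auto
    moreover have "W = (n * degree (coeff P i0) + d * i0) + (n * degree (coeff Q j0) + d * j0)"
      by (simp add: W_def e_def distrib_left)
    ultimately have "n * degree (coeff P i) + n * degree (coeff Q j) < n * e'"
      using that(1) unfolding distrib_left by linarith
    then have "degree (coeff P i * coeff Q j) < e'"
      using False n by (simp add: degree_mult_eq flip: distrib_left)
    then show ?thesis by (rule coeff_eq_0)
  qed auto
  have c_coeff: "coeff (c k) e' = (\<Sum>i\<le>k. coeff (coeff P i * coeff Q (k - i)) e')" for k e'
    by (simp add: c_def coeff_mult coeff_sum)
  have c_small: "coeff (c k) e' = 0" if "n * e' + d * k \<ge> W" "k \<noteq> i0 + j0" for k e'
    unfolding c_coeff using that by (intro sum.neutral ballI small) auto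
  have "coeff (c (i0 + j0)) e =
      (\<Sum>i\<le>i0+j0. if i = i0 then coeff (coeff P i0 * coeff Q j0) e else 0)"
    unfolding c_coeff by (intro sum.cong refl) (auto simp: W_def intro!: small)
  also have "\<dots> = coeff (coeff P i0 * coeff Q j0) e" by simp
  also have "\<dots> \<noteq> 0" using i0(1) j0(1) unfolding e_def by (simp add: coeff_mult_degree_sum)
  finally have c_top: "coeff (c (i0 + j0)) e \<noteq> 0" .
  show False
  proof (cases "i0 + j0 < n")
    \<comment> \<open>A term of degree \<open>e\<close> in \<open>g * c (k + n)\<close> would need
      degree at least \<open>e - d\<close> in \<open>c (k + n)\<close>, hence weight at least
      \<open>W\<close>; but only the index \<open>i0 + j0\<close> reaches this weight.\<close>
    case True
    define k where "k = i0 + j0"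
    have "coeff (g * c (k + n)) e = 0"
    proof (cases "c (k + n) = 0")
      case False
      then have "coeff (c (k + n)) (degree (c (k + n))) \<noteq> 0" by simp
      then have "n * degree (c (k + n)) + d * (k + n) < W"
        using c_small[of "degree (c (k + n))" "k + n"] n by (force simp: k_def)
      then have "n * (d + degree (c (k + n))) < n * e"
        by (simp add: W_def k_def algebra_simps)
      then show ?thesis using False g0 by (intro coeff_eq_0) (simp add: degree_mult_eq d_def)
    qed simp
    then show False using red[of k] c_top True by (simp add: k_def)
  next
    case False
    define k where "k = i0 + j0 - n"
    have k: "k < n" "k + n = i0 + j0" using False i0(2) j0(2) by (auto simp: k_def)
    have top: "coeff (c (k + n)) e \<noteq> 0" using c_top unfolding k(2) .
    then have "c (k + n) \<noteq> 0" "degree (c (k + n)) \<ge> e"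
      by (metis coeff_0, rule le_degree)
    \<comment> \<open>Now \<open>c k\<close> inherits degree at least \<open>d + e\<close> from
      \<open>c (k + n)\<close>. At index \<open>k\<close> this again has weight at least
      \<open>W\<close>, although \<open>k\<close> differs from \<open>i0 + j0\<close>.\<close>
    then have "c k \<noteq> 0" "degree (c k) \<ge> d + e"
      unfolding red[OF k(1)] using g0 by (simp_all add: degree_mult_eq d_def)
    moreover from this(2) have "n * (d + e) \<le> n * degree (c k)" by (rule mult_le_mono2)
    moreover have "W = n * (d + e) + d * k" unfolding W_def k(2)[symmetric] by (simp add: distrib_left)
    ultimately have "coeff (c k) (degree (c k)) = 0"
      using k(2) n by (intro c_small) linarith+
    then show False using \<open>c k \<noteq> 0\<close> by simp
  qed
qed

section \<open>The defining equation is prime\<close>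

lemma index4_cases [case_names 1 2 3 4]:
  fixes i :: 4
  obtains "i = 1" | "i = 2" | "i = 3" | "i = 4"
proof (cases i)
  case (of_int z)
  then have "0 \<le> z" "z < 4" by simp_all
  then have "z = 0 \<or> z = 1 \<or> z = 2 \<or> z = 3" by arith
  then show ?thesis using that of_int by auto
qed

lemma pvar_power: "pvar i ^ n = (single (single i n) 1 :: 'k::field mpoly4)"
proof (induction n)
  case (Suc n)
  have "pvar i ^ Suc n = pvar i * (single (single i n) 1 :: 'k mpoly4)" by (simp only: power_Suc Suc)
  also have "\<dots> = single (single i 1 + single i n) 1" by (simp add: pvar_def mult_single)
  finally show ?case by (simp flip: single_add)
qed simp

text \<open>In \<open>k[x\<^sub>2][y][z]\<close> the substitution \<open>x\<^sub>3 = y - z\<close>, \<open>x\<^sub>4 = z\<close> gives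
  \<open>x\<^sub>2\<^sup>7 + x\<^sub>3\<^sup>7 + x\<^sub>4\<^sup>7\<close> the degree \<open>6\<close> in \<open>z\<close>, which is prime to \<open>7\<close>.\<close>

definition nested_var :: "4 \<Rightarrow> 'k::field poly poly poly" where
  "nested_var i = (if i = 2 then [:[:[:0, 1:]:]:] else if i = 3 then [:[:0, 1:], -1:] else [:0, 1:])"

definition nested :: "'k::field mpoly4 \<Rightarrow> 'k poly poly poly" where
  "nested = mpoly_eval (\<lambda>c. [:[:[:c:]:]:]) nested_var"

text \<open>Here x1 is the outermost variable, so that f becomes a monic binomial
  \<open>monom 1 7 + [:diag_tail:]\<close>, the shape that the weight argument requires.\<close>

definition nested1 :: "'k::field mpoly4 \<Rightarrow> 'k poly poly poly poly" where
  "nested1 = mpoly_eval (\<lambda>c. [:[:[:[:c:]:]:]:]) (\<lambda>i. if i = 1 then [:0, 1:] else [:nested_var i:])"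

lemma ring_map_nested1: "ring_map nested1"
  unfolding nested1_def by (rule ring_map_mpoly_eval) (standard, simp_all add: one_pCons)

lemma nested1_const: "nested1 (single 0 c) = [:[:[:[:c:]:]:]:]"
  unfolding nested1_def by (rule mpoly_eval_const) (standard, simp_all add: one_pCons)

lemma nested1_var: "nested1 (pvar i) = (if i = 1 then [:0, 1:] else [:nested_var i:])"
  unfolding nested1_def pvar_def by (rule mpoly_eval_var) (standard, simp_all add: one_pCons)

text \<open>Left inverse of \<open>nested1\<close>: undoing x3 = y - z, x4 = z sends y to x3 + x4.
  It serves to show that \<open>nested1\<close> is injective.\<close>

definition unnested1 :: "'k::field poly poly poly poly \<Rightarrow> 'k mpoly4" where
  "unnested1 = poly_eval (poly_eval (poly_eval (poly_eval (single 0) (pvar 2)) (pvar 3 + pvar 4)) (pvar 4)) (pvar 1)"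

lemma unnested1_nested1: "unnested1 (nested1 s) = s"
proof (rule mpoly_eval_id)
  let ?h1 = "poly_eval (single 0 :: 'a \<Rightarrow> _) (pvar 2)"
  let ?h2 = "poly_eval ?h1 (pvar 3 + pvar 4)"
  let ?h3 = "poly_eval ?h2 (pvar 4)"
  have h: "ring_map (single 0 :: 'a \<Rightarrow> 'a mpoly4)" "ring_map ?h1" "ring_map ?h2" "ring_map ?h3"
    by (rule ring_map_const ring_map_poly_eval)+
  note hs = h[THEN ring_map.zero] h[THEN ring_map.one] ring_map.one[OF ring_map_poly_eval[OF h(4)]]
  interpret N: ring_map "nested1 :: 'a mpoly4 \<Rightarrow> _" by (rule ring_map_nested1)
  interpret M: ring_map "unnested1 :: _ \<Rightarrow> 'a mpoly4"
    unfolding unnested1_def by (rule ring_map_poly_eval[OF h(4)])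
  note ev = poly_eval_pCons[OF h(1)] poly_eval_pCons[OF h(2)] poly_eval_pCons[OF h(3)]
    poly_eval_pCons[OF h(4)] poly_eval_0[OF h(1)] poly_eval_0[OF h(2)] poly_eval_0[OF h(3)]
    poly_eval_0[OF h(4)]
  show "ring_map (\<lambda>s :: 'a mpoly4. unnested1 (nested1 s))"
    by standard (simp_all add: N.one N.add N.mult M.one M.add M.mult)
  show "unnested1 (nested1 (single 0 c)) = single 0 c" for c :: 'a
    by (simp add: nested1_const unnested1_def ev)
  have v: "unnested1 (nested1 (pvar i :: 'a mpoly4)) = pvar i" for i
    by (cases i rule: index4_cases)
      (simp_all add: nested1_var nested_var_def unnested1_def ev hs one_pCons[symmetric]
        ring_map.uminus[OF h(3)])
  show "unnested1 (nested1 (single (single i 1) 1)) = single (single i 1) (1 :: 'a)" for i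
    using v[of i] unfolding pvar_def .
qed

lemma nested1_eq_0_iff: "nested1 s = 0 \<longleftrightarrow> s = 0"
  using unnested1_nested1[of s] unnested1_nested1[of 0]
  by (metis ring_map.zero[OF ring_map_nested1])

section \<open>Remainders modulo f over the subring k[x2, x3, x4]\<close>

definition free1 :: "'k::field mpoly4 set" where
  "free1 = {a. \<forall>m. lookup a m \<noteq> 0 \<longrightarrow> lookup m 1 = 0}"

lemma free1_0: "0 \<in> free1"
  by (simp add: free1_def)

lemma free1_add: "a \<in> free1 \<Longrightarrow> b \<in> free1 \<Longrightarrow> a + b \<in> free1"
  unfolding free1_def by (auto simp: lookup_add) (metis add_0)

lemma free1_single: "lookup m 1 = 0 \<Longrightarrow> single m c \<in> free1"
  by (auto simp: free1_def lookup_single when_def)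

lemma free1_1: "1 \<in> free1"
  unfolding single_one[symmetric] by (rule free1_single) simp

lemma free1_uminus: "a \<in> free1 \<Longrightarrow> - a \<in> free1"
  by (simp add: free1_def)

lemma free1_mult: "a \<in> free1 \<Longrightarrow> b \<in> free1 \<Longrightarrow> a * b \<in> free1"
  unfolding free1_def using keys_mult[of a b]
  by (auto simp: in_keys_iff[symmetric] lookup_add dest!: subsetD)

lemma free1_pvar_power: "i \<noteq> 1 \<Longrightarrow> pvar i ^ n \<in> free1"
  by (simp add: pvar_power free1_single lookup_single_not_eq)

lemma nested1_free1:
  fixes a :: "'k::field mpoly4"
  assumes "a \<in> free1"
  shows "nested1 a = [:nested a:]"
proof -
  have mon: "monom_at (\<lambda>i. if i = 1 then [:0, 1:] else [:nested_var i:]) m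
      = [:monom_at nested_var m :: 'k poly poly poly:]" if "lookup m 1 = 0" for m :: "4 \<Rightarrow>\<^sub>0 nat"
  proof -
    have "ring_map (\<lambda>b :: 'k poly poly poly. [:b:])" by standard (simp_all add: one_pCons)
    note C = ring_map.prod[OF this] ring_map.power[OF this]
    show ?thesis
      unfolding monom_at_def C by (intro prod.cong) (use that in auto)
  qed
  have "ring_map (\<lambda>b :: 'k poly poly poly. [:b:])" by standard (simp_all add: one_pCons)
  note C = ring_map.sum[OF this]
  show ?thesis
    unfolding nested1_def nested_def mpoly_eval_def C using assms
    by (auto intro!: sum.cong simp: in_keys_iff free1_def mon)
qed

text \<open>The remainders of division by f in the variable x1: S/(f) is free over k[x2, x3, x4]
  with basis 1, x1, ..., x1^6.\<close>

definition combine1 :: "(nat \<Rightarrow> 'k mpoly4) \<Rightarrow> 'k::field mpoly4" where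
  "combine1 a = (\<Sum>i<7. a i * pvar 1 ^ i)"

lemma nested1_combine1:
  assumes "\<And>i. a i \<in> free1"
  shows "nested1 (combine1 a) = (\<Sum>i<7. monom (nested (a i)) i)"
proof -
  interpret N: ring_map "nested1 :: 'a mpoly4 \<Rightarrow> _" by (rule ring_map_nested1)
  show ?thesis
    unfolding combine1_def
    by (simp add: N.sum N.mult N.power nested1_var nested1_free1 assms monom_altdef)
qed

lemma coeff_nested1_combine1:
  assumes "\<And>i. a i \<in> free1"
  shows "coeff (nested1 (combine1 a)) k = (if k < 7 then nested (a k) else 0)"
  by (simp add: nested1_combine1 assms coeff_sum if_distrib sum.delta cong: if_cong)

lemma degree_nested1_combine1:
  assumes "\<And>i. a i \<in> free1"
  shows "degree (nested1 (combine1 a)) < 7"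
proof -
  have "degree (nested1 (combine1 a)) \<le> 6"
    by (rule degree_le) (simp add: coeff_nested1_combine1 assms)
  then show ?thesis by simp
qed

text \<open>Rewriting x1^7 as -(x2^7 + x3^7 + x4^7) lowers the exponent of x1 by 7, so the recursion
  on this exponent ends below 7.\<close>

lemma exists_combine1_single:
  "\<exists>a. (\<forall>i. a i \<in> free1) \<and> diag_poly dvd single m c - combine1 a" (is "?P (single m c)")
proof (induction "lookup m 1" arbitrary: m c rule: less_induct)
  case less
  have add: "?P (s + t)" if st: "?P s" "?P t" for s t
  proof -
    obtain a b where "\<forall>i. a i \<in> free1" "diag_poly dvd s - combine1 a"
      "\<forall>i. b i \<in> free1" "diag_poly dvd t - combine1 b"
      using st by blast
    moreover from this have "diag_poly dvd (s - combine1 a) + (t - combine1 b)"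
      by (intro dvd_add)
    ultimately show ?thesis
      by (intro exI[of _ "\<lambda>i. a i + b i"])
        (auto simp: free1_add combine1_def distrib_right sum.distrib algebra_simps)
  qed
  show ?case
  proof (cases "lookup m 1 < 7")
    case True
    define m' where "m' = m - single 1 (lookup m 1)"
    define a where "a i = (if i = lookup m 1 then single m' c else 0)" for i
    have "m = m' + single 1 (lookup m 1)"
      by (rule poly_mapping_eqI) (simp add: m'_def lookup_add lookup_minus lookup_single when_def)
    then have "single m c = combine1 a"
      unfolding combine1_def a_def using True
      by (simp add: if_distrib if_distribR sum.delta mult_single pvar_power cong: if_cong)
    moreover have "a i \<in> free1" for i
      unfolding a_def m'_def by (auto intro!: free1_single simp: free1_0 lookup_minus)
    ultimately show ?thesis by (intro exI[of _ a]) simp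
  next
    case False
    define m' where "m' = m - single 1 7"
    have m: "m = m' + single 1 7"
      by (rule poly_mapping_eqI) (use False in \<open>auto simp: m'_def lookup_add lookup_minus lookup_single when_def\<close>)
    have IH: "?P (single (m' + single j 7) (- c))" if "j \<noteq> 1" for j
    proof (rule less)
      show "lookup (m' + single j 7) 1 < lookup m 1"
        using False that by (auto simp: m'_def lookup_add lookup_minus lookup_single when_def)
    qed
    define r where "r = single (m' + single 2 7) (- c) + single (m' + single 3 7) (- c) +
      single (m' + single 4 7) (- c)"
    have "?P r" unfolding r_def by (intro add IH) simp_all
    then obtain a where a: "\<forall>i. a i \<in> free1" "diag_poly dvd r - combine1 a" by blast
    have "single m c = diag_poly * single m' c + r"
      unfolding diag_poly_def pvar_power r_def
      by (simp add: m distrib_right mult_single add_ac single_uminus)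
    then have "single m c - combine1 a = diag_poly * single m' c + (r - combine1 a)" by simp
    also have "diag_poly dvd \<dots>" using a(2) by (intro dvd_add) auto
    finally show ?thesis using a(1) by blast
  qed
qed

lemma exists_combine1:
  "\<exists>a. (\<forall>i. a i \<in> free1) \<and> diag_poly dvd s - combine1 a"
proof (induction s rule: poly_mapping_add_induct)
  case (single m c)
  show ?case by (rule exists_combine1_single)
next
  case (add s t)
  then obtain a b where "\<forall>i. a i \<in> free1" "diag_poly dvd s - combine1 a"
      "\<forall>i. b i \<in> free1" "diag_poly dvd t - combine1 b"
    by blast
  moreover from this have "diag_poly dvd (s - combine1 a) + (t - combine1 b)"
    by (intro dvd_add)
  ultimately show ?case
    by (intro exI[of _ "\<lambda>i. a i + b i"])
      (auto simp: free1_add combine1_def distrib_right sum.distrib algebra_simps)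
qed

definition diag_tail :: "'k::field poly poly poly" where
  "diag_tail = [:[:[:0, 1:]:]:] ^ 7 + [:[:0, 1:], -1:] ^ 7 + [:0, 1:] ^ 7"

lemma nested1_diag_poly: "nested1 diag_poly = monom 1 7 + [:diag_tail:]"
proof -
  interpret N: ring_map "nested1 :: 'a mpoly4 \<Rightarrow> _" by (rule ring_map_nested1)
  have C: "ring_map (\<lambda>b :: 'a poly poly poly. [:b:])" by standard (simp_all add: one_pCons)
  show ?thesis
    unfolding diag_poly_def diag_tail_def
    by (simp add: N.add N.power nested1_var nested_var_def monom_altdef ring_map.power[OF C, symmetric])
qed

lemma three_eq_0: "CHAR('a::comm_ring_1) = 3 \<Longrightarrow> (3 :: 'a) = 0"
  by (metis of_nat_CHAR of_nat_numeral)

text \<open>In characteristic 3, (y - z)^7 = (y^3 - z^3)^2 (y - z) begins with -z^7 + y z^6. Adding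
  z^7 cancels the top term and leaves y z^6.\<close>

lemma degree_diag_tail:
  assumes "CHAR('k::field) = 3"
  shows "degree (diag_tail :: 'k poly poly poly) = 6"
proof -
  define y :: "'k poly poly" where "y = [:0, 1:]"
  have "(3 :: 'k poly poly) = 0" using three_eq_0[OF assms] by (simp add: numeral_poly)
  then have y3: "z + (z + z) = 0" for z :: "'k poly poly"
    using mult_zero_left[of z] by (simp add: numeral_3_eq_3 flip: distrib_right)
  have "[:y, -1:] ^ 3 = [:y * (y * y), - (y * y + (y * y + y * y)), y + (y + y), -1:]"
    by (simp add: power3_eq_cube)
  then have c: "[:y, -1:] ^ 3 = [:y^3, 0, 0, -1:]" by (simp only: y3) (simp add: power3_eq_cube)
  have "[:y, -1:] ^ 7 = ([:y, -1:] ^ 3) ^ 2 * [:y, -1:]"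
    by (simp only: flip: power_mult power_Suc2) simp
  also have "\<dots> = [:y^7, - (y^6), 0, - (2 * y^4), 2 * y^3, 0, y, -1:]"
    unfolding c by (simp add: power2_eq_square flip: power_add power_Suc power_Suc2)
  finally have p7: "[:y, -1:] ^ 7 = [:y^7, - (y^6), 0, - (2 * y^4), 2 * y^3, 0, y, -1:]" .
  have "[:0, 1 :: 'k poly poly:] ^ 7 = monom 1 7" by (simp add: monom_altdef)
  also have "\<dots> = [:0, 0, 0, 0, 0, 0, 0, 1:]" by (simp add: monom_Suc eval_nat_numeral)
  finally have x7: "[:0, 1 :: 'k poly poly:] ^ 7 = [:0, 0, 0, 0, 0, 0, 0, 1:]" .
  have C: "ring_map (\<lambda>b :: 'k poly poly. [:b:])" by standard (simp_all add: one_pCons)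
  have "y \<noteq> 0" by (simp add: y_def)
  then show ?thesis
    unfolding diag_tail_def y_def[symmetric] p7 x7 ring_map.power[OF C, symmetric] by simp
qed

text \<open>Both factors may be replaced by their remainders of degree below 7 in x1; the weight
  argument then applies with n = 7 and d = 6.\<close>

lemma diag_poly_prime:
  assumes char: "CHAR('k::field) = 3" and dvd: "(diag_poly :: 'k mpoly4) dvd s * t"
  shows "diag_poly dvd s \<or> diag_poly dvd t"
proof -
  obtain a where a: "\<And>i. a i \<in> free1" "diag_poly dvd s - combine1 a"
    using exists_combine1 by blast
  obtain b where b: "\<And>i. b i \<in> free1" "diag_poly dvd t - combine1 b"
    using exists_combine1 by blast
  have "diag_poly dvd s * t - (s - combine1 a) * t - combine1 a * (t - combine1 b)"
    by (intro dvd_diff dvd dvd_mult2[OF a(2)] dvd_mult[OF b(2)])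
  then have "diag_poly dvd combine1 a * combine1 b" by (simp add: algebra_simps)
  then obtain h where "combine1 a * combine1 b = diag_poly * h" by (auto simp: dvd_def)
  then have "nested1 (combine1 a) * nested1 (combine1 b) = (monom 1 7 + [:diag_tail:]) * nested1 h"
    unfolding nested1_diag_poly[symmetric] by (metis ring_map.mult[OF ring_map_nested1])
  moreover have "coprime (degree (diag_tail :: 'k poly poly poly)) 7"
    using coprime_Suc_right_nat[of 6] by (simp add: degree_diag_tail[OF char])
  ultimately have "nested1 (combine1 a) = 0 \<or> nested1 (combine1 b) = 0"
    using degree_diag_tail[OF char]
    by (intro monic_binomial_prime_aux[OF _ _ degree_nested1_combine1[OF a(1)]
          degree_nested1_combine1[OF b(1)]]) simp_all
  then have "combine1 a = 0 \<or> combine1 b = 0" by (simp add: nested1_eq_0_iff)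
  then show ?thesis using a(2) b(2) by auto
qed

text \<open>Fraction-free Gaussian elimination: a coordinate is eliminated against a pivot by
  cross-multiplication, so that all coefficients stay in the subring \<open>A\<close>. In the
  application \<open>A\<close> is \<open>free1\<close>.\<close>

lemma exists_linear_dependence:
  fixes v :: "'b \<Rightarrow> 'c \<Rightarrow> 'a::idom"
  assumes "finite I" "finite K" "card I < card K"
    and A: "1 \<in> A" "\<And>x y. x \<in> A \<Longrightarrow> y \<in> A \<Longrightarrow> x + y \<in> A" "\<And>x. x \<in> A \<Longrightarrow> - x \<in> A"
      "\<And>x y. x \<in> A \<Longrightarrow> y \<in> A \<Longrightarrow> x * y \<in> A"
    and "\<And>k i. k \<in> K \<Longrightarrow> i \<in> I \<Longrightarrow> v k i \<in> A"
  shows "\<exists>\<alpha>. (\<forall>k\<in>K. \<alpha> k \<in> A) \<and> (\<exists>k\<in>K. \<alpha> k \<noteq> 0) \<and> (\<forall>i\<in>I. (\<Sum>k\<in>K. \<alpha> k * v k i) = 0)"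
  using assms(1-3,8)
proof (induction I arbitrary: K v rule: finite_induct)
  case empty
  then have "K \<noteq> {}" by auto
  then show ?case using A(1) by (intro exI[of _ "\<lambda>_. 1"]) auto
next
  case (insert j I)
  have sumA: "sum F B \<in> A" if "\<And>x. x \<in> B \<Longrightarrow> F x \<in> A" for F :: "'b \<Rightarrow> 'a" and B
    using that A(2)[of 1 "- 1"] A
    by (induction B rule: infinite_finite_induct) auto
  show ?case
  proof (cases "\<forall>k\<in>K. v k j = 0")
    case True
    have "\<exists>\<alpha>. (\<forall>k\<in>K. \<alpha> k \<in> A) \<and> (\<exists>k\<in>K. \<alpha> k \<noteq> 0) \<and> (\<forall>i\<in>I. (\<Sum>k\<in>K. \<alpha> k * v k i) = 0)"
      using insert by (intro insert.IH) auto
    then show ?thesis using True by auto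
  next
    case False
    then obtain p where p: "p \<in> K" "v p j \<noteq> 0" by auto
    define K' where "K' = K - {p}"
    have "\<exists>\<alpha>. (\<forall>k\<in>K'. \<alpha> k \<in> A) \<and> (\<exists>k\<in>K'. \<alpha> k \<noteq> 0) \<and>
        (\<forall>i\<in>I. (\<Sum>k\<in>K'. \<alpha> k * (v p j * v k i + - (v k j * v p i))) = 0)"
      using insert.prems insert.hyps p
      by (intro insert.IH A) (auto simp: K'_def)
    then obtain \<alpha> where \<alpha>: "\<And>k. k \<in> K' \<Longrightarrow> \<alpha> k \<in> A" "\<exists>k\<in>K'. \<alpha> k \<noteq> 0"
        "\<And>i. i \<in> I \<Longrightarrow> (\<Sum>k\<in>K'. \<alpha> k * (v p j * v k i + - (v k j * v p i))) = 0"
      by blast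
    \<comment> \<open>A relation among the eliminated vectors is lifted back; the pivot receives the
      coefficient that cancels coordinate \<open>j\<close>.\<close>
    define \<beta> where "\<beta> k = (if k = p then - (\<Sum>k\<in>K'. \<alpha> k * v k j) else \<alpha> k * v p j)" for k
    have sum: "(\<Sum>k\<in>K. \<beta> k * v k i) = (\<Sum>k\<in>K'. \<alpha> k * (v p j * v k i + - (v k j * v p i)))" for i
    proof -
      have "(\<Sum>k\<in>K. \<beta> k * v k i) = \<beta> p * v p i + (\<Sum>k\<in>K'. \<beta> k * v k i)"
        unfolding K'_def using p(1) insert.prems(1) by (simp add: sum.remove)
      also have "(\<Sum>k\<in>K'. \<beta> k * v k i) = (\<Sum>k\<in>K'. \<alpha> k * v p j * v k i)"
        by (intro sum.cong) (auto simp: \<beta>_def K'_def)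
      also have "\<beta> p * v p i = (\<Sum>k\<in>K'. - (\<alpha> k * v k j * v p i))"
        by (simp add: \<beta>_def sum_distrib_right sum_negf)
      also have "\<dots> + (\<Sum>k\<in>K'. \<alpha> k * v p j * v k i) =
          (\<Sum>k\<in>K'. \<alpha> k * (v p j * v k i + - (v k j * v p i)))"
        unfolding sum.distrib[symmetric] by (intro sum.cong refl) (simp only: algebra_simps mult_minus_right)
      finally show ?thesis .
    qed
    have "\<beta> k \<in> A" if "k \<in> K" for k
      using that \<alpha>(1) insert.prems(3) p(1)
      by (auto simp: \<beta>_def K'_def intro!: A sumA)
    moreover have "\<exists>k\<in>K. \<beta> k \<noteq> 0"
      using \<alpha>(2) p(2) by (auto simp: \<beta>_def K'_def)
    moreover have "(\<Sum>k\<in>K. \<beta> k * v k i) = 0" if "i \<in> insert j I" for i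
      using that \<alpha>(3) unfolding sum by (auto simp: mult.commute)
    ultimately show ?thesis by blast
  qed
qed

text \<open>The eight powers 1, c, ..., c^7 lie in a module of rank 7 over k[x2, x3, x4], so they
  satisfy a relation modulo f. Once the lowest occurring power of c is cancelled, the constant term
  of the relation is nonzero and a multiple of c modulo f.\<close>

lemma exists_free1_multiple:
  fixes c :: "'k::field mpoly4"
  assumes char: "CHAR('k) = 3" and c: "\<not> diag_poly dvd c"
  obtains d a where "a \<in> free1" "a \<noteq> 0" "diag_poly dvd d * c - a"
proof -
  have "\<exists>a. (\<forall>i. a i \<in> free1) \<and> diag_poly dvd c ^ k - combine1 a" for k
    by (rule exists_combine1)
  then obtain v where v: "\<And>k i. v k i \<in> free1" "\<And>k. diag_poly dvd c ^ k - combine1 (v k)"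
    by metis
  have "\<exists>\<alpha>. (\<forall>k\<in>{..7::nat}. \<alpha> k \<in> free1) \<and> (\<exists>k\<in>{..7}. \<alpha> k \<noteq> 0) \<and>
      (\<forall>i\<in>{..<7::nat}. (\<Sum>k\<in>{..7}. \<alpha> k * v k i) = 0)"
    by (rule exists_linear_dependence)
      (auto simp: v free1_1 intro: free1_add free1_uminus free1_mult)
  then obtain \<alpha> where \<alpha>: "\<And>k. k \<le> 7 \<Longrightarrow> \<alpha> k \<in> free1" "\<exists>k. k \<le> 7 \<and> \<alpha> k \<noteq> 0"
      "\<And>i. i < 7 \<Longrightarrow> (\<Sum>k\<le>7. \<alpha> k * v k i) = 0"
    by auto
  have "(\<Sum>k\<le>7. \<alpha> k * combine1 (v k)) = (\<Sum>i<7. (\<Sum>k\<le>7. \<alpha> k * v k i) * pvar 1 ^ i)"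
    unfolding combine1_def sum_distrib_left sum_distrib_right mult.assoc by (rule sum.swap)
  also have "\<dots> = 0" using \<alpha>(3) by simp
  finally have "(\<Sum>k\<le>7. \<alpha> k * c ^ k) = (\<Sum>k\<le>7. \<alpha> k * (c ^ k - combine1 (v k)))"
    by (simp add: right_diff_distrib sum_subtractf)
  also have "diag_poly dvd \<dots>" using v(2) by (intro dvd_sum) auto
  finally have dvd: "diag_poly dvd (\<Sum>k\<le>7. \<alpha> k * c ^ k)" .
  define k0 where "k0 = (LEAST k. k \<le> 7 \<and> \<alpha> k \<noteq> 0)"
  have k0: "k0 \<le> 7" "\<alpha> k0 \<noteq> 0"
    using LeastI_ex[OF \<alpha>(2)] by (auto simp: k0_def)
  have below: "\<alpha> k = 0" if "k < k0" for k
    using not_less_Least[of k "\<lambda>k. k \<le> 7 \<and> \<alpha> k \<noteq> 0"] that k0(1) by (auto simp: k0_def)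
  define e where "e = (\<Sum>k\<in>{k0<..7}. \<alpha> k * c ^ (k - k0 - 1))"
  have "(\<Sum>k\<le>7. \<alpha> k * c ^ k) = (\<Sum>k\<in>{k0..7}. \<alpha> k * c ^ k)"
    by (rule sum.mono_neutral_right) (auto simp: below not_le)
  also have "{k0..7} = insert k0 {k0<..7}" using k0(1) by auto
  also have "(\<Sum>k\<in>\<dots>. \<alpha> k * c ^ k) = \<alpha> k0 * c ^ k0 + (\<Sum>k\<in>{k0<..7}. \<alpha> k * c ^ k)"
    by simp
  also have "(\<Sum>k\<in>{k0<..7}. \<alpha> k * c ^ k) = c ^ k0 * (c * e)"
    unfolding e_def sum_distrib_left
  proof (intro sum.cong refl)
    fix k assume "k \<in> {k0<..7}"
    then have "c ^ k = c ^ k0 * (c * c ^ (k - k0 - 1))" by (simp flip: power_Suc power_add)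
    then have "\<alpha> k * c ^ k = \<alpha> k * (c ^ k0 * (c * c ^ (k - k0 - 1)))" by (rule arg_cong)
    also have "\<dots> = c ^ k0 * (c * (\<alpha> k * c ^ (k - k0 - 1)))" by (simp only: mult_ac)
    finally show "\<alpha> k * c ^ k = \<dots>" .
  qed
  also have "\<alpha> k0 * c ^ k0 + c ^ k0 * (c * e) = c ^ k0 * (\<alpha> k0 + c * e)"
    by (simp only: distrib_left mult.commute[of "\<alpha> k0"])
  finally have "diag_poly dvd c ^ k0 * (\<alpha> k0 + c * e)"
    using dvd by simp
  \<comment> \<open>Primality keeps f from dividing a power of c, so the factor
    \<open>c ^ k0\<close> can be removed.\<close>
  moreover have "\<not> diag_poly dvd c ^ n" for n
  proof (induction n)
    case 0
    have "\<not> (diag_poly :: 'k mpoly4) dvd 1"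
    proof
      assume "(diag_poly :: 'k mpoly4) dvd 1"
      then obtain h :: "'k mpoly4" where "1 = diag_poly * h" by (auto simp: dvd_def)
      then have "lookup (1 :: 'k mpoly4) 0 = lookup (diag_poly * h) 0" by simp
      then show False by (simp add: lookup_mult_0 lookup_diag_poly_0)
    qed
    then show ?case by simp
  next
    case (Suc n)
    then show ?case using diag_poly_prime[OF char] c by auto
  qed
  ultimately have "diag_poly dvd \<alpha> k0 + c * e"
    using diag_poly_prime[OF char] by blast
  then have "diag_poly dvd - (\<alpha> k0 + c * e)" by (simp only: dvd_minus_iff)
  also have "- (\<alpha> k0 + c * e) = (- e) * c - \<alpha> k0" by (simp add: mult.commute)
  finally show ?thesis using k0 \<alpha>(1) that by blast
qed

section \<open>The local ring\<close>

definition loc :: "'k::field mpoly4 \<Rightarrow> 'k diag_local" where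
  "loc s = to_local (diag_class s)"

lemma ring_map_loc: "ring_map loc"
  by standard (simp_all add: loc_def diag_class_add diag_class_mult to_local_add to_local_mult
      one_diag_ring_def[symmetric] to_local_1)

interpretation loc: ring_map loc by (rule ring_map_loc)

lemma loc_pvar: "loc (pvar i) = local_var i"
  by (simp add: loc_def local_var_def diag_var_def)

lemma diag_class_eq_0_iff: "diag_class a = 0 \<longleftrightarrow> diag_poly dvd a"
  unfolding zero_diag_ring_def diag_ring.abs_eq_iff diag_rel_def ideal.span_singleton dvd_def
  by (auto simp: mult.commute)

lemma diag_class_in_max_iff: "diag_class s \<in> diag_max_ideal \<longleftrightarrow> lookup s 0 = 0"
  by (simp add: diag_max_ideal_iff const_coeff.abs_eq)

lemma loc_fraction: obtains a s where "lookup s 0 \<noteq> 0" "y * loc s = loc a"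
proof -
  obtain a s where "s \<notin> diag_max_ideal" "y * to_local s = to_local a"
    using local_fraction by blast
  moreover obtain a' s' where "a = diag_class a'" "s = diag_class s'"
    using diag_class_exhaust by metis
  ultimately show ?thesis using that[of s' a'] by (simp add: loc_def diag_class_in_max_iff)
qed

lemma loc_unit: 
  assumes "lookup s 0 \<noteq> 0" obtains t where "loc s * t = 1"
  using assms to_local_unit[of "diag_class s"] by (auto simp: loc_def diag_class_in_max_iff)

lemma loc_unit_cancel:
  assumes "lookup s 0 \<noteq> 0" shows "y * loc s = z * loc s \<longleftrightarrow> y = z"
proof -
  obtain t where "loc s * t = 1" using assms by (rule loc_unit)
  then show ?thesis by (metis mult.assoc mult.right_neutral)
qed

lemma not_diag_poly_dvd_unit: "lookup s 0 \<noteq> 0 \<Longrightarrow> \<not> diag_poly dvd s"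
  by (auto simp: dvd_def lookup_mult_0 lookup_diag_poly_0)

text \<open>A witness w for the vanishing of a fraction has nonzero constant term, whereas f has
  constant term 0. So f divides w a but not w, and primality moves it to a.\<close>

lemma loc_eq_0_iff:
  assumes "CHAR('k::field) = 3"
  shows "loc (a :: 'k mpoly4) = 0 \<longleftrightarrow> diag_poly dvd a"
proof
  assume "loc a = 0"
  then have "to_local (diag_class a) = to_local (diag_class 0)" 
    using loc.zero by (simp add: loc_def)
  then obtain w where "w \<notin> diag_max_ideal" "w * (diag_class a - diag_class 0) = 0"
    unfolding to_local_eq_iff by blast
  moreover obtain w' where "w = diag_class w'" by (rule diag_class_exhaust)
  ultimately have "lookup w' 0 \<noteq> 0" "diag_poly dvd w' * a"
    by (simp_all add: diag_class_in_max_iff diag_class_eq_0_iff[symmetric] diag_class_mult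
        zero_diag_ring_def[symmetric])
  then show "diag_poly dvd a"
    using diag_poly_prime[OF assms] not_diag_poly_dvd_unit by blast
next
  assume "diag_poly dvd a"
  then have "diag_class a = 0" by (simp add: diag_class_eq_0_iff)
  also have "\<dots> = diag_class 0" by (simp only: zero_diag_ring_def)
  finally show "loc a = 0" using loc.zero by (simp add: loc_def)
qed

lemma local_no_zero_divisors:
  fixes y z :: "'k::field diag_local"
  assumes char: "CHAR('k) = 3" and "y * z = 0"
  shows "y = 0 \<or> z = 0"
proof -
  obtain a s where a: "lookup s 0 \<noteq> 0" "y * loc s = loc a" by (rule loc_fraction)
  obtain b t where b: "lookup t 0 \<noteq> 0" "z * loc t = loc b" by (rule loc_fraction)
  have "loc (a * b) = (y * loc s) * (z * loc t)" by (simp only: loc.mult a(2) b(2))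
  also have "\<dots> = (y * z) * (loc s * loc t)" by (simp only: mult_ac)
  also have "\<dots> = 0" by (simp add: assms)
  finally have "loc a = 0 \<or> loc b = 0"
    using diag_poly_prime[OF char] by (simp add: loc_eq_0_iff[OF char])
  then show ?thesis
    using a b loc_unit_cancel[of s y 0] loc_unit_cancel[of t z 0] by auto
qed

lemma char_local:
  assumes char: "CHAR('k::field) = 3" shows "CHAR('k diag_local) = 3"
proof (rule CHAR_eqI)
  have of_nat: "of_nat n = loc (single 0 (of_nat n :: 'k))" for n
  proof (induction n)
    case 0
    show ?case by (simp add: loc.zero)
  next
    case (Suc n)
    then show ?case by (simp add: single_add loc.add loc.one)
  qed
  show "of_nat 3 = (0 :: 'k diag_local)"
    unfolding of_nat using three_eq_0[OF char] by (simp add: loc.zero)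
  show "3 dvd n" if "of_nat n = (0 :: 'k diag_local)" for n
  proof -
    have "lookup (single (0 :: 4 \<Rightarrow>\<^sub>0 nat) (of_nat n :: 'k)) 0 = 0"
      using that not_diag_poly_dvd_unit[of "single 0 (of_nat n :: 'k)"]
      unfolding of_nat loc_eq_0_iff[OF char] by blast
    then have "of_nat n = (0 :: 'k)" by (simp only: lookup_single_eq)
    then show ?thesis using of_nat_eq_0_iff_char_dvd[of n, where ?'a = 'k] char by simp
  qed
qed

text \<open>What this yields for tight closure: a multiplier lies outside every minimal prime, hence
  it is nonzero.\<close>

lemma minimal_prime_0:
  assumes char: "CHAR('k::field) = 3" shows "minimal_prime {0 :: 'k diag_local}"
proof -
  have "(1 :: 'k diag_local) \<noteq> 0" by simp
  then have "{0 :: 'k diag_local} \<noteq> UNIV" by blast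
  moreover have "0 \<in> Q" if "prime_ideal Q" for Q :: "'k diag_local set"
    using that by (auto simp: prime_ideal_def ideal.subspace_def)
  ultimately show ?thesis
    unfolding minimal_prime_def prime_ideal_def
    using local_no_zero_divisors[OF char]
    by (auto simp: ideal.subspace_def prime_ideal_def)
qed

lemma one_notin_minimal_prime: "minimal_prime P \<Longrightarrow> 1 \<notin> (P :: 'a::comm_ring_1 set)"
  unfolding minimal_prime_def prime_ideal_def
  by (metis UNIV_I ideal.subspace_scale mult.right_neutral subsetI subset_antisym)

section \<open>Cartier operators\<close>

lemma frobenius_add:
  assumes "CHAR('a::comm_ring_1) = 3"
  shows "(x + y :: 'a) ^ 3 ^ e = x ^ 3 ^ e + y ^ 3 ^ e"
  using freshmans_dream'[of "3 ^ e" e x y] assms by (simp add: two_is_prime_nat prime_nat_numeral_eq)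

lemma char_mpoly4:
  assumes "CHAR('k::field) = 3" shows "CHAR('k mpoly4) = 3"
proof (rule CHAR_eqI)
  show "of_nat 3 = (0 :: 'k mpoly4)"
    unfolding single_of_nat[symmetric] using three_eq_0[OF assms] by simp
  show "3 dvd n" if "of_nat n = (0 :: 'k mpoly4)" for n
  proof -
    have "lookup (of_nat n :: 'k mpoly4) 0 = 0" using that by simp
    then have "of_nat n = (0 :: 'k)" by (simp add: lookup_of_nat)
    then show ?thesis using of_nat_eq_0_iff_char_dvd[of n, where ?'a = 'k] assms by simp
  qed
qed

text \<open>The value at 1 is left open: the normalization is made at a coefficient that depends on
  the use.\<close>

definition frobenius_splitting :: "nat \<Rightarrow> ('k::field \<Rightarrow> 'k) \<Rightarrow> bool" where
  "frobenius_splitting q \<phi> \<longleftrightarrow> (\<forall>a b. \<phi> (a + b) = \<phi> a + \<phi> b) \<and> (\<forall>a b. \<phi> (a ^ q * b) = a * \<phi> b)"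

text \<open>Through \<open>a ^ 3 ^ e * b\<close> the field is a vector space over itself, by
  additivity of Frobenius. Extending \<open>c\<close> to a basis gives a linear map from this
  structure to the usual one with value 1 at \<open>c\<close>.\<close>

lemma exists_frobenius_splitting:
  fixes c :: "'k::field"
  assumes char: "CHAR('k) = 3" and c: "c \<noteq> 0"
  obtains \<phi> where "frobenius_splitting (3 ^ e) \<phi>" "\<phi> c = 1"
proof -
  have "vector_space (\<lambda>a b :: 'k. a ^ 3 ^ e * b)"
    by unfold_locales
      (simp_all only: distrib_left distrib_right frobenius_add[OF char] power_mult_distrib mult.assoc
        power_one mult_1_left)
  moreover have "vector_space ((*) :: 'k \<Rightarrow> _)"
    by unfold_locales (simp_all only: distrib_left distrib_right mult.assoc mult_1_left)
  ultimately interpret V: vector_space_pair "\<lambda>a b :: 'k. a ^ 3 ^ e * b" "(*)"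
    by (rule vector_space_pair.intro)
  have "V.vs1.independent {c}" using c by (simp add: V.vs1.dependent_single)
  then obtain \<phi> where \<phi>: "Vector_Spaces.linear (\<lambda>a b :: 'k. a ^ 3 ^ e * b) (*) \<phi>" "\<phi> c = 1"
    using V.linear_independent_extend[of "{c}" "\<lambda>_. 1"] by auto
  interpret L: Vector_Spaces.linear "\<lambda>a b :: 'k. a ^ 3 ^ e * b" "(*)" \<phi> by (rule \<phi>)
  show ?thesis using that[of \<phi>] \<phi>(2) by (simp add: frobenius_splitting_def L.add L.scale)
qed

text \<open>Exponent q m + (q - 1) in every variable: these are the monomials that
  \<open>cartier\<close> can send to a multiple of x^m, as the standard generator of the
  q-inverse-linear operators does.\<close>

definition stretch :: "nat \<Rightarrow> ('n::finite \<Rightarrow>\<^sub>0 nat) \<Rightarrow> 'n \<Rightarrow>\<^sub>0 nat" where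
  "stretch q m = Abs_poly_mapping (\<lambda>i. q * lookup m i + (q - 1))"

lemma lookup_stretch: "lookup (stretch q m) i = q * lookup m i + (q - 1)"
  by (simp add: stretch_def)

lemma stretch_eq_iff:
  assumes "q > 0" shows "stretch q m = stretch q n \<longleftrightarrow> m = n"
proof
  assume *: "stretch q m = stretch q n"
  show "m = n"
  proof (rule poly_mapping_eqI)
    fix i
    have "q * lookup m i + (q - 1) = q * lookup n i + (q - 1)"
      using arg_cong[OF *, of "\<lambda>x. lookup x i"] by (simp only: lookup_stretch)
    then show "lookup m i = lookup n i" using assms by (simp only: add_right_cancel mult_cancel1) simp
  qed
qed simp

definition cartier :: "nat \<Rightarrow> ('k::field \<Rightarrow> 'k) \<Rightarrow> 'k mpoly4 \<Rightarrow> 'k mpoly4" where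
  "cartier q \<phi> s = Abs_poly_mapping (\<lambda>m. \<phi> (lookup s (stretch q m)))"

context
  fixes q e :: nat and \<phi> :: "'k::field \<Rightarrow> 'k"
  assumes char: "CHAR('k) = 3" and q: "q = 3 ^ e" and \<phi>: "frobenius_splitting q \<phi>"
begin

lemma splitting_add: "\<phi> (a + b) = \<phi> a + \<phi> b"
  using \<phi> by (simp add: frobenius_splitting_def)

lemma splitting_scale: "\<phi> (a ^ q * b) = a * \<phi> b"
  using \<phi> by (simp add: frobenius_splitting_def)

lemma splitting_0: "\<phi> 0 = 0"
  using splitting_scale[of 0 0] by simp

lemma splitting_exponent_pos: "q > 0"
  by (simp add: q)

lemma lookup_cartier: "lookup (cartier q \<phi> s) m = \<phi> (lookup s (stretch q m))"
proof -
  have "{m. \<phi> (lookup s (stretch q m)) \<noteq> 0} \<subseteq> stretch q -` keys s"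
    by (auto simp: in_keys_iff splitting_0 intro: ccontr)
  moreover have "finite (stretch q -` keys s)"
    by (intro finite_vimageI) (auto simp: inj_on_def stretch_eq_iff splitting_exponent_pos)
  ultimately have "finite {m. \<phi> (lookup s (stretch q m)) \<noteq> 0}" by (rule finite_subset)
  then show ?thesis by (simp add: cartier_def)
qed

lemma cartier_add: "cartier q \<phi> (s + t) = cartier q \<phi> s + cartier q \<phi> t"
  by (rule poly_mapping_eqI) (simp add: lookup_cartier lookup_add splitting_add)

lemma cartier_0: "cartier q \<phi> 0 = 0"
  by (rule poly_mapping_eqI) (simp add: lookup_cartier splitting_0)

lemma cartier_sum: "cartier q \<phi> (sum F A) = (\<Sum>x\<in>A. cartier q \<phi> (F x))"
  by (induction A rule: infinite_finite_induct) (simp_all add: cartier_0 cartier_add)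

lemma cartier_stretch: "cartier q \<phi> (single (stretch q m) c) = single m (\<phi> c)"
  by (rule poly_mapping_eqI)
    (simp add: lookup_cartier lookup_single when_def stretch_eq_iff splitting_exponent_pos splitting_0)

lemma cartier_not_stretch: "(\<And>m. n \<noteq> stretch q m) \<Longrightarrow> cartier q \<phi> (single n c) = 0"
  by (rule poly_mapping_eqI) (simp add: lookup_cartier lookup_single when_def splitting_0)

lemma single_power: "single m c ^ n = single (Poly_Mapping.map ((*) n) m) (c ^ n)"
  for m :: "4 \<Rightarrow>\<^sub>0 nat" and c :: 'k
proof (induction n)
  case 0
  have "Poly_Mapping.map ((*) 0) m = 0"
    by (rule poly_mapping_eqI) (simp add: Poly_Mapping.map.rep_eq when_def)
  then show ?case by (simp only: power_0 single_one)
next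
  case (Suc n)
  have "Poly_Mapping.map ((*) (Suc n)) m = m + Poly_Mapping.map ((*) n) m"
    by (rule poly_mapping_eqI) (simp add: Poly_Mapping.map.rep_eq lookup_add when_def)
  then show ?case by (simp only: power_Suc Suc mult_single)
qed

lemma cartier_single_power_mult:
  "cartier q \<phi> (single m c ^ q * single n d) = single m c * cartier q \<phi> (single n d)"
proof -
  define qm where "qm = Poly_Mapping.map ((*) q) m"
  have qm: "lookup qm i = q * lookup m i" for i
    by (simp add: qm_def Poly_Mapping.map.rep_eq when_def)
  have eq: "single m c ^ q * single n d = single (qm + n) (c ^ q * d)"
    by (simp add: single_power mult_single qm_def)
  show ?thesis
  proof (cases "\<exists>n'. n = stretch q n'")
    case True
    then obtain n' where n': "n = stretch q n'" by auto
    have "qm + n = stretch q (m + n')"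
      by (rule poly_mapping_eqI) (simp add: n' lookup_add lookup_stretch qm distrib_left)
    then show ?thesis unfolding eq by (simp add: n' cartier_stretch splitting_scale mult_single)
  next
    case False
    have "qm + n \<noteq> stretch q m'" for m'
    proof
      assume *: "qm + n = stretch q m'"
      have "n = stretch q (m' - m)"
      proof (rule poly_mapping_eqI)
        fix i
        have i: "q * lookup m i + lookup n i = q * lookup m' i + (q - 1)"
          using arg_cong[OF *, of "\<lambda>x. lookup x i"] by (simp add: lookup_add lookup_stretch qm)
        \<comment> \<open>The remainder q - 1 cannot make up for a deficit of q, so m is bounded by
          m' and n itself would be stretched.\<close>
        then have "q * lookup m i < q * (lookup m' i + 1)" using splitting_exponent_pos by (simp add: distrib_left)
        then have le: "lookup m i \<le> lookup m' i" by (simp only: nat_mult_less_cancel_disj) simp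
        then have "q * lookup m' i = q * lookup m i + q * (lookup m' i - lookup m i)"
          by (simp flip: distrib_left)
        then show "lookup n i = lookup (stretch q (m' - m)) i"
          using i unfolding lookup_stretch lookup_minus by linarith
      qed
      then show False using False by blast
    qed
    then show ?thesis unfolding eq using False by (subst (1 2) cartier_not_stretch) auto
  qed
qed

lemma cartier_power_mult: "cartier q \<phi> (a ^ q * b) = a * cartier q \<phi> b"
proof (induction a rule: poly_mapping_add_induct)
  case (single m c)
  show ?case
    by (induction b rule: poly_mapping_add_induct)
      (simp_all add: cartier_single_power_mult distrib_left cartier_add)
next
  case (add a a')
  then show ?case
    by (simp add: q frobenius_add[OF char_mpoly4[OF char]] distrib_right cartier_add[unfolded q])
qed

text \<open>The operator on \<open>S\<close> that induces an operator on the hypersurface \<open>S/(f)\<close>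
  (Fedder).\<close>

definition fedder :: "'k mpoly4 \<Rightarrow> 'k mpoly4" where
  "fedder t = cartier q \<phi> (diag_poly ^ (q - 1) * t)"

lemma fedder_add: "fedder (s + t) = fedder s + fedder t"
  by (simp add: fedder_def distrib_left cartier_add)

lemma fedder_0: "fedder 0 = 0"
  by (simp add: fedder_def cartier_0)

lemma fedder_uminus: "fedder (- t) = - fedder t"
  using fedder_add[of t "- t"] by (simp add: fedder_0 minus_unique)

lemma fedder_power_mult: "fedder (a ^ q * b) = a * fedder b"
  unfolding fedder_def by (metis cartier_power_mult mult.left_commute)

text \<open>One factor f of t completes f^(q-1) to f^q, which leaves the operator as f. This is why
  the operator descends modulo f.\<close>

lemma fedder_dvd: "diag_poly dvd t \<Longrightarrow> diag_poly dvd fedder t"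
proof -
  assume "diag_poly dvd t"
  then obtain h where "t = diag_poly * h" by (auto simp: dvd_def)
  then have "diag_poly ^ (q - 1) * t = (diag_poly ^ (q - 1) * diag_poly) * h"
    by (simp only: mult.assoc)
  also have "\<dots> = diag_poly ^ q * h" by (simp only: power_minus_mult[OF splitting_exponent_pos])
  finally have "fedder t = diag_poly * cartier q \<phi> h" by (simp add: fedder_def cartier_power_mult)
  then show ?thesis by simp
qed

text \<open>As a/s = s^(q-1) a / s^q, an induced operator must have the value
  \<open>fedder (s ^ (q - 1) * a)\<close> over \<open>s\<close>. After clearing denominators, two
  choices of the fraction differ by the image of a multiple of f.\<close>

lemma loc_fedder_unique:
  assumes "lookup s 0 \<noteq> 0" "y * loc s = loc a" "z * loc s = loc (fedder (s ^ (q - 1) * a))"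
    and "lookup s' 0 \<noteq> 0" "y * loc s' = loc a'" "z' * loc s' = loc (fedder (s' ^ (q - 1) * a'))"
  shows "z = z'"
proof -
  have "loc (a * s' - a' * s) = (y * loc s) * loc s' - (y * loc s') * loc s"
    by (simp only: loc.diff loc.mult assms(2,5))
  also have "\<dots> = 0" by (simp add: mult_ac)
  finally have dvd: "diag_poly dvd a * s' - a' * s" by (simp only: loc_eq_0_iff[OF char])
  have pow: "x ^ q = x ^ (q - 1) * x" for x :: "'k mpoly4"
    by (rule power_minus_mult[OF splitting_exponent_pos, symmetric])
  have "s' * fedder (s ^ (q - 1) * a) + - (s * fedder (s' ^ (q - 1) * a')) =
      fedder (s' ^ q * (s ^ (q - 1) * a)) + - fedder (s ^ q * (s' ^ (q - 1) * a'))"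
    by (simp only: fedder_power_mult)
  also have "\<dots> = fedder (s' ^ q * (s ^ (q - 1) * a)) + fedder (- (s ^ q * (s' ^ (q - 1) * a')))"
    by (simp only: fedder_uminus)
  also have "\<dots> = fedder (s' ^ q * (s ^ (q - 1) * a) + - (s ^ q * (s' ^ (q - 1) * a')))"
    by (simp only: fedder_add)
  also have "s' ^ q * (s ^ (q - 1) * a) + - (s ^ q * (s' ^ (q - 1) * a')) =
      s ^ (q - 1) * s' ^ (q - 1) * (a * s' - a' * s)"
    unfolding pow by (simp add: algebra_simps)
  finally have "diag_poly dvd s' * fedder (s ^ (q - 1) * a) - s * fedder (s' ^ (q - 1) * a')"
    using fedder_dvd[OF dvd_mult[OF dvd, of "s ^ (q - 1) * s' ^ (q - 1)"]] by simp
  then have "loc s' * (z * loc s) = loc s * (z' * loc s')"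
    unfolding loc_eq_0_iff[OF char, symmetric] loc.diff loc.mult assms(3,6) by simp
  then have "z * (loc s * loc s') = z' * (loc s * loc s')" by (simp only: mult_ac)
  then have "z * loc (s * s') = z' * loc (s * s')" by (simp only: loc.mult)
  then show ?thesis using loc_unit_cancel[of "s * s'" z z'] assms(1,4) by (simp add: lookup_mult_0)
qed

text \<open>Values of the induced operator are chosen for each y and pinned down by uniqueness;
  every identity then follows by exhibiting one suitable fraction.\<close>

lemma exists_local_fedder:
  obtains \<Phi> where "\<And>y z. \<Phi> (y + z) = \<Phi> y + \<Phi> z" "\<And>y z. \<Phi> (y ^ q * z) = y * \<Phi> z"
    "\<And>t. \<Phi> (loc t) = loc (fedder t)"
proof -
  have "\<exists>z. \<exists>s a. lookup s 0 \<noteq> 0 \<and> y * loc s = loc a \<and> z * loc s = loc (fedder (s ^ (q - 1) * a))"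
    for y
  proof -
    obtain a s where as: "lookup s 0 \<noteq> 0" "y * loc s = loc a" by (rule loc_fraction)
    moreover obtain t where "loc s * t = 1" using as(1) by (rule loc_unit)
    then have "loc (fedder (s ^ (q - 1) * a)) * t * loc s = loc (fedder (s ^ (q - 1) * a))"
      by (simp add: mult.assoc mult.commute[of t])
    ultimately show ?thesis by blast
  qed
  then obtain \<Phi> where \<Phi>: "\<And>y. \<exists>s a. lookup s 0 \<noteq> 0 \<and> y * loc s = loc a \<and>
      \<Phi> y * loc s = loc (fedder (s ^ (q - 1) * a))"
    by metis
  have rule: "\<Phi> y = z" if "lookup s 0 \<noteq> 0" "y * loc s = loc a"
    "z * loc s = loc (fedder (s ^ (q - 1) * a))" for y z s a
    using \<Phi>[of y] loc_fedder_unique[OF _ _ _ that] by blast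
  have pow: "x ^ q = x ^ (q - 1) * x" for x :: "'k mpoly4"
    by (rule power_minus_mult[OF splitting_exponent_pos, symmetric])
  have "\<Phi> (y + z) = \<Phi> y + \<Phi> z" for y z
  proof -
    obtain s a where s: "lookup s 0 \<noteq> 0" "y * loc s = loc a"
        "\<Phi> y * loc s = loc (fedder (s ^ (q - 1) * a))"
      using \<Phi> by blast
    obtain t b where t: "lookup t 0 \<noteq> 0" "z * loc t = loc b"
        "\<Phi> z * loc t = loc (fedder (t ^ (q - 1) * b))"
      using \<Phi> by blast
    have "(s * t) ^ (q - 1) * (a * t + b * s) =
        t ^ q * (s ^ (q - 1) * a) + s ^ q * (t ^ (q - 1) * b)"
      unfolding pow power_mult_distrib by (simp only: algebra_simps)
    then have F: "fedder ((s * t) ^ (q - 1) * (a * t + b * s)) =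
        t * fedder (s ^ (q - 1) * a) + s * fedder (t ^ (q - 1) * b)"
      by (simp only: fedder_add fedder_power_mult)
    show ?thesis
    proof (rule rule)
      show "lookup (s * t) 0 \<noteq> 0" using s t by (simp add: lookup_mult_0)
      have "(y + z) * loc (s * t) = (y * loc s) * loc t + (z * loc t) * loc s"
        by (simp only: loc.mult algebra_simps)
      then show "(y + z) * loc (s * t) = loc (a * t + b * s)"
        by (simp only: s t loc.mult loc.add)
      have "(\<Phi> y + \<Phi> z) * loc (s * t) = loc t * (\<Phi> y * loc s) + loc s * (\<Phi> z * loc t)"
        by (simp only: loc.mult algebra_simps)
      then show "(\<Phi> y + \<Phi> z) * loc (s * t) = loc (fedder ((s * t) ^ (q - 1) * (a * t + b * s)))"
        by (simp only: F s t loc.mult loc.add)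
    qed
  qed
  moreover have "\<Phi> (y ^ q * z) = y * \<Phi> z" for y z
  proof -
    obtain a s where s: "lookup s 0 \<noteq> 0" "y * loc s = loc a" by (rule loc_fraction)
    obtain t b where t: "lookup t 0 \<noteq> 0" "z * loc t = loc b"
        "\<Phi> z * loc t = loc (fedder (t ^ (q - 1) * b))"
      using \<Phi> by blast
    have "(s ^ q * t) ^ (q - 1) * (a ^ q * b) = (s ^ (q - 1) * a) ^ q * (t ^ (q - 1) * b)"
      by (simp add: power_mult_distrib mult_ac flip: power_mult)
    then have F: "fedder ((s ^ q * t) ^ (q - 1) * (a ^ q * b)) =
        s ^ (q - 1) * a * fedder (t ^ (q - 1) * b)"
      by (simp only: fedder_power_mult)
    show ?thesis
    proof (rule rule)
      show "lookup (s ^ q * t) 0 \<noteq> 0" using s t by (simp add: lookup_mult_0 lookup_power_0)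
      have "y ^ q * z * loc (s ^ q * t) = (y * loc s) ^ q * (z * loc t)"
        by (simp only: loc.mult loc.power power_mult_distrib mult_ac)
      then show "y ^ q * z * loc (s ^ q * t) = loc (a ^ q * b)"
        by (simp only: s t loc.mult loc.power)
      have "y * \<Phi> z * loc (s ^ q * t) = loc (s ^ (q - 1)) * (y * loc s) * (\<Phi> z * loc t)"
        by (simp only: pow loc.mult mult_ac)
      then show "y * \<Phi> z * loc (s ^ q * t) = loc (fedder ((s ^ q * t) ^ (q - 1) * (a ^ q * b)))"
        by (simp only: F s t loc.mult)
    qed
  qed
  moreover have "\<Phi> (loc t) = loc (fedder t)" for t
    by (rule rule[of 1 _ t]) (simp_all add: loc.one)
  ultimately show ?thesis using that by blast
qed

text \<open>The induced operator sends \<open>c * a ^ q\<close> to \<open>a * \<Phi> c\<close>,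
  hence J^[q] into J, and it extracts \<open>u\<close> from \<open>u ^ q\<close>.\<close>

lemma fedder_frobenius_power:
  assumes J: "ideal.subspace J" and mem: "loc t * u ^ q \<in> frobenius_power J q"
  shows "loc (fedder t) * u \<in> J"
proof -
  obtain \<Phi> where \<Phi>: "\<And>y z. \<Phi> (y + z) = \<Phi> y + \<Phi> z" "\<And>y z. \<Phi> (y ^ q * z) = y * \<Phi> z"
    "\<And>t. \<Phi> (loc t) = loc (fedder t)"
    using exists_local_fedder by blast
  have "\<Phi> y \<in> J" if "y \<in> frobenius_power J q" for y
    using that unfolding frobenius_power_def
  proof (induction rule: ideal.span_induct_alt)
    case base
    show ?case using \<Phi>(1)[of 0 0] ideal.subspace_0[OF J] by simp
  next
    case (step c x y)
    then obtain a where a: "x = a ^ q" "a \<in> J" by auto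
    have "\<Phi> (c * x) = a * \<Phi> c" using \<Phi>(2)[of a c] by (simp add: a mult.commute)
    then have "\<Phi> (c * x) \<in> J" using ideal.subspace_scale[OF J a(2), of "\<Phi> c"] by (simp add: mult.commute)
    then show ?case using step ideal.subspace_add[OF J] by (simp add: \<Phi>(1))
  qed
  from this[OF mem] have "\<Phi> (u ^ q * loc t) \<in> J" by (simp add: mult.commute)
  then show ?thesis unfolding \<Phi>(2,3) by (simp add: mult.commute)
qed

end

lemma frobenius_power_mult_subset:
  "frobenius_power I (q * r) \<subseteq> frobenius_power (frobenius_power I q) r"
  unfolding frobenius_power_def
proof (rule ideal.span_mono, safe)
  fix a assume "a \<in> I"
  then have "a ^ q \<in> ideal.span ((\<lambda>a. a ^ q) ` I)" by (intro ideal.span_base) auto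
  then show "a ^ (q * r) \<in> (\<lambda>a. a ^ r) ` ideal.span ((\<lambda>a. a ^ q) ` I)"
    by (auto simp: power_mult)
qed

lemma subspace_frobenius_power: "ideal.subspace (frobenius_power I q)"
  by (simp add: frobenius_power_def)

section \<open>Elements of the test ideal\<close>

text \<open>The multiplier property of t is used at exponent E + e. The operator strips off the
  factor 3^e and leaves the statement at exponent E, with I^[3^E] in the role of J.\<close>

lemma test_ideal_fedder:
  fixes t :: "'k::field mpoly4"
  assumes char: "CHAR('k) = 3" and \<phi>: "frobenius_splitting (3 ^ e) \<phi>" and t: "loc t \<in> test_ideal"
  shows "loc (fedder (3 ^ e) \<phi> t) \<in> test_ideal"
  unfolding test_ideal_def char_local[OF char]
proof (intro CollectI allI impI)
  fix I and u :: "'k diag_local" and E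
  assume I: "ideal.subspace I" "u \<in> tight_closure I"
  have "loc t * u ^ 3 ^ (E + e) \<in> frobenius_power I (3 ^ (E + e))"
    using t I unfolding test_ideal_def char_local[OF char] by blast
  then have "loc t * (u ^ 3 ^ E) ^ 3 ^ e \<in> frobenius_power (frobenius_power I (3 ^ E)) (3 ^ e)"
    using frobenius_power_mult_subset[of I "3 ^ E" "3 ^ e"]
    by (auto simp: power_add power_mult)
  then show "loc (fedder (3 ^ e) \<phi> t) * u ^ 3 ^ E \<in> frobenius_power I (3 ^ E)"
    by (rule fedder_frobenius_power[OF char refl \<phi> subspace_frobenius_power])
qed

lemma poly_mapping_sum_single: "s = (\<Sum>m\<in>keys s. single m (lookup s m))"
  by (rule poly_mapping_eqI) (simp add: lookup_sum lookup_single when_def sum.delta in_keys_iff)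

lemma diag_poly_split:
  obtains g :: "'k::field mpoly4" where "g \<in> free1" "diag_poly = pvar 1 ^ 7 + g"
  by (rule that[of "pvar 2 ^ 7 + pvar 3 ^ 7 + pvar 4 ^ 7"])
    (simp_all add: diag_poly_def free1_add free1_pvar_power add.assoc)

context
  fixes q e :: nat and \<phi> :: "'k::field \<Rightarrow> 'k"
  assumes char: "CHAR('k) = 3" and q: "q = 3 ^ e" and \<phi>: "frobenius_splitting q \<phi>"
begin

text \<open>All terms have x1-exponent n, and the operator sees only exponents congruent to q - 1
  modulo q.\<close>

lemma cartier_pvar_power_free1:
  assumes "b \<in> free1" "\<not> q dvd n + 1"
  shows "cartier q \<phi> (pvar 1 ^ n * b) = 0"
proof -
  have "pvar 1 ^ n * b = (\<Sum>m\<in>keys b. single (single 1 n + m) (lookup b m))"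
    by (subst (1) poly_mapping_sum_single[of b])
      (simp add: sum_distrib_left pvar_power mult_single)
  then have "cartier q \<phi> (pvar 1 ^ n * b) =
      (\<Sum>m\<in>keys b. cartier q \<phi> (single (single 1 n + m) (lookup b m)))"
    by (simp only: cartier_sum[OF char q \<phi>])
  also have "\<dots> = 0"
  proof (intro sum.neutral ballI cartier_not_stretch[OF char q \<phi>])
    fix m m' assume "m \<in> keys b"
    then have m: "lookup m 1 = 0" using assms(1) by (simp add: free1_def in_keys_iff)
    show "single 1 n + m \<noteq> stretch q m'"
    proof
      assume "single 1 n + m = stretch q m'"
      then have "lookup (single 1 n + m) 1 = lookup (stretch q m') 1" by simp
      then have "n + 1 = q * lookup m' 1 + (q - 1) + 1" by (simp add: lookup_add lookup_stretch m)
      also have "\<dots> = q * (lookup m' 1 + 1)" using q by simp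
      finally have "q dvd n + 1" by (metis dvd_triv_left)
      with assms(2) show False by blast
    qed
  qed
  finally show ?thesis .
qed

text \<open>Of the powers \<open>x\<^sub>1\<^bsup>7k\<^esup>\<close>, \<open>k \<le> q - 1\<close>, in the expansion of
  \<open>f\<^bsup>q-1\<^esup>\<close>, only the highest one contributes.\<close>

lemma fedder_pvar_free1:
  assumes b: "b \<in> free1"
  shows "fedder q \<phi> (pvar 1 ^ 6 * b) = cartier q \<phi> (pvar 1 ^ (7 * (q - 1) + 6) * b)"
proof -
  obtain g :: "'k mpoly4" where g: "g \<in> free1" "diag_poly = pvar 1 ^ 7 + g"
    by (rule diag_poly_split)
  have gp: "g ^ n \<in> free1" for n by (induction n) (simp_all add: free1_1 free1_mult g)
  have of_nat: "of_nat n \<in> free1" for n by (induction n) (simp_all add: free1_0 free1_1 free1_add)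
  have "diag_poly ^ (q - 1) * (pvar 1 ^ 6 * b) =
      (\<Sum>k\<le>q-1. pvar 1 ^ (7 * k + 6) * (of_nat (q - 1 choose k) * (g ^ (q - 1 - k) * b)))"
    unfolding g(2) binomial_ring sum_distrib_right power_add power_mult
    by (intro sum.cong refl) (simp only: mult_ac)
  then have "fedder q \<phi> (pvar 1 ^ 6 * b) = (\<Sum>k\<le>q-1.
      cartier q \<phi> (pvar 1 ^ (7 * k + 6) * (of_nat (q - 1 choose k) * (g ^ (q - 1 - k) * b))))"
    by (simp only: fedder_def[OF char q \<phi>] cartier_sum[OF char q \<phi>])
  also have "\<dots> = (\<Sum>k\<in>{q-1}.
      cartier q \<phi> (pvar 1 ^ (7 * k + 6) * (of_nat (q - 1 choose k) * (g ^ (q - 1 - k) * b))))"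
  proof (rule sum.mono_neutral_right)
    show "\<forall>k\<in>{..q-1} - {q-1}.
      cartier q \<phi> (pvar 1 ^ (7 * k + 6) * (of_nat (q - 1 choose k) * (g ^ (q - 1 - k) * b))) = 0"
    proof (intro ballI cartier_pvar_power_free1 free1_mult of_nat gp b)
      fix k assume "k \<in> {..q-1} - {q-1}"
      then have k: "k + 1 < q" by auto
      \<comment> \<open>The exponent plus one is 7(k + 1). As q is prime to 7, it is divisible by q
        only if k + 1 is, that is, for k = q - 1.\<close>
      have "coprime q 7" unfolding q by (simp add: coprime_commute[of 3] primes_coprime)
      moreover have "7 * k + 6 + 1 = 7 * (k + 1)" by simp
      ultimately have "q dvd 7 * k + 6 + 1 \<longleftrightarrow> q dvd k + 1"
        by (metis coprime_dvd_mult_right_iff)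
      then show "\<not> q dvd 7 * k + 6 + 1" using k by (auto dest: dvd_imp_le)
    qed
  qed auto
  finally show ?thesis by simp
qed

end

text \<open>A single monomial x^gamma of a is isolated by completing it with delta to exponent q - 1
  in x2, x3, x4. Any other monomial seen by the operator would agree with gamma modulo q, hence
  equal it, because all exponents in a are below q.\<close>

lemma exists_fedder_preimage:
  fixes a :: "'k::field mpoly4"
  assumes char: "CHAR('k) = 3" and a: "a \<in> free1" "a \<noteq> 0"
  obtains e \<phi> d where "e \<ge> e0" "frobenius_splitting (3 ^ e) \<phi>"
    "fedder (3 ^ e) \<phi> (d * a) = pvar 1 ^ 6"
proof -
  \<comment> \<open>A crude bound for all exponents in a; since e is at least N, 3^e exceeds each of
    them.\<close>
  define N where "N = (\<Sum>m\<in>keys a. \<Sum>i\<in>UNIV. lookup m i)"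
  define e where "e = e0 + N"
  define q :: nat where "q = 3 ^ e"
  have bound: "lookup m i < q" if "m \<in> keys a" for m i
  proof -
    have "lookup m i \<le> (\<Sum>i\<in>UNIV. lookup m i)" by (rule member_le_sum) auto
    also have "\<dots> \<le> N" unfolding N_def by (rule member_le_sum) (use that in auto)
    also have "N \<le> e" by (simp add: e_def)
    also have "e < q" unfolding q_def by (rule less_exp[THEN less_le_trans]) (simp add: power_mono)
    finally show ?thesis .
  qed
  obtain \<gamma> where \<gamma>: "\<gamma> \<in> keys a" using a(2) by (metis ex_in_conv keys_eq_empty)
  have \<gamma>1: "lookup m 1 = 0" if "m \<in> keys a" for m
    using a(1) that by (simp add: free1_def in_keys_iff)
  obtain \<phi> where \<phi>: "frobenius_splitting (3 ^ e) \<phi>" "\<phi> (lookup a \<gamma>) = 1"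
    using exists_frobenius_splitting[OF char] \<gamma> by (metis in_keys_iff)
  define \<delta> :: "4 \<Rightarrow>\<^sub>0 nat" where "\<delta> = Abs_poly_mapping (\<lambda>i. if i = 1 then 0 else q - 1 - lookup \<gamma> i)"
  have \<delta>: "lookup \<delta> i = (if i = 1 then 0 else q - 1 - lookup \<gamma> i)" for i
    by (simp add: \<delta>_def)
  \<comment> \<open>Because 7(q - 1) + 6 = 6q + (q - 1), the operator turns this power of x1 into
    x1^6.\<close>
  define n where "n = 7 * (q - 1) + 6"
  have q: "q > 0" by (simp add: q_def)
  have free: "single \<delta> 1 * a \<in> free1" using a by (intro free1_mult free1_single) (auto simp: \<delta>)
  have "pvar 1 ^ n * (single \<delta> 1 * a) = (\<Sum>m\<in>keys a. single (single 1 n + \<delta> + m) (lookup a m))"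
    by (subst (1) poly_mapping_sum_single[of a])
      (simp add: sum_distrib_left pvar_power mult_single add.assoc)
  then have "cartier q \<phi> (pvar 1 ^ n * (single \<delta> 1 * a)) =
      (\<Sum>m\<in>keys a. cartier q \<phi> (single (single 1 n + \<delta> + m) (lookup a m)))"
    using cartier_sum[OF char refl \<phi>(1)] by (simp add: q_def)
  also have "\<dots> = (\<Sum>m\<in>{\<gamma>}. cartier q \<phi> (single (single 1 n + \<delta> + m) (lookup a m)))"
  proof (rule sum.mono_neutral_right)
    show "\<forall>m\<in>keys a - {\<gamma>}. cartier q \<phi> (single (single 1 n + \<delta> + m) (lookup a m)) = 0"
    proof (intro ballI)
      fix m assume m: "m \<in> keys a - {\<gamma>}"
      have "single 1 n + \<delta> + m \<noteq> stretch q m'" for m'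
      proof
        assume *: "single 1 n + \<delta> + m = stretch q m'"
        have "m = \<gamma>"
        proof (rule poly_mapping_eqI)
          fix i
          show "lookup m i = lookup \<gamma> i"
          proof (cases "i = 1")
            case False
            have "lookup (single 1 n + \<delta> + m) i = lookup (stretch q m') i" using * by simp
            then have "q - 1 - lookup \<gamma> i + lookup m i = q * lookup m' i + (q - 1)"
              using False by (simp only: lookup_add lookup_stretch \<delta> lookup_single) simp
            then have eq: "lookup m i = q * lookup m' i + lookup \<gamma> i"
              using bound[OF \<gamma>, of i] by linarith
            moreover have "lookup m i < q" using m bound by auto
            ultimately have "lookup m' i = 0" by (cases "lookup m' i") auto
            then show ?thesis using eq by simp
          qed (use m \<gamma> \<gamma>1 in auto)
        qed
        with m show False by blast
      qed
      then show "cartier q \<phi> (single (single 1 n + \<delta> + m) (lookup a m)) = 0"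
        unfolding q_def by (rule cartier_not_stretch[OF char refl \<phi>(1)])
    qed
  qed (use \<gamma> in auto)
  also have "\<dots> = cartier q \<phi> (single (stretch q (single 1 6)) (lookup a \<gamma>))"
  proof -
    have "single 1 n + \<delta> + \<gamma> = stretch q (single 1 6)"
    proof (rule poly_mapping_eqI)
      fix i
      show "lookup (single 1 n + \<delta> + \<gamma>) i = lookup (stretch q (single 1 6)) i"
        using bound[OF \<gamma>, of i] \<gamma>1[OF \<gamma>] q
        by (cases "i = 1") (auto simp: lookup_add lookup_stretch \<delta> lookup_single n_def when_def)
    qed
    then show ?thesis by simp
  qed
  also have "\<dots> = pvar 1 ^ 6"
    using cartier_stretch[OF char refl \<phi>(1)] \<phi>(2) by (simp add: q_def pvar_power)
  finally have "cartier q \<phi> (pvar 1 ^ n * (single \<delta> 1 * a)) = pvar 1 ^ 6" .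
  then have "fedder (3 ^ e) \<phi> (pvar 1 ^ 6 * (single \<delta> 1 * a)) = pvar 1 ^ 6"
    using fedder_pvar_free1[OF char refl \<phi>(1) free] by (simp add: q_def n_def)
  then show ?thesis
    using that[of e \<phi> "pvar 1 ^ 6 * single \<delta> 1"] \<phi>(1) by (simp add: e_def mult.assoc)
qed

text \<open>The operator depends on the multiplier c belonging to u, but its output x1^6 does not,
  and the exponent E remains free. This uniformity puts x1^6 into the test ideal.\<close>

lemma pvar1_power6_in_test_ideal:
  assumes char: "CHAR('k::field) = 3"
  shows "loc (pvar 1 ^ 6 :: 'k mpoly4) \<in> test_ideal"
  unfolding test_ideal_def char_local[OF char]
proof (intro CollectI allI impI)
  fix I and u :: "'k diag_local" and E
  assume I: "ideal.subspace I" "u \<in> tight_closure I"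
  obtain c e0 where c: "\<And>P. minimal_prime P \<Longrightarrow> c \<notin> P"
      and e0: "\<And>e. e \<ge> e0 \<Longrightarrow> c * u ^ 3 ^ e \<in> frobenius_power I (3 ^ e)"
    using I(2) unfolding tight_closure_def char_local[OF char] by blast
  have "c \<noteq> 0" using c[OF minimal_prime_0[OF char]] by simp
  obtain b s where b: "lookup s 0 \<noteq> 0" "c * loc s = loc b" by (rule loc_fraction)
  have "loc b \<noteq> 0" using b \<open>c \<noteq> 0\<close> loc_unit_cancel[of s c 0] by auto
  then have "\<not> diag_poly dvd b" by (simp add: loc_eq_0_iff[OF char])
  then obtain d a where a: "a \<in> free1" "a \<noteq> 0" "diag_poly dvd d * b - a"
    by (rule exists_free1_multiple[OF char])
  have "loc a = loc (d * b)" using a(3) by (simp flip: loc_eq_0_iff[OF char] add: loc.diff)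
  then have la: "loc a = loc d * loc s * c" by (simp add: loc.mult b(2)[symmetric] mult_ac)
  obtain e \<phi> d' where e: "e \<ge> e0" "frobenius_splitting (3 ^ e) \<phi>"
      "fedder (3 ^ e) \<phi> (d' * a) = pvar 1 ^ 6"
    using exists_fedder_preimage[OF char a(1,2)] by metis
  have "loc (d' * a) * u ^ 3 ^ (E + e) = loc d' * loc d * loc s * (c * u ^ 3 ^ (E + e))"
    by (simp add: loc.mult la mult_ac)
  also have "\<dots> \<in> frobenius_power I (3 ^ (E + e))"
    using e(1) by (intro ideal.subspace_scale[OF subspace_frobenius_power e0]) simp
  finally have "loc (d' * a) * (u ^ 3 ^ E) ^ 3 ^ e \<in> frobenius_power (frobenius_power I (3 ^ E)) (3 ^ e)"
    using frobenius_power_mult_subset[of I "3 ^ E" "3 ^ e"] by (auto simp: power_add power_mult)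
  from fedder_frobenius_power[OF char refl e(2) subspace_frobenius_power this]
  show "loc (pvar 1 ^ 6) * u ^ 3 ^ E \<in> frobenius_power I (3 ^ E)" by (simp add: e(3))
qed

section \<open>Further monomials from the operators with q = 3\<close>

lemma diag_poly_eq_sum: "diag_poly = (\<Sum>i\<in>UNIV. single (single i 7) 1)"
proof -
  have U: "(UNIV :: 4 set) = {1, 2, 3, 4}" by (auto intro: index4_cases)
  show ?thesis unfolding U diag_poly_def pvar_power by (simp add: add.assoc)
qed

text \<open>The type argument carries the coefficient field, which an exponent vector does not
  determine.\<close>

definition monomial_in_test :: "'k::field itself \<Rightarrow> (4 \<Rightarrow>\<^sub>0 nat) \<Rightarrow> bool" where
  "monomial_in_test _ m \<longleftrightarrow> loc (single m 1 :: 'k mpoly4) \<in> test_ideal"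

lemma monomial_in_test_mono:
  assumes "monomial_in_test TYPE('k::field) m" "\<And>i. lookup m i \<le> lookup n i"
  shows "monomial_in_test TYPE('k) n"
proof -
  have "n = (n - m) + m"
    by (rule poly_mapping_eqI) (use assms(2) in \<open>simp add: lookup_add lookup_minus\<close>)
  then have "loc (single n 1 :: 'k mpoly4) = loc (single (n - m) 1) * loc (single m 1)"
    by (metis loc.mult mult_single mult_1)
  then show ?thesis
    using assms(1) ideal.subspace_scale[OF subspace_test_ideal] unfolding monomial_in_test_def by metis
qed

text \<open>By the inequality, some multiple x^a of x^m satisfies x^a xi^7 xj^7 = x^(3t + 2), with
  exponent 3 t + 2 in every variable. The operator kills every other term of f^2 x^a and yields x^t
  with coefficient 1 or 2.\<close>

lemma monomial_in_test_step:
  assumes char: "CHAR('k::field) = 3" and m: "monomial_in_test TYPE('k) m"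
    and le: "\<And>x. lookup m x + (if x = i then 7 else 0) + (if x = j then 7 else 0) \<le> 3 * lookup t x + 2"
  shows "monomial_in_test TYPE('k) t"
proof -
  obtain \<phi> :: "'k \<Rightarrow> 'k" where \<phi>: "frobenius_splitting (3 ^ 1) \<phi>" "\<phi> 1 = 1"
    by (rule exists_frobenius_splitting[OF char one_neq_zero])
  define E :: "4 \<Rightarrow> 4 \<Rightarrow> 4 \<Rightarrow>\<^sub>0 nat" where "E k l = single k 7 + single l 7" for k l
  have E: "lookup (E k l) x = (if x = k then 7 else 0) + (if x = l then 7 else 0)" for k l x
    by (simp add: E_def lookup_add lookup_single when_def eq_commute)
  define a where "a = stretch 3 t - E i j"
  have a: "E i j + a = stretch 3 t"
  proof (rule poly_mapping_eqI)
    fix x show "lookup (E i j + a) x = lookup (stretch 3 t) x"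
      using le[of x] unfolding a_def lookup_add lookup_minus E lookup_stretch by simp
  qed
  have "monomial_in_test TYPE('k) a"
  proof (rule monomial_in_test_mono[OF m])
    fix x show "lookup m x \<le> lookup a x"
      using le[of x] unfolding a_def lookup_minus E lookup_stretch by simp
  qed
  then have T: "loc (fedder 3 \<phi> (single a 1)) \<in> test_ideal"
    using test_ideal_fedder[OF char \<phi>(1)] by (simp add: monomial_in_test_def)
  have summand: "cartier 3 \<phi> (single (E k l + a) 1) = (if (k, l) = (i, j) \<or> (k, l) = (j, i) then single t 1 else 0)"
    for k l
  proof (cases "(k, l) = (i, j) \<or> (k, l) = (j, i)")
    case True
    then have "E k l = E i j" by (auto simp: E_def add.commute)
    then show ?thesis using True cartier_stretch[OF char refl \<phi>(1)] \<phi>(2) by (simp add: a)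
  next
    case False
    have "E k l + a \<noteq> stretch 3 t'" for t'
    proof
      assume *: "E k l + a = stretch 3 t'"
      \<comment> \<open>Both exponents are 2 modulo 3, and 7 is 1 modulo 3. So each index has the
        same multiplicity modulo 3 in the pairs (k, l) and (i, j), and multiplicities up to 2 that
        agree modulo 3 are equal.\<close>
      have "(if x = k then 1 else 0) + (if x = l then 1 else 0) =
          (if x = i then 1 else 0) + (if x = j then 1 else (0::nat))" for x
      proof -
        have "lookup (E k l) x + lookup a x = 3 * lookup t' x + 2"
          "lookup (E i j) x + lookup a x = 3 * lookup t x + 2"
          using arg_cong[OF *, of "\<lambda>m. lookup m x"] arg_cong[OF a, of "\<lambda>m. lookup m x"]
          by (simp_all add: lookup_add lookup_stretch)
        then show ?thesis unfolding E by (auto split: if_splits) presburger+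
      qed
      from this[of i] this[of j] this[of k] this[of l] False show False
        by (auto split: if_splits)
    qed
    then have "cartier 3 \<phi> (single (E k l + a) 1) = 0"
      using cartier_not_stretch[OF char refl \<phi>(1)] by simp
    then show ?thesis using False by (simp only: if_False)
  qed
  have "diag_poly ^ (3 - 1) * single a 1 = diag_poly * diag_poly * single a (1 :: 'k)"
    by (simp add: power2_eq_square)
  also have "\<dots> = (\<Sum>k\<in>UNIV. \<Sum>l\<in>UNIV. single (E k l + a) 1)"
    unfolding diag_poly_eq_sum E_def
    by (simp only: sum_product) (simp add: sum_distrib_right mult_single)
  finally have "fedder 3 \<phi> (single a 1) = (\<Sum>k\<in>UNIV. \<Sum>l\<in>UNIV. cartier 3 \<phi> (single (E k l + a) 1))"
    using \<phi>(1) by (simp add: fedder_def[OF char, of 3 1] cartier_sum[OF char, of 3 1])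
  also have "\<dots> = (\<Sum>(k, l)\<in>UNIV. if (k, l) = (i, j) \<or> (k, l) = (j, i) then single t 1 else 0)"
    unfolding summand by (simp add: sum.cartesian_product split_def flip: UNIV_Times_UNIV)
  also have "\<dots> = (\<Sum>x\<in>{(i, j), (j, i)}. single t 1)"
    by (rule sum.mono_neutral_cong_right) (auto split: if_splits)
  \<comment> \<open>For distinct i, j the term occurs twice, and 2 = -1 is a unit in characteristic
    3.\<close>
  also have "\<dots> = (if i = j then single t 1 else - single t 1)"
  proof -
    have "(2 :: 'k) = 3 - 1" by simp
    then have "(1 + 1 :: 'k) = - 1" using three_eq_0[OF char] by simp
    then have "single t (1 :: 'k) + single t 1 = - single t 1"
      by (simp only: flip: single_add single_uminus)
    then show ?thesis by simp
  qed
  finally have "loc (single t (1 :: 'k)) \<in> test_ideal \<or> - loc (single t 1) \<in> (test_ideal :: 'k diag_local set)"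
    using T by (auto simp: loc.uminus split: if_splits)
  then show ?thesis
    using ideal.subspace_neg[OF subspace_test_ideal, of "- loc (single t (1 :: 'k))"]
    unfolding monomial_in_test_def by auto
qed

text \<open>With the pair i, j, xk^7 gives xi^2 xj^2 xk^2, because 7 is below 3 times 2 plus 2. With
  the pair l, l this gives xl^4, where all bounds are sharp: 14 is 3 times 4 plus 2.\<close>

lemma monomial_in_test_power4_aux:
  assumes char: "CHAR('k::field) = 3" and "monomial_in_test TYPE('k) (single k 7)" and "distinct [i, j, k, l]"
  shows "monomial_in_test TYPE('k) (single l 4)"
proof -
  have "monomial_in_test TYPE('k) (single i 2 + single j 2 + single k 2)"
    by (rule monomial_in_test_step[OF char assms(2), of i j])
      (use assms(3) in \<open>auto simp: lookup_add lookup_single when_def\<close>)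
  then show ?thesis
    by (rule monomial_in_test_step[OF char, of _ l l])
      (use assms(3) in \<open>auto simp: lookup_add lookup_single when_def\<close>)
qed

lemma index4_complete:
  fixes k l :: 4 assumes "k \<noteq> l" obtains i j where "distinct [i, j, k, l]"
proof -
  have "\<exists>i j. distinct [i, j, k, l]"
  proof (rule ccontr)
    assume "\<not> ?thesis"
    then have *: "\<not> distinct [i, j, k, l]" for i j by blast
    show False
      using *[of 1 2] *[of 1 3] *[of 1 4] *[of 2 3] *[of 2 4] *[of 3 4] assms
      by (cases k rule: index4_cases; cases l rule: index4_cases) simp_all
  qed
  then show ?thesis using that by blast
qed

lemma monomial_in_test_power4:
  assumes char: "CHAR('k::field) = 3"
  shows "monomial_in_test TYPE('k) (single l 4)"
proof -
  have "monomial_in_test TYPE('k) (single 1 6)"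
    using pvar1_power6_in_test_ideal[OF char] by (simp add: monomial_in_test_def pvar_power)
  then have 1: "monomial_in_test TYPE('k) (single 1 7)"
    by (rule monomial_in_test_mono) (simp add: lookup_single when_def)
  have ne1: "monomial_in_test TYPE('k) (single l 4)" if "l \<noteq> 1" for l
    using monomial_in_test_power4_aux[OF char 1] index4_complete that by metis
  \<comment> \<open>Now x2 takes over the part of x1 and supplies the missing power x1^4.\<close>
  have "monomial_in_test TYPE('k) (single 2 7)"
    by (rule monomial_in_test_mono[OF ne1[of 2]]) (simp_all add: lookup_single when_def)
  from monomial_in_test_power4_aux[OF char this, of 3 4 1]
  have "monomial_in_test TYPE('k) (single 1 4)" by simp
  with ne1 show ?thesis by metis
qed

text \<open>For distinct indices, xi^4 gives xi xj xk^2 xl^2 through the pair k, l, and this gives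
  xi^2 xj^2 through the pair i, j, where 1 + 7 = 8 and 2 meet their bounds exactly.\<close>

lemma monomial_in_test_squares:
  assumes char: "CHAR('k::field) = 3"
  shows "monomial_in_test TYPE('k) (single i 2 + single j 2)"
proof (cases "i = j")
  case True
  then show ?thesis using monomial_in_test_power4[OF char, of j] by (simp flip: single_add)
next
  case False
  then obtain k l where kl: "distinct [k, l, i, j]" using index4_complete by metis
  have "monomial_in_test TYPE('k) (single i 1 + single j 1 + single k 2 + single l 2)"
    by (rule monomial_in_test_step[OF char monomial_in_test_power4[OF char, of i], of k l])
      (use kl in \<open>auto simp: lookup_add lookup_single when_def\<close>)
  then show ?thesis
    by (rule monomial_in_test_step[OF char, of _ i j])
      (use kl in \<open>auto simp: lookup_add lookup_single when_def\<close>)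
qed

lemma local_var_squares_in_test_ideal:
  assumes char: "CHAR('k::field) = 3"
  shows "local_var i ^ 2 * local_var j ^ 2 \<in> (test_ideal :: 'k diag_local set)"
proof -
  have "local_var i ^ 2 * local_var j ^ 2 = loc (pvar i ^ 2 * pvar j ^ 2 :: 'k mpoly4)"
    by (simp only: loc.mult loc.power loc_pvar)
  then show ?thesis
    using monomial_in_test_squares[OF char, of i j]
    by (simp add: monomial_in_test_def pvar_power mult_single)
qed

section \<open>Powers of ideals and integral closure\<close>

lemma subspace_ideal_power: "ideal.subspace (ideal_power I n)"
  by (cases n) (simp_all add: ideal_mult_def)

lemma zero_in_ideal_mult: "0 \<in> ideal_mult I J"
  by (simp add: ideal_mult_def ideal.span_zero)

lemma ideal_mult_memI: "a \<in> I \<Longrightarrow> b \<in> J \<Longrightarrow> a * b \<in> ideal_mult I J"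
  unfolding ideal_mult_def by (intro ideal.span_base) auto

lemma ideal_mult_subset:
  assumes "ideal.subspace L" "\<And>a b. a \<in> I \<Longrightarrow> b \<in> J \<Longrightarrow> a * b \<in> L"
  shows "ideal_mult I J \<subseteq> L"
  unfolding ideal_mult_def using assms by (intro ideal.span_minimal) auto

lemma ideal_power_mult_mem:
  "a \<in> ideal_power I i \<Longrightarrow> b \<in> ideal_power I j \<Longrightarrow> a * b \<in> ideal_power I (i + j)"
proof (induction i arbitrary: a)
  case 0
  then show ?case by (simp add: ideal.subspace_scale[OF subspace_ideal_power])
next
  case (Suc i)
  have "ideal_power I (Suc i) \<subseteq> {a. a * b \<in> ideal_power I (Suc i + j)}"
    unfolding ideal_power.simps
  proof (rule ideal_mult_subset)
    show "ideal.subspace {a. a * b \<in> ideal_power I (Suc i + j)}"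
      using subspace_ideal_power[of I "Suc i + j"]
      by (auto simp: ideal.subspace_def distrib_right mult.assoc)
    show "x * y \<in> {a. a * b \<in> ideal_power I (Suc i + j)}" if "x \<in> I" "y \<in> ideal_power I i" for x y
      using ideal_mult_memI[OF that(1) Suc.IH[OF that(2) Suc.prems(2)]] by (simp add: mult.assoc)
  qed
  with Suc.prems(1) show ?case by blast
qed

lemma ideal_power_1: "a \<in> I \<Longrightarrow> a \<in> ideal_power I 1"
  using ideal_mult_memI[of a I 1 UNIV] by simp

text \<open>Homogeneous elements of degree \<open>n\<close> of the Rees algebra of \<open>I\<close>, in which the
  variable also has degree \<open>1\<close>.\<close>

definition rees :: "'a::comm_ring_1 set \<Rightarrow> nat \<Rightarrow> 'a poly \<Rightarrow> bool" where
  "rees I n P \<longleftrightarrow> (\<forall>k. if k \<le> n then coeff P k \<in> ideal_power I (n - k) else coeff P k = 0)"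

lemma reesD: "rees I n P \<Longrightarrow> k \<le> n \<Longrightarrow> coeff P k \<in> ideal_power I (n - k)"
  unfolding rees_def by metis

lemma rees_coeff_0: "rees I n P \<Longrightarrow> n < k \<Longrightarrow> coeff P k = 0"
  unfolding rees_def by (metis not_le)

lemma rees_0: "rees I n 0"
  by (simp add: rees_def ideal.subspace_0[OF subspace_ideal_power])

lemma rees_add: "rees I n P \<Longrightarrow> rees I n Q \<Longrightarrow> rees I n (P + Q)"
  unfolding rees_def by (metis add_0 coeff_add ideal.subspace_add subspace_ideal_power)

lemma rees_diff: "rees I n P \<Longrightarrow> rees I n Q \<Longrightarrow> rees I n (P - Q)"
  unfolding rees_def by (metis diff_0_right coeff_diff ideal.subspace_diff subspace_ideal_power)

lemma rees_sum: "(\<And>x. x \<in> A \<Longrightarrow> rees I n (F x)) \<Longrightarrow> rees I n (sum F A)"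
  by (induction A rule: infinite_finite_induct) (auto simp: rees_0 rees_add)

lemma rees_mult: assumes P: "rees I n P" and Q: "rees I m Q" shows "rees I (n + m) (P * Q)"
proof -
  have "coeff (P * Q) k \<in> ideal_power I (n + m - k)" if "k \<le> n + m" for k
    unfolding coeff_mult
  proof (rule ideal.subspace_sum[OF subspace_ideal_power])
    fix l assume l: "l \<in> {..k}"
    show "coeff P l * coeff Q (k - l) \<in> ideal_power I (n + m - k)"
    proof (cases "l \<le> n \<and> k - l \<le> m")
      case True
      then have "n - l + (m - (k - l)) = n + m - k" using l that by auto
      with ideal_power_mult_mem[OF reesD[OF P] reesD[OF Q], of l "k - l"] True
      show ?thesis by simp
    next
      case False
      then have "coeff P l * coeff Q (k - l) = 0"
        using rees_coeff_0[OF P, of l] rees_coeff_0[OF Q, of "k - l"] by auto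
      then show ?thesis by (simp add: ideal.subspace_0[OF subspace_ideal_power])
    qed
  qed
  moreover have "coeff (P * Q) k = 0" if "n + m < k" for k
    unfolding coeff_mult
  proof (rule sum.neutral, rule ballI)
    fix l assume "l \<in> {..k}"
    with that have "n < l \<or> m < k - l" by auto
    then show "coeff P l * coeff Q (k - l) = 0"
      using rees_coeff_0[OF P, of l] rees_coeff_0[OF Q, of "k - l"] by auto
  qed
  ultimately show ?thesis by (auto simp: rees_def)
qed

lemma rees_pCons_0: "rees I n P \<Longrightarrow> rees I (Suc n) (pCons 0 P)"
  unfolding rees_def
  by (auto simp: coeff_pCons zero_in_ideal_mult split: nat.splits)

lemma rees_smult:
  assumes d: "d \<in> ideal_power I i" and P: "rees I n P" shows "rees I (n + i) (smult d P)"
proof -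
  have "rees I i [:d:]"
    using d by (auto simp: rees_def coeff_pCons ideal.subspace_0[OF subspace_ideal_power] split: nat.splits)
  from rees_mult[OF P this] show ?thesis by (simp add: mult.commute[of P])
qed

text \<open>That X^2 P is homogeneous of degree n says, without subtraction, that P has degree n -
  2. An element of I^2 in place of X^2 keeps the degree.\<close>

lemma rees_smult_square:
  assumes d: "d \<in> ideal_power I 2" and P: "rees I n (pCons 0 (pCons 0 P))" shows "rees I n (smult d P)"
proof -
  have "coeff (smult d P) k \<in> ideal_power I (n - k)" if k: "k \<le> n" for k
  proof (cases "k + 2 \<le> n")
    case True
    then have "coeff P k \<in> ideal_power I (n - (k + 2))" using reesD[OF P, of "k + 2"] by simp
    moreover have "2 + (n - (k + 2)) = n - k" using True by simp
    ultimately show ?thesis using ideal_power_mult_mem[OF d] by (metis coeff_smult)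
  next
    case False
    then have "coeff P k = 0" using rees_coeff_0[OF P, of "k + 2"] by simp
    then show ?thesis by (simp add: ideal.subspace_0[OF subspace_ideal_power])
  qed
  moreover have "coeff P k = 0" if "n < k" for k
    using rees_coeff_0[OF P, of "k + 2"] that by simp
  ultimately show ?thesis by (auto simp: rees_def)
qed

text \<open>An equation of integral dependence is the same as a homogeneous element that is monic in
  the variable.\<close>

lemma integral_closure_iff_rees:
  "u \<in> integral_closure I \<longleftrightarrow> (\<exists>n\<ge>1. \<exists>P. rees I n P \<and> coeff P n = 1 \<and> poly P u = 0)"
proof
  assume "u \<in> integral_closure I"
  then obtain n a where n: "n \<ge> 1" "\<And>i. i \<in> {1..n} \<Longrightarrow> a i \<in> ideal_power I i"
      "u ^ n + (\<Sum>i = 1..n. a i * u ^ (n - i)) = 0"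
    unfolding integral_closure_def by blast
  define P where "P = monom 1 n + (\<Sum>i = 1..n. monom (a i) (n - i))"
  have mon: "rees I n (monom c (n - i))" if "i \<le> n" "c \<in> ideal_power I i" for c i
    using that by (auto simp: rees_def ideal.subspace_0[OF subspace_ideal_power])
  have "rees I n P"
    unfolding P_def using mon[of 0 1] by (intro rees_add rees_sum mon) (use n in auto)
  moreover have "coeff P n = 1" by (auto simp: P_def coeff_sum intro!: sum.neutral)
  moreover have "poly P u = 0" using n(3) by (simp add: P_def poly_sum poly_monom)
  ultimately show "\<exists>n\<ge>1. \<exists>P. rees I n P \<and> coeff P n = 1 \<and> poly P u = 0" using n(1) by blast
next
  assume "\<exists>n\<ge>1. \<exists>P. rees I n P \<and> coeff P n = 1 \<and> poly P u = 0"
  then obtain n P where n: "n \<ge> 1" "rees I n P" "coeff P n = 1" "poly P u = 0" by blast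
  have "degree P = n"
    using n(3) rees_coeff_0[OF n(2)] by (intro antisym degree_le le_degree) auto
  then have "0 = (\<Sum>k\<le>n. coeff P k * u ^ k)" using n(4) by (simp add: poly_altdef)
  also have "\<dots> = (\<Sum>i\<in>{0..n}. coeff P (n - i) * u ^ (n - i))"
    by (rule sum.reindex_bij_witness[of _ "\<lambda>i. n - i" "\<lambda>i. n - i"]) auto
  also have "\<dots> = u ^ n + (\<Sum>i=1..n. coeff P (n - i) * u ^ (n - i))"
    by (subst sum.atLeast_Suc_atMost) (simp_all add: n(3))
  finally have eq: "u ^ n + (\<Sum>i=1..n. coeff P (n - i) * u ^ (n - i)) = 0" by simp
  show "u \<in> integral_closure I"
    unfolding integral_closure_def
    by (intro CollectI exI[of _ n] conjI exI[of _ "\<lambda>i. coeff P (n - i)"] ballI n(1) eq)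
      (use reesD[OF n(2)] in \<open>metis atLeastAtMost_iff diff_diff_cancel diff_le_self\<close>)
qed

text \<open>Writing \<open>(X - w)\<^sup>j = A\<^sub>j + w B\<^sub>j\<close> with \<open>A\<^sub>j\<close>, \<open>B\<^sub>j\<close> polynomials in
  \<open>w\<^sup>2\<close>, an equation \<open>P\<close> for \<open>u\<close> gives
  \<open>P(X - w) = A + w B\<close>, and \<open>A\<^sup>2 - w\<^sup>2 B\<^sup>2\<close> is an equation for \<open>u + w\<close>.\<close>

fun even_part :: "'a::comm_ring_1 \<Rightarrow> nat \<Rightarrow> 'a poly" and odd_part :: "'a \<Rightarrow> nat \<Rightarrow> 'a poly" where
  "even_part w 0 = 1"
| "odd_part w 0 = 0"
| "even_part w (Suc j) = pCons 0 (even_part w j) - smult (w ^ 2) (odd_part w j)"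
| "odd_part w (Suc j) = pCons 0 (odd_part w j) - even_part w j"

lemma poly_even_odd_part:
  "poly (even_part w j) x + w * poly (odd_part w j) x = (x - w) ^ j"
proof (induction j)
  case (Suc j)
  have "poly (even_part w (Suc j)) x + w * poly (odd_part w (Suc j)) x =
      (x - w) * (poly (even_part w j) x + w * poly (odd_part w j) x)"
    by (simp add: power2_eq_square algebra_simps)
  then show ?case by (simp only: Suc power_Suc)
qed simp

text \<open>The odd part has degree j - 1; the extra factor X expresses this without truncated
  subtraction, which matters at j = 0.\<close>

lemma rees_even_odd_part:
  assumes w: "w ^ 2 \<in> ideal_power I 2"
  shows "rees I j (even_part w j) \<and> rees I j (pCons 0 (odd_part w j)) \<and> coeff (even_part w j) j = 1"
proof (induction j)
  case 0
  have "rees I 0 1" by (simp add: rees_def)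
  then show ?case by (simp add: rees_0)
next
  case (Suc j)
  have X: "rees I (Suc j) (pCons 0 (even_part w j))" using Suc by (intro rees_pCons_0) simp
  have Y: "rees I (Suc j) (pCons 0 (pCons 0 (odd_part w j)))" using Suc by (intro rees_pCons_0) simp
  have "coeff (odd_part w j) (Suc j) = 0" using rees_coeff_0[OF Y, of "Suc j + 2"] by simp
  moreover have "pCons 0 (odd_part w (Suc j)) = pCons 0 (pCons 0 (odd_part w j)) - pCons 0 (even_part w j)"
    by simp
  ultimately show ?case
    using rees_diff[OF X rees_smult_square[OF w Y]] rees_diff[OF Y X] Suc by simp
qed

lemma integral_closure_add_square:
  assumes u: "u \<in> integral_closure I" and w: "w ^ 2 \<in> ideal_power I 2"
  shows "u + w \<in> integral_closure I"
proof -
  obtain n P where n: "n \<ge> 1" "rees I n P" "coeff P n = 1" "poly P u = 0"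
    using u unfolding integral_closure_iff_rees by blast
  define A where "A = (\<Sum>i\<le>n. smult (coeff P i) (even_part w i))"
  define B where "B = (\<Sum>i\<le>n. smult (coeff P i) (odd_part w i))"
  note eo = rees_even_odd_part[OF w]
  have A: "rees I n A"
    unfolding A_def
  proof (rule rees_sum)
    fix i assume "i \<in> {..n}"
    then show "rees I n (smult (coeff P i) (even_part w i))"
      using rees_smult[OF reesD[OF n(2)], of i i "even_part w i"] eo[of i] by simp
  qed
  have XB: "pCons 0 B = (\<Sum>i\<le>n. smult (coeff P i) (pCons 0 (odd_part w i)))"
  proof -
    have "pCons 0 B = [:0, 1:] * B" by simp
    then show ?thesis by (simp add: B_def sum_distrib_left)
  qed
  have B: "rees I n (pCons 0 B)"
    unfolding XB
  proof (rule rees_sum)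
    fix i assume "i \<in> {..n}"
    then show "rees I n (smult (coeff P i) (pCons 0 (odd_part w i)))"
      using rees_smult[OF reesD[OF n(2)], of i i "pCons 0 (odd_part w i)"] eo[of i] by simp
  qed
  have "coeff A n = (\<Sum>i\<le>n. if i = n then 1 else 0)"
    unfolding A_def coeff_sum
  proof (intro sum.cong refl)
    fix i assume "i \<in> {..n}"
    then show "coeff (smult (coeff P i) (even_part w i)) n = (if i = n then 1 else 0)"
      using eo[of i] n(3) rees_coeff_0[of I i "even_part w i" n] by auto
  qed
  then have An: "coeff A n = 1" by simp
  define Q where "Q = A * A - smult (w ^ 2) (B * B)"
  have BB: "rees I (n + n) (pCons 0 (pCons 0 (B * B)))"
    using rees_mult[OF B B] by simp
  have Q: "rees I (n + n) Q"
    unfolding Q_def by (intro rees_diff rees_mult A rees_smult_square[OF w BB])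
  have "coeff (A * A) (n + n) = (\<Sum>l\<le>n+n. if l = n then 1 else 0)"
    unfolding coeff_mult
  proof (intro sum.cong refl)
    fix l assume "l \<in> {..n + n}"
    then show "coeff A l * coeff A (n + n - l) = (if l = n then 1 else 0)"
      using An rees_coeff_0[OF A, of l] rees_coeff_0[OF A, of "n + n - l"]
      by (cases "l < n"; cases "l = n") auto
  qed
  \<comment> \<open>As B has degree at most n - 1, the top coefficient of Q comes from A
    alone.\<close>
  moreover have "coeff (B * B) (n + n) = 0" using rees_coeff_0[OF BB, of "n + n + 2"] by simp
  ultimately have Qn: "coeff Q (n + n) = 1" by (simp add: Q_def)
  have "degree P = n"
    using n(3) rees_coeff_0[OF n(2)] by (intro antisym degree_le le_degree) auto
  then have "poly P u = (\<Sum>i\<le>n. coeff P i * (u + w - w) ^ i)" by (simp add: poly_altdef)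
  also have "\<dots> = poly A (u + w) + w * poly B (u + w)"
    unfolding poly_even_odd_part[symmetric]
    by (simp add: A_def B_def poly_sum sum_distrib_left distrib_left mult.left_commute sum.distrib)
  finally have "poly A (u + w) = - (w * poly B (u + w))"
    using n(4) by (simp add: eq_neg_iff_add_eq_0)
  then have "poly Q (u + w) = 0" by (simp add: Q_def power2_eq_square mult_ac)
  then show ?thesis
    unfolding integral_closure_iff_rees using n(1) Q Qn by (intro exI[of _ "n + n"]) auto
qed

lemma zero_in_integral_closure: "0 \<in> integral_closure I"
proof -
  have "rees I 1 [:0, 1:]"
    by (auto simp: rees_def coeff_pCons zero_in_ideal_mult split: nat.splits)
  then show ?thesis unfolding integral_closure_iff_rees by (intro exI[of _ 1] conjI exI) auto
qed

text \<open>Multiples of a generator also have their square in I^2, so a linear combination is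
  reached from 0 by adding one such element at a time.\<close>

lemma span_subset_integral_closure:
  assumes "\<And>w. w \<in> G \<Longrightarrow> w ^ 2 \<in> ideal_power I 2"
  shows "ideal.span G \<subseteq> integral_closure I"
proof
  fix u assume "u \<in> ideal.span G"
  then show "u \<in> integral_closure I"
  proof (induction rule: ideal.span_induct_alt)
    case base
    show ?case by (rule zero_in_integral_closure)
  next
    case (step c w u)
    have "(c * w) ^ 2 \<in> ideal_power I 2"
      using ideal.subspace_scale[OF subspace_ideal_power assms[OF step(1)]]
      by (simp add: power_mult_distrib)
    with step(2) have "u + c * w \<in> integral_closure I" by (intro integral_closure_add_square)
    then show ?case by (simp add: add.commute)
  qed
qed

primrec var_products :: "'a::comm_ring_1 set \<Rightarrow> nat \<Rightarrow> 'a set" where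
  "var_products V 0 = {1}"
| "var_products V (Suc n) = {v * g |v g. v \<in> V \<and> g \<in> var_products V n}"

lemma ideal_power_span_subset: "ideal_power (ideal.span V) n \<subseteq> ideal.span (var_products V n)"
proof (induction n)
  case 0
  have "x \<in> ideal.span {1}" for x :: 'a
    using ideal.span_scale[OF ideal.span_base[of 1 "{1}"], of x] by simp
  then show ?case by auto
next
  case (Suc n)
  have prod: "v * b \<in> ideal.span (var_products V (Suc n))"
    if v: "v \<in> V" and b: "b \<in> ideal.span (var_products V n)" for v b
    using b
  proof (induction rule: ideal.span_induct_alt)
    case base
    show ?case by (simp add: ideal.span_zero)
  next
    case (step c g y)
    have "c * (v * g) \<in> ideal.span (var_products V (Suc n))"
      using v step(1) by (intro ideal.span_scale ideal.span_base) auto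
    with step(2) have "c * (v * g) + v * y \<in> ideal.span (var_products V (Suc n))"
      by (rule ideal.span_add[rotated])
    then show ?case by (simp only: distrib_left mult.left_commute)
  qed
  show ?case unfolding ideal_power.simps
  proof (rule ideal_mult_subset)
    fix a b assume a: "a \<in> ideal.span V" and "b \<in> ideal_power (ideal.span V) n"
    with Suc have b: "b \<in> ideal.span (var_products V n)" by blast
    show "a * b \<in> ideal.span (var_products V (Suc n))"
      using a
    proof (induction rule: ideal.span_induct_alt)
      case base
      show ?case by (simp add: ideal.span_zero)
    next
      case (step c v y)
      have "c * (v * b) \<in> ideal.span (var_products V (Suc n))"
        using prod[OF step(1) b] by (rule ideal.span_scale)
      with step(2) have "c * (v * b) + y * b \<in> ideal.span (var_products V (Suc n))"
        by (rule ideal.span_add[rotated])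
      then show ?case by (simp only: distrib_right mult.assoc)
    qed
  qed simp
qed

lemma local_max_power4_subset_integral_closure:
  assumes char: "CHAR('k::field) = 3"
  shows "ideal_power local_max_ideal 4 \<subseteq> integral_closure (test_ideal :: 'k diag_local set)"
proof -
  define V :: "'k diag_local set" where "V = {local_var 1, local_var 2, local_var 3, local_var 4}"
  have "ideal.span (var_products V 4) \<subseteq> integral_closure (test_ideal :: 'k diag_local set)"
  proof (rule span_subset_integral_closure)
    fix g assume "g \<in> var_products V 4"
    then obtain a b c d where "a \<in> V" "b \<in> V" "c \<in> V" "d \<in> V" "g = a * (b * (c * d))"
      by (auto simp: eval_nat_numeral)
    then obtain i j k l where "g = local_var i * (local_var j * (local_var k * local_var l))"
      unfolding V_def by blast
    then have "g ^ 2 = (local_var i ^ 2 * local_var j ^ 2) * (local_var k ^ 2 * local_var l ^ 2)"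
      by (simp add: power_mult_distrib mult.assoc)
    also have "\<dots> \<in> ideal_power test_ideal (1 + 1)"
      by (intro ideal_power_mult_mem ideal_power_1 local_var_squares_in_test_ideal char)
    finally show "g ^ 2 \<in> ideal_power test_ideal 2" by (simp only: one_add_one)
  qed
  with ideal_power_span_subset[of V 4] show ?thesis by (auto simp: local_max_ideal_def V_def)
qed

section \<open>Localized ideals\<close>

definition localize :: "'k::field mpoly4 set \<Rightarrow> 'k diag_local set" where
  "localize L = {y. \<exists>a s. a \<in> L \<and> lookup s 0 \<noteq> 0 \<and> y * loc s = loc a}"

lemma localizeI: "a \<in> L \<Longrightarrow> lookup s 0 \<noteq> 0 \<Longrightarrow> y * loc s = loc a \<Longrightarrow> y \<in> localize L"
  unfolding localize_def by blast

lemma localizeE: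
  assumes "y \<in> localize L" obtains a s where "a \<in> L" "lookup s 0 \<noteq> 0" "y * loc s = loc a"
  using assms unfolding localize_def by blast

lemma loc_in_localize: "a \<in> L \<Longrightarrow> loc a \<in> localize L"
  by (rule localizeI[of _ _ 1]) (simp_all add: loc.one)

lemma localize_mult:
  assumes "\<And>a b. a \<in> L \<Longrightarrow> b \<in> L' \<Longrightarrow> a * b \<in> L''" "y \<in> localize L" "z \<in> localize L'"
  shows "y * z \<in> localize L''"
proof -
  obtain a s where a: "a \<in> L" "lookup s 0 \<noteq> 0" "y * loc s = loc a" using assms(2) by (rule localizeE)
  obtain b t where b: "b \<in> L'" "lookup t 0 \<noteq> 0" "z * loc t = loc b" using assms(3) by (rule localizeE)
  show ?thesis
  proof (rule localizeI)
    show "a * b \<in> L''" using a b assms by blast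
    show "lookup (s * t) 0 \<noteq> 0" using a b by (simp add: lookup_mult_0)
    have "y * z * loc (s * t) = (y * loc s) * (z * loc t)" by (simp only: loc.mult mult_ac)
    then show "y * z * loc (s * t) = loc (a * b)" by (simp only: a b loc.mult)
  qed
qed

lemma subspace_localize:
  fixes L :: "'k::field mpoly4 set"
  assumes L: "ideal.subspace L" shows "ideal.subspace (localize L)"
proof (rule ideal.subspaceI)
  show "0 \<in> localize L"
    using loc_in_localize[OF ideal.subspace_0[OF L]] by (simp add: loc.zero)
next
  fix y z assume "y \<in> localize L" "z \<in> localize L"
  then obtain a s b t where a: "a \<in> L" "lookup s 0 \<noteq> 0" "y * loc s = loc a"
      and b: "b \<in> L" "lookup t 0 \<noteq> 0" "z * loc t = loc b"
    by (metis localizeE)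
  show "y + z \<in> localize L"
  proof (rule localizeI)
    show "t * a + s * b \<in> L" using a b L by (intro ideal.subspace_add ideal.subspace_scale)
    show "lookup (s * t) 0 \<noteq> 0" using a b by (simp add: lookup_mult_0)
    have "(y + z) * loc (s * t) = loc t * (y * loc s) + loc s * (z * loc t)"
      by (simp only: loc.mult algebra_simps)
    then show "(y + z) * loc (s * t) = loc (t * a + s * b)" by (simp only: a b loc.mult loc.add)
  qed
next
  fix c y :: "'k diag_local" assume y: "y \<in> localize L"
  obtain c' s where c: "lookup s 0 \<noteq> 0" "c * loc s = loc c'" by (rule loc_fraction)
  then have "c \<in> localize UNIV" by (intro localizeI) auto
  then show "c * y \<in> localize L"
    using y by (rule localize_mult[rotated]) (rule ideal.subspace_scale[OF L])
qed

lemma loc_in_localizeD: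
  assumes char: "CHAR('k::field) = 3" and "loc (a :: 'k mpoly4) \<in> localize L"
  obtains s h where "lookup s 0 \<noteq> 0" "h \<in> L" "diag_poly dvd s * a - h"
proof -
  obtain h s where h: "h \<in> L" "lookup s 0 \<noteq> 0" "loc a * loc s = loc h"
    using assms(2) by (rule localizeE)
  have "loc (s * a - h) = 0" using h(3) by (simp add: loc.diff loc.mult mult.commute)
  then show ?thesis using that h by (simp add: loc_eq_0_iff[OF char])
qed

section \<open>Coefficients of products\<close>

lemma lookup_single_mult:
  fixes a :: "'k::field mpoly4"
  shows "lookup (single k c * a) m =
    (if \<forall>i. lookup k i \<le> lookup m i then c * lookup a (m - k) else 0)"
proof (induction a rule: poly_mapping_add_induct)
  case (single n d)
  have "k + n = m \<longleftrightarrow> (\<forall>i. lookup k i \<le> lookup m i) \<and> n = m - k"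
    unfolding poly_mapping_eq_iff fun_eq_iff lookup_add lookup_minus
    by (metis add_diff_cancel_left' le_add1 le_add_diff_inverse)
  then show ?case by (auto simp: mult_single lookup_single when_def)
qed (simp add: distrib_left lookup_add)

lemma lookup_minus_le: "lookup (m - k) i \<le> lookup m i" for m k :: "4 \<Rightarrow>\<^sub>0 nat"
  by (simp add: lookup_minus)

lemma lookup_mult_keys:
  fixes a r :: "'k::field mpoly4"
  shows "lookup (r * a) m = (\<Sum>k\<in>keys r. lookup (single k (lookup r k) * a) m)"
  by (subst (1) poly_mapping_sum_single[of r]) (simp add: sum_distrib_right lookup_sum)

text \<open>This is the monomial ideal generated by the powers of each xi with exponent b_i + 1: no
  monomial dividing x^b occurs.\<close>

definition box :: "(4 \<Rightarrow>\<^sub>0 nat) \<Rightarrow> 'k::field mpoly4 set" where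
  "box b = {a. \<forall>m. (\<forall>i. lookup m i \<le> lookup b i) \<longrightarrow> lookup a m = 0}"

lemma subspace_box: "ideal.subspace (box b)"
proof (rule ideal.subspaceI)
  fix c x :: "'a mpoly4" assume x: "x \<in> box b"
  have "lookup (c * x) m = 0" if m: "\<forall>i. lookup m i \<le> lookup b i" for m
  proof (subst lookup_mult_keys, intro sum.neutral ballI)
    fix k
    have "\<forall>i. lookup (m - k) i \<le> lookup b i"
      using m lookup_minus_le le_trans by blast
    then have "lookup x (m - k) = 0" using x by (simp add: box_def)
    then show "lookup (single k (lookup c k) * x) m = 0" by (simp add: lookup_single_mult)
  qed
  then show "c * x \<in> box b" by (simp add: box_def)
qed (auto simp: box_def lookup_add)

definition mdeg :: "(4 \<Rightarrow>\<^sub>0 nat) \<Rightarrow> nat" where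
  "mdeg m = (\<Sum>i\<in>UNIV. lookup m i)"

lemma mdeg_add: "mdeg (m + n) = mdeg m + mdeg n"
  by (simp add: mdeg_def lookup_add sum.distrib)

lemma mdeg_single: "mdeg (single i n) = n"
proof -
  have "mdeg (single i n) = (\<Sum>j\<in>UNIV. if j = i then n else 0)"
    unfolding mdeg_def by (intro sum.cong) (auto simp: lookup_single when_def)
  then show ?thesis by simp
qed

lemma lookup_le_mdeg: "lookup m i \<le> mdeg m"
  unfolding mdeg_def by (rule member_le_sum) auto

lemma mdeg_eq_0_iff: "mdeg m = 0 \<longleftrightarrow> m = 0"
proof
  assume "mdeg m = 0"
  then show "m = 0" using lookup_le_mdeg[of m] by (intro poly_mapping_eqI) simp
qed (simp add: mdeg_def)

text \<open>The coefficient of s a at m is s_0 a_m plus contributions of a at proper divisors of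
  x^m. These divide x^b as well, so induction on the degree removes them.\<close>

lemma box_unit_cancel:
  assumes s: "lookup s 0 \<noteq> 0" and sa: "s * a \<in> box b" shows "a \<in> box b"
proof -
  have "lookup a m = 0" if "\<forall>i. lookup m i \<le> lookup b i" for m
    using that
  proof (induction "mdeg m" arbitrary: m rule: less_induct)
    case less
    have "lookup (single k (lookup s k) * a) m = 0" if "k \<noteq> 0" for k
    proof (cases "\<forall>i. lookup k i \<le> lookup m i")
      case True
      have "m = k + (m - k)"
        by (rule poly_mapping_eqI) (use True in \<open>simp add: lookup_add lookup_minus\<close>)
      then have "mdeg m = mdeg k + mdeg (m - k)" by (metis mdeg_add)
      moreover have "mdeg k \<noteq> 0" using that by (simp add: mdeg_eq_0_iff)
      moreover have "\<forall>i. lookup (m - k) i \<le> lookup b i"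
        using less.prems lookup_minus_le le_trans by blast
      ultimately have "lookup a (m - k) = 0" using less.hyps[of "m - k"] by simp
      then show ?thesis by (simp add: lookup_single_mult)
    qed (auto simp: lookup_single_mult)
    then have "lookup (s * a) m = (\<Sum>k\<in>{0}. lookup (single k (lookup s k) * a) m)"
      using s by (subst lookup_mult_keys, intro sum.mono_neutral_right) (auto simp: in_keys_iff)
    also have "\<dots> = lookup s 0 * lookup a m" by (simp add: lookup_single_mult)
    finally show ?case using sa s less.prems by (auto simp: box_def)
  qed
  then show ?thesis by (simp add: box_def)
qed

lemma lookup_diag_poly: "lookup (diag_poly :: 'k::field mpoly4) m \<noteq> 0 \<Longrightarrow> \<exists>i. m = single i 7"
  unfolding diag_poly_def pvar_power lookup_add
  by (metis add_0 lookup_single_not_eq)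

lemma diag_poly_in_box:
  assumes "\<And>i. lookup b i < 7" shows "diag_poly \<in> box b"
  unfolding box_def
proof (intro CollectI allI impI, rule ccontr)
  fix m assume m: "\<forall>i. lookup m i \<le> lookup b i" "lookup (diag_poly :: 'a mpoly4) m \<noteq> 0"
  then obtain i where "m = single i 7" using lookup_diag_poly by blast
  then have "7 \<le> lookup b i" using m(1) by (metis lookup_single_eq)
  with assms[of i] show False by simp
qed

text \<open>As all b_i are below 7, f already lies in the monomial ideal, so reduction modulo f
  loses nothing.\<close>

lemma loc_in_localize_box:
  assumes char: "CHAR('k::field) = 3" and b: "\<And>i. lookup b i < 7"
    and "loc (a :: 'k mpoly4) \<in> localize (box b)"
  shows "a \<in> box b"
proof -
  obtain s h where s: "lookup s 0 \<noteq> 0" "h \<in> box b" "diag_poly dvd s * a - h"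
    using loc_in_localizeD[OF char assms(3)] by blast
  then obtain g where "s * a - h = g * diag_poly" by (auto simp: dvd_def mult.commute)
  then have "s * a = g * diag_poly + h" by (simp add: algebra_simps)
  also have "\<dots> \<in> box b"
    using s(2) by (intro ideal.subspace_add[OF subspace_box] ideal.subspace_scale[OF subspace_box]
        diag_poly_in_box b)
  finally show ?thesis using box_unit_cancel[OF s(1)] by blast
qed

section \<open>An upper bound for the test ideal\<close>

lemma frobenius_power_power:
  assumes char: "CHAR('a::comm_ring_1) = 3" and v: "(v :: 'a) \<in> frobenius_power I r"
  shows "v ^ 3 ^ e \<in> frobenius_power I (r * 3 ^ e)"
  using v unfolding frobenius_power_def[of I r]
proof (induction rule: ideal.span_induct_alt)
  case base
  show ?case by (simp add: frobenius_power_def ideal.span_zero power_0_left)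
next
  case (step c x y)
  then obtain a where a: "x = a ^ r" "a \<in> I" by auto
  have "c ^ 3 ^ e * a ^ (r * 3 ^ e) \<in> frobenius_power I (r * 3 ^ e)"
    using a(2) unfolding frobenius_power_def by (intro ideal.span_scale ideal.span_base) auto
  then show ?case
    using step(2) ideal.subspace_add[OF subspace_frobenius_power]
    by (simp add: frobenius_add[OF char] power_mult_distrib a(1) power_mult)
qed

text \<open>Raising the membership of u^3 to powers of 3 gives it for all q from 3 on, so the
  multiplier 1 works with \<open>e0 = 1\<close>.\<close>

lemma frobenius_power_3_subset_tight_closure:
  assumes char: "CHAR('a::comm_ring_1) = 3" and u: "(u :: 'a) ^ 3 \<in> frobenius_power I 3"
  shows "u \<in> tight_closure I"
proof -
  have "1 * u ^ 3 ^ e \<in> frobenius_power I (3 ^ e)" if e: "e \<ge> 1" for e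
  proof -
    obtain e' where "e = Suc e'" using e by (cases e) auto
    then show ?thesis using frobenius_power_power[OF char u, of e'] by (simp add: power_mult)
  qed
  then show ?thesis
    unfolding tight_closure_def char using one_notin_minimal_prime by blast
qed

lemma test_ideal_mult_tight_closure:
  assumes "c \<in> test_ideal" "ideal.subspace I" "u \<in> tight_closure I"
  shows "c * u \<in> (I :: 'a::comm_ring_1 set)"
proof -
  have "c * u ^ (CHAR('a) ^ 0) \<in> frobenius_power I (CHAR('a) ^ 0)"
    using assms unfolding test_ideal_def by blast
  then show ?thesis using assms(2) by (simp add: frobenius_power_def ideal.span_eq_iff[THEN iffD2])
qed

text \<open>The exponents \<open>\<alpha>\<close> for which \<open>u = x\<^sub>1\<^bsup>6-\<alpha>\<^sub>1\<^esup>\<close> satisfies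
  \<open>u\<^sup>3 \<in> I\<^bsup>[3]\<^esup>\<close>, where \<open>I\<close> is generated by the
  \<open>x\<^sub>i\<^bsup>\<alpha>\<^sub>i+1\<^esup>\<close>, \<open>i \<noteq> 1\<close>: replace \<open>x\<^sub>1\<^sup>7\<close> by
  \<open>- x\<^sub>2\<^sup>7 - x\<^sub>3\<^sup>7 - x\<^sub>4\<^sup>7\<close>, once in the first case and twice in the second.\<close>

definition frobenius_nilpotent_exponent :: "(4 \<Rightarrow>\<^sub>0 nat) \<Rightarrow> bool" where
  "frobenius_nilpotent_exponent \<alpha> \<longleftrightarrow>
     lookup \<alpha> 1 \<le> 3 \<and> (\<forall>i. i \<noteq> 1 \<longrightarrow> lookup \<alpha> i \<le> 1) \<or>
     lookup \<alpha> 1 \<le> 1 \<and> (\<forall>i. lookup \<alpha> i \<le> 3) \<and>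
     (\<forall>i j. i \<noteq> 1 \<longrightarrow> j \<noteq> 1 \<longrightarrow> i \<noteq> j \<longrightarrow> lookup \<alpha> i \<le> 1 \<or> lookup \<alpha> j \<le> 1)"

lemma local_var_relation:
  assumes char: "CHAR('k::field) = 3"
  shows "(local_var 1 :: 'k diag_local) ^ 7 = - (\<Sum>i\<in>{2,3,4}. local_var i ^ 7)"
proof -
  have "loc (diag_poly :: 'k mpoly4) = 0" by (simp add: loc_eq_0_iff[OF char])
  then have "(local_var 1 :: 'k diag_local) ^ 7 + (\<Sum>i\<in>{2,3,4}. local_var i ^ 7) = 0"
    by (simp add: diag_poly_def loc.add loc.power loc_pvar add.assoc)
  then show ?thesis unfolding eq_neg_iff_add_eq_0 .
qed

lemma frobenius_nilpotent:
  fixes \<alpha> :: "4 \<Rightarrow>\<^sub>0 nat"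
  assumes char: "CHAR('k::field) = 3" and \<alpha>: "frobenius_nilpotent_exponent \<alpha>"
  defines "I \<equiv> ideal.span ((\<lambda>i. local_var i ^ (lookup \<alpha> i + 1)) ` {2,3,4}) :: 'k diag_local set"
  shows "(local_var 1 ^ (6 - lookup \<alpha> 1)) ^ 3 \<in> frobenius_power I 3"
proof -
  define J where "J = frobenius_power I 3"
  have J: "ideal.subspace J" by (simp add: J_def subspace_frobenius_power)
  have mem: "z * local_var i ^ l \<in> J" if "i \<noteq> 1" "3 * (lookup \<alpha> i + 1) \<le> l" for i l z
  proof -
    have "i \<in> {2,3,4}" using that(1) by (cases i rule: index4_cases) auto
    then have "local_var i ^ (lookup \<alpha> i + 1) \<in> I"
      unfolding I_def by (intro ideal.span_base) auto
    then have "(local_var i ^ (lookup \<alpha> i + 1)) ^ 3 \<in> J"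
      unfolding J_def frobenius_power_def by (intro ideal.span_base imageI)
    then have "z * local_var i ^ (l - 3 * (lookup \<alpha> i + 1)) * (local_var i ^ (lookup \<alpha> i + 1)) ^ 3 \<in> J"
      by (rule ideal.subspace_scale[OF J])
    moreover have "(local_var i :: 'k diag_local) ^ (l - 3 * (lookup \<alpha> i + 1)) *
        (local_var i ^ (lookup \<alpha> i + 1)) ^ 3 = local_var i ^ l"
      using that(2) unfolding power_mult[symmetric] power_add[symmetric]
      by (intro arg_cong[where f = "(^) (local_var i)"]) simp
    ultimately show ?thesis by (simp only: mult.assoc)
  qed
  let ?g = "\<Sum>i\<in>{2,3,4}. (local_var i :: 'k diag_local) ^ 7"
  \<comment> \<open>Replacing x1^7 r times needs 18 - 3 alpha_1 to be at least 7 r: alpha_1 up to 3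
    allows r = 1, and up to 1 allows r = 2. A term xi^7 lies in I^[3] if alpha_i is at most 1, and
    xi^14 if it is at most 3.\<close>
  have "\<exists>r n. 7 * r + n = (6 - lookup \<alpha> 1) * 3 \<and> ?g ^ r \<in> J"
    using \<alpha> unfolding frobenius_nilpotent_exponent_def
  proof (elim disjE conjE)
    assume a: "lookup \<alpha> 1 \<le> 3" "\<forall>i. i \<noteq> 1 \<longrightarrow> lookup \<alpha> i \<le> 1"
    have "?g \<in> J"
    proof (rule ideal.subspace_sum[OF J])
      fix i :: 4 assume "i \<in> {2,3,4}"
      then have i: "i \<noteq> 1" by auto
      with a(2) have "lookup \<alpha> i \<le> 1" by blast
      then show "local_var i ^ 7 \<in> J" using mem[OF i, of 7 1] by simp
    qed
    then show ?thesis using a(1)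
      by (intro exI[of _ 1] exI[of _ "(6 - lookup \<alpha> 1) * 3 - 7"]) auto
  next
    assume a: "lookup \<alpha> 1 \<le> 1" "\<forall>i. lookup \<alpha> i \<le> 3"
      "\<forall>i j. i \<noteq> 1 \<longrightarrow> j \<noteq> 1 \<longrightarrow> i \<noteq> j \<longrightarrow> lookup \<alpha> i \<le> 1 \<or> lookup \<alpha> j \<le> 1"
    have "?g * ?g \<in> J"
      unfolding sum_product
    proof (intro ideal.subspace_sum[OF J])
      fix i j :: 4 assume "i \<in> {2,3,4}" "j \<in> {2,3,4}"
      then have ij: "i \<noteq> 1" "j \<noteq> 1" by auto
      show "local_var i ^ 7 * local_var j ^ 7 \<in> J"
      proof (cases "i = j")
        case True
        have "lookup \<alpha> i \<le> 3" using a(2) by blast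
        then show ?thesis using mem[OF ij(1), of 14 1] True by (simp flip: power_add)
      next
        case False
        then have "lookup \<alpha> i \<le> 1 \<or> lookup \<alpha> j \<le> 1" using a(3) ij by blast
        then show ?thesis
          using mem[OF ij(1), of 7 "local_var j ^ 7"] mem[OF ij(2), of 7 "local_var i ^ 7"]
          by (auto simp: mult.commute)
      qed
    qed
    then show ?thesis using a(1)
      by (intro exI[of _ 2] exI[of _ "(6 - lookup \<alpha> 1) * 3 - 14"]) (auto simp: power2_eq_square)
  qed
  then obtain r n where r: "7 * r + n = (6 - lookup \<alpha> 1) * 3" "?g ^ r \<in> J" by blast
  have "(local_var 1 ^ (6 - lookup \<alpha> 1)) ^ 3 = (local_var 1 ^ 7) ^ r * (local_var 1 :: 'k diag_local) ^ n"
    unfolding power_mult[symmetric] power_add[symmetric] r(1) ..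
  also have "\<dots> = ((- 1) ^ r * local_var 1 ^ n) * ?g ^ r"
    unfolding local_var_relation[OF char] by (subst power_minus) (simp only: mult_ac)
  also have "\<dots> \<in> J" using r(2) by (rule ideal.subspace_scale[OF J])
  finally show ?thesis by (simp add: J_def)
qed

text \<open>The exponent b agrees with alpha except that x1 gets exponent 6, the largest for which f
  still lies in the monomial ideal of b. Multiplication by u moves the coefficient at alpha to b,
  where it has to vanish.\<close>

lemma test_ideal_coeff_eq_0:
  fixes c :: "'k::field diag_local"
  assumes char: "CHAR('k) = 3" and c: "c \<in> test_ideal" "c * loc s = loc a"
    and \<alpha>: "frobenius_nilpotent_exponent \<alpha>"
  shows "lookup a \<alpha> = 0"
proof -
  have \<alpha>_le: "lookup \<alpha> i \<le> 3" for i
    using \<alpha> unfolding frobenius_nilpotent_exponent_def by (cases "i = 1") (auto intro: le_trans)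
  define I where "I = (ideal.span ((\<lambda>i. local_var i ^ (lookup \<alpha> i + 1)) ` {2,3,4}) :: 'k diag_local set)"
  define n where "n = 6 - lookup \<alpha> 1"
  define b where "b = \<alpha> + single 1 n"
  have b: "lookup b i = (if i = 1 then 6 else lookup \<alpha> i)" for i
    using \<alpha>_le[of 1] by (simp add: b_def n_def lookup_add lookup_single when_def)
  have "local_var 1 ^ n \<in> tight_closure I"
    using frobenius_nilpotent[OF char \<alpha>] unfolding I_def[symmetric] n_def[symmetric]
    by (rule frobenius_power_3_subset_tight_closure[OF char_local[OF char]])
  then have "c * local_var 1 ^ n \<in> I"
    by (intro test_ideal_mult_tight_closure[OF c(1)]) (simp_all add: I_def)
  moreover have "I \<subseteq> localize (box b)"
    unfolding I_def
  proof (rule ideal.span_minimal[OF _ subspace_localize[OF subspace_box]], rule image_subsetI)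
    fix i :: 4 assume "i \<in> {2,3,4}"
    then have i: "i \<noteq> 1" by auto
    have "pvar i ^ (lookup \<alpha> i + 1) \<in> (box b :: 'k mpoly4 set)"
      unfolding box_def pvar_power
    proof (intro CollectI allI impI)
      fix m assume "\<forall>j. lookup m j \<le> lookup b j"
      then have "lookup m i \<le> lookup \<alpha> i" using i b by metis
      then have "m \<noteq> single i (lookup \<alpha> i + 1)" by auto
      then show "lookup (single (single i (lookup \<alpha> i + 1)) (1::'k)) m = 0"
        by (metis lookup_single_not_eq)
    qed
    from loc_in_localize[OF this] show "(local_var i :: 'k diag_local) ^ (lookup \<alpha> i + 1) \<in> localize (box b)"
      by (simp only: loc.power loc_pvar)
  qed
  ultimately have "loc s * (c * local_var 1 ^ n) \<in> localize (box b)"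
    using ideal.subspace_scale[OF subspace_localize[OF subspace_box]] by blast
  also have "loc s * (c * local_var 1 ^ n) = (c * loc s) * local_var 1 ^ n"
    by (simp only: mult_ac)
  also have "\<dots> = loc (pvar 1 ^ n * a)"
    by (simp only: c(2) loc.mult loc.power loc_pvar mult.commute)
  finally have "pvar 1 ^ n * a \<in> box b"
    by (rule loc_in_localize_box[OF char, rotated]) (use \<alpha>_le in \<open>simp add: b le_less_trans[of _ 3]\<close>)
  then have "lookup (pvar 1 ^ n * a) b = 0" by (simp add: box_def)
  moreover have "b - single 1 n = \<alpha>" by (simp add: b_def)
  ultimately show ?thesis
    by (simp add: pvar_power lookup_single_mult b_def lookup_add split: if_splits)
qed

text \<open>Two exponents of at least 2 would force degree 4. So if alpha_1 is at least 2, all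
  others are at most 1; otherwise the second case holds.\<close>

lemma mdeg_le_3_frobenius_nilpotent:
  assumes "mdeg \<alpha> \<le> 3" shows "frobenius_nilpotent_exponent \<alpha>"
proof -
  have pair: "lookup \<alpha> i + lookup \<alpha> j \<le> 3" if "i \<noteq> j" for i j
  proof -
    have "lookup \<alpha> i + lookup \<alpha> j = (\<Sum>x\<in>{i, j}. lookup \<alpha> x)" using that by simp
    also have "\<dots> \<le> mdeg \<alpha>" unfolding mdeg_def by (rule sum_mono2) auto
    finally show ?thesis using assms by simp
  qed
  have single: "lookup \<alpha> i \<le> 3" for i using lookup_le_mdeg[of \<alpha> i] assms by simp
  show ?thesis
  proof (cases "lookup \<alpha> 1 \<le> 1")
    case True
    have "lookup \<alpha> i \<le> 1 \<or> lookup \<alpha> j \<le> 1" if "i \<noteq> j" for i j using pair[OF that] by arith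
    then show ?thesis using True single by (auto simp: frobenius_nilpotent_exponent_def)
  next
    case False
    have "lookup \<alpha> i \<le> 1" if "i \<noteq> 1" for i using pair[OF that] False by arith
    then show ?thesis using single by (auto simp: frobenius_nilpotent_exponent_def)
  qed
qed

section \<open>The filtration by order at the origin\<close>

definition order_ge :: "nat \<Rightarrow> 'k::field mpoly4 set" where
  "order_ge j = {a. \<forall>m. mdeg m < j \<longrightarrow> lookup a m = 0}"

lemma order_ge_mult: "a \<in> order_ge i \<Longrightarrow> b \<in> order_ge j \<Longrightarrow> a * b \<in> order_ge (i + j)"
proof -
  assume a: "a \<in> order_ge i" and b: "b \<in> order_ge j"
  have "i + j \<le> mdeg m" if m: "m \<in> keys (a * b)" for m
  proof -
    obtain k l where "m = k + l" "k \<in> keys a" "l \<in> keys b" using m keys_mult[of a b] by blast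
    moreover from this have "i \<le> mdeg k" "j \<le> mdeg l"
      using a b by (auto simp: order_ge_def in_keys_iff not_less[symmetric])
    ultimately show ?thesis by (simp add: mdeg_add)
  qed
  then show ?thesis by (auto simp: order_ge_def in_keys_iff not_le[symmetric])
qed

lemma order_ge_mono: "i \<le> j \<Longrightarrow> order_ge j \<subseteq> order_ge i"
  by (auto simp: order_ge_def)

lemma subspace_order_ge: "ideal.subspace (order_ge j)"
proof (rule ideal.subspaceI)
  fix c x :: "'a mpoly4" assume "x \<in> order_ge j"
  moreover have "c \<in> order_ge 0" by (simp add: order_ge_def)
  ultimately show "c * x \<in> order_ge j" using order_ge_mult[of c 0 x j] by simp
qed (auto simp: order_ge_def lookup_add)

lemma local_var_in_local_max_ideal: "local_var i \<in> local_max_ideal"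
  unfolding local_max_ideal_def by (rule ideal.span_base) (cases i rule: index4_cases; simp)

lemma loc_single_in_local_max_power:
  "j \<le> mdeg m \<Longrightarrow> loc (single m c) \<in> ideal_power local_max_ideal j"
proof (induction j arbitrary: m)
  case (Suc j)
  then have "m \<noteq> 0" by (auto simp: mdeg_def)
  then obtain i where i: "lookup m i \<noteq> 0" by (metis lookup_zero poly_mapping_eqI)
  have m: "m = single i 1 + (m - single i 1)"
    using i by (intro poly_mapping_eqI) (auto simp: lookup_add lookup_minus lookup_single when_def)
  have "mdeg m = 1 + mdeg (m - single i 1)" by (metis m mdeg_add mdeg_single)
  with Suc have "loc (single (m - single i 1) c) \<in> ideal_power local_max_ideal j" by simp
  then have "local_var i * loc (single (m - single i 1) c) \<in> ideal_power local_max_ideal (Suc j)"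
    unfolding ideal_power.simps by (intro ideal_mult_memI local_var_in_local_max_ideal)
  also have "local_var i * loc (single (m - single i 1) c) = loc (pvar i * single (m - single i 1) c)"
    by (simp only: loc.mult loc_pvar)
  also have "pvar i * single (m - single i 1) c = single (single i 1 + (m - single i 1)) c"
    by (simp add: pvar_def mult_single)
  also have "\<dots> = single m c" by (simp only: m[symmetric])
  finally show ?case .
qed simp

lemma localize_order_ge_subset: "localize (order_ge j) \<subseteq> ideal_power local_max_ideal j"
proof
  fix y assume "y \<in> localize (order_ge j)"
  then obtain a s where a: "a \<in> order_ge j" "lookup s 0 \<noteq> 0" "y * loc s = loc a" by (rule localizeE)
  have "loc a = (\<Sum>m\<in>keys a. loc (single m (lookup a m)))"
    by (subst (1) poly_mapping_sum_single[of a]) (rule loc.sum)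
  also have "\<dots> \<in> ideal_power local_max_ideal j"
    using a(1) by (intro ideal.subspace_sum[OF subspace_ideal_power] loc_single_in_local_max_power)
      (auto simp: order_ge_def in_keys_iff not_less[symmetric])
  finally have la: "loc a \<in> ideal_power local_max_ideal j" .
  obtain t where t: "loc s * t = 1" using a(2) by (rule loc_unit)
  have "t * (y * loc s) = y * (loc s * t)" by (simp only: mult_ac)
  then have "y = t * (y * loc s)" by (simp only: t mult_1_right)
  also have "\<dots> \<in> ideal_power local_max_ideal j"
    unfolding a(3) by (rule ideal.subspace_scale[OF subspace_ideal_power la])
  finally show "y \<in> ideal_power local_max_ideal j" .
qed

lemma test_ideal_subset:
  assumes char: "CHAR('k::field) = 3"
  shows "(test_ideal :: 'k diag_local set) \<subseteq> localize (order_ge 4)"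
proof
  fix c :: "'k diag_local" assume c: "c \<in> test_ideal"
  obtain a s where a: "lookup s 0 \<noteq> 0" "c * loc s = loc a" by (rule loc_fraction)
  have "lookup a \<alpha> = 0" if "mdeg \<alpha> < 4" for \<alpha>
    using test_ideal_coeff_eq_0[OF char c a(2) mdeg_le_3_frobenius_nilpotent] that by simp
  then have "a \<in> order_ge 4" by (simp add: order_ge_def)
  then show "c \<in> localize (order_ge 4)" using a by (rule localizeI)
qed

lemma x1_x2_cube_notin_test_ideal:
  assumes char: "CHAR('k::field) = 3"
  shows "local_var 1 * local_var 2 ^ 3 \<notin> (test_ideal :: 'k diag_local set)"
proof
  assume c: "local_var 1 * local_var 2 ^ 3 \<in> (test_ideal :: 'k diag_local set)"
  define \<alpha> :: "4 \<Rightarrow>\<^sub>0 nat" where "\<alpha> = single 1 1 + single 2 3"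
  have "pvar 1 * pvar 2 ^ 3 = (single \<alpha> 1 :: 'k mpoly4)"
    unfolding pvar_power by (simp add: pvar_def \<alpha>_def mult_single)
  then have "local_var 1 * local_var 2 ^ 3 * loc 1 = loc (single \<alpha> 1 :: 'k mpoly4)"
    by (metis loc.mult loc.power loc_pvar mult.right_neutral)
  moreover have "frobenius_nilpotent_exponent \<alpha>"
    by (auto simp: frobenius_nilpotent_exponent_def \<alpha>_def lookup_add lookup_single when_def)
  ultimately have "lookup (single \<alpha> (1::'k)) \<alpha> = 0"
    by (rule test_ideal_coeff_eq_0[OF char c])
  then show False by simp
qed

lemma x1_x2_cube_in_local_max_power:
  "local_var 1 * local_var 2 ^ 3 \<in> ideal_power (local_max_ideal :: 'k::field diag_local set) 4"
proof -
  have "local_var 1 * local_var 2 ^ 3 = loc (pvar 1 * pvar 2 ^ 3 :: 'k mpoly4)"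
    by (simp only: loc.mult loc.power loc_pvar)
  also have "pvar 1 * pvar 2 ^ 3 = (single (single 1 1 + single 2 3) 1 :: 'k mpoly4)"
    unfolding pvar_power by (simp add: pvar_def mult_single)
  finally show ?thesis
    by (simp add: loc_single_in_local_max_power mdeg_add mdeg_single del: One_nat_def)
qed

section \<open>Powers of the maximal ideal are integrally closed in low degree\<close>

text \<open>Substitutes xi T for xi, so that the coefficient of T^N is the homogeneous part of
  degree N.\<close>

definition graded :: "'k::field mpoly4 \<Rightarrow> 'k mpoly4 poly" where
  "graded = mpoly_eval (\<lambda>c. [:single 0 c:]) (\<lambda>i. monom (pvar i) 1)"

lemma ring_map_graded_const: "ring_map (\<lambda>c :: 'k::field. [:single 0 c :: 'k mpoly4:])"
  by standard (simp_all add: single_add mult_single one_pCons mult.commute)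

lemma ring_map_graded: "ring_map graded"
  unfolding graded_def by (rule ring_map_mpoly_eval[OF ring_map_graded_const])

interpretation graded: ring_map graded by (rule ring_map_graded)

lemma graded_pvar: "graded (pvar i) = monom (pvar i) 1"
  unfolding graded_def pvar_def by (rule mpoly_eval_var[OF ring_map_graded_const])

lemma graded_diag_poly: "graded diag_poly = monom diag_poly 7"
  unfolding diag_poly_def by (simp add: graded.add graded.power graded_pvar monom_power add_monom)

lemma graded_single: "graded (single m c) = monom (single m c) (mdeg m)"
proof -
  have "graded (single m 1) = monom (single m (1 :: 'a)) (mdeg m)"
  proof (induction m rule: poly_mapping_add_induct)
    case (single i n)
    show ?case
      unfolding pvar_power[symmetric] graded.power graded_pvar monom_power mdeg_single by simp
  next
    case (add m n)
    have "single (m + n) (1 :: 'a) = single m 1 * single n 1" by (simp add: mult_single)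
    then show ?case by (simp add: graded.mult add mult_monom mdeg_add)
  qed
  moreover have "graded (single 0 c) = [:single 0 c:]"
    unfolding graded_def by (rule mpoly_eval_const[OF ring_map_graded_const])
  moreover have "single m c = single 0 c * single m 1" by (simp add: mult_single)
  ultimately have "graded (single m c) = [:single 0 c:] * monom (single m 1) (mdeg m)"
    by (metis graded.mult)
  then show ?thesis by (simp add: smult_monom mult_single)
qed

lemma lookup_coeff_graded: "lookup (coeff (graded a) N) m = (lookup a m when mdeg m = N)"
proof (induction a rule: poly_mapping_add_induct)
  case (single k c)
  show ?case by (auto simp: graded_single lookup_single when_def)
qed (simp add: graded.add lookup_add when_add_distrib)

lemma coeff_graded_order_ge: "a \<in> order_ge j \<Longrightarrow> N < j \<Longrightarrow> coeff (graded a) N = 0"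
  by (rule poly_mapping_eqI) (simp add: lookup_coeff_graded order_ge_def when_def)

lemma coeff_mult_lowest:
  fixes P Q :: "'a::comm_ring_1 poly"
  assumes "\<And>k. k < i \<Longrightarrow> coeff P k = 0" "\<And>k. k < j \<Longrightarrow> coeff Q k = 0"
  shows "coeff (P * Q) (i + j) = coeff P i * coeff Q j" "\<And>k. k < i + j \<Longrightarrow> coeff (P * Q) k = 0"
proof -
  have "coeff (P * Q) (i + j) = (\<Sum>k\<in>{i}. coeff P k * coeff Q (i + j - k))"
    unfolding coeff_mult
  proof (rule sum.mono_neutral_right)
    show "\<forall>k\<in>{..i + j} - {i}. coeff P k * coeff Q (i + j - k) = 0"
    proof
      fix k assume "k \<in> {..i + j} - {i}"
      then have "k < i \<or> i + j - k < j" by auto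
      then show "coeff P k * coeff Q (i + j - k) = 0" using assms by auto
    qed
  qed auto
  then show "coeff (P * Q) (i + j) = coeff P i * coeff Q j" by simp
  show "coeff (P * Q) k = 0" if "k < i + j" for k
    unfolding coeff_mult
  proof (rule sum.neutral, rule ballI)
    fix l assume "l \<in> {..k}"
    with that have "l < i \<or> k - l < j" by auto
    then show "coeff P l * coeff Q (k - l) = 0" using assms by auto
  qed
qed

lemma coeff_power_lowest:
  fixes P :: "'a::comm_ring_1 poly"
  assumes "\<And>k. k < j \<Longrightarrow> coeff P k = 0"
  shows "coeff (P ^ n) (n * j) = coeff P j ^ n \<and> (\<forall>k<n * j. coeff (P ^ n) k = 0)"
proof (induction n)
  case (Suc n)
  then show ?case
    using coeff_mult_lowest[of j P "n * j" "P ^ n"] assms by simp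
qed simp

text \<open>In degree n j the element h contributes nothing, so f divides s_0 L^n, where L is the
  initial form of a. By primality f divides L, which is impossible for a nonzero form of degree j <
  7.\<close>

lemma leading_form_contradiction:
  fixes a :: "'k::field mpoly4"
  assumes char: "CHAR('k) = 3" and s: "lookup s 0 \<noteq> 0" and a: "a \<in> order_ge j" "a \<notin> order_ge (Suc j)"
    and j: "j < 7" and h: "h \<in> order_ge (n * j + 1)" and dvd: "diag_poly dvd s * a ^ n - h"
  shows False
proof -
  obtain k where k: "s * a ^ n - h = diag_poly * k" using dvd by (auto simp: dvd_def)
  define L where "L = coeff (graded a) j"
  have "graded s * graded a ^ n = graded h + monom diag_poly 7 * graded k"
    unfolding graded_diag_poly[symmetric] graded.mult[symmetric] graded.power[symmetric]
      graded.add[symmetric] k[symmetric] by simp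
  then have "coeff (graded s * graded a ^ n) (0 + n * j) =
      coeff (graded h) (n * j) + coeff (monom diag_poly 7 * graded k) (n * j)"
    by simp
  moreover have "coeff (graded h) (n * j) = 0" using coeff_graded_order_ge[OF h] by simp
  moreover have "diag_poly dvd coeff (monom diag_poly 7 * graded k) (n * j)"
    by (simp add: coeff_monom_mult)
  moreover have "coeff (graded s * graded a ^ n) (0 + n * j) = coeff (graded s) 0 * L ^ n"
    using coeff_mult_lowest(1)[of 0 "graded s" "n * j" "graded a ^ n"]
      coeff_power_lowest[of j "graded a" n] coeff_graded_order_ge[OF a(1)] by (simp add: L_def)
  ultimately have "diag_poly dvd coeff (graded s) 0 * L ^ n" by simp
  moreover have "lookup (coeff (graded s) 0) 0 \<noteq> 0"
    using s by (simp add: lookup_coeff_graded mdeg_def)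
  ultimately have "diag_poly dvd L ^ n"
    using diag_poly_prime[OF char] not_diag_poly_dvd_unit by blast
  then have "diag_poly dvd L"
  proof (induction n)
    case 0
    then show ?case using not_diag_poly_dvd_unit[of "1 :: 'k mpoly4"] by simp
  qed (use diag_poly_prime[OF char] in auto)
  then obtain g where "L = g * diag_poly" by (auto simp: dvd_def mult.commute)
  moreover have "diag_poly \<in> (order_ge 7 :: 'k mpoly4 set)"
    using lookup_diag_poly by (fastforce simp: order_ge_def mdeg_single)
  ultimately have L: "L \<in> order_ge 7" by (simp add: ideal.subspace_scale[OF subspace_order_ge])
  obtain m where m: "mdeg m < Suc j" "lookup a m \<noteq> 0" using a(2) by (auto simp: order_ge_def)
  with a(1) have "mdeg m = j" by (auto simp: order_ge_def less_Suc_eq)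
  then have "lookup L m \<noteq> 0" using m(2) by (simp add: L_def lookup_coeff_graded)
  then show False using L j \<open>mdeg m = j\<close> by (simp add: order_ge_def)
qed

lemma ideal_power_subset_localize_order_ge:
  assumes I: "I \<subseteq> localize (order_ge d)"
  shows "ideal_power I i \<subseteq> localize (order_ge (d * i))"
proof (induction i)
  case 0
  have "y \<in> localize (order_ge 0)" for y :: "'a diag_local"
  proof -
    obtain a s where "lookup s 0 \<noteq> 0" "y * loc s = loc a" by (rule loc_fraction)
    then show ?thesis by (intro localizeI[of a _ s]) (auto simp: order_ge_def)
  qed
  then show ?case by auto
next
  case (Suc i)
  show ?case unfolding ideal_power.simps
  proof (rule ideal_mult_subset)
    fix a b assume "a \<in> I" "b \<in> ideal_power I i"
    then have "a \<in> localize (order_ge d)" "b \<in> localize (order_ge (d * i))" using I Suc by auto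
    from localize_mult[OF order_ge_mult this] show "a * b \<in> localize (order_ge (d * Suc i))" by simp
  qed (rule subspace_localize[OF subspace_order_ge])
qed

lemma localize_mono: "L \<subseteq> L' \<Longrightarrow> localize L \<subseteq> localize L'"
  by (auto simp: localize_def)

text \<open>If the numerator a had order j < d, the equation would express a^n, up to a unit, by
  terms of order above n j. The initial form of a rules this out.\<close>

lemma integral_closure_subset_localize_order_ge:
  assumes char: "CHAR('k::field) = 3" and d: "d \<le> 7"
    and I: "(I :: 'k diag_local set) \<subseteq> localize (order_ge d)"
  shows "integral_closure I \<subseteq> localize (order_ge d)"
proof
  fix u assume "u \<in> integral_closure I"
  then obtain n c where n: "n \<ge> 1" "\<And>i. i \<in> {1..n} \<Longrightarrow> c i \<in> ideal_power I i"
      "u ^ n + (\<Sum>i = 1..n. c i * u ^ (n - i)) = 0"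
    unfolding integral_closure_def by blast
  obtain a s where a: "lookup s 0 \<noteq> 0" "u * loc s = loc a" by (rule loc_fraction)
  have "a \<in> order_ge d"
  proof (rule ccontr)
    assume na: "a \<notin> order_ge d"
    \<comment> \<open>This is the order of a; it is below d, hence below 7, the degree of f.\<close>
    define j where "j = (LEAST j. a \<notin> order_ge (Suc j))"
    have "d \<noteq> 0" using na by (auto simp: order_ge_def)
    then have ex: "a \<notin> order_ge (Suc (d - 1))" using na by simp
    have j: "a \<notin> order_ge (Suc j)" unfolding j_def by (rule LeastI[of "\<lambda>j. a \<notin> order_ge (Suc j)", OF ex])
    have jd: "j < d" using Least_le[of "\<lambda>j. a \<notin> order_ge (Suc j)", OF ex] \<open>d \<noteq> 0\<close> by (simp add: j_def)
    have aj: "a \<in> order_ge j"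
    proof (cases j)
      case (Suc j')
      then show ?thesis using not_less_Least[of j' "\<lambda>j. a \<notin> order_ge (Suc j)"] by (auto simp: j_def)
    qed (simp add: order_ge_def)
    define F :: "nat \<Rightarrow> 'k diag_local set" where "F i = localize (order_ge i)" for i
    have F: "ideal.subspace (F i)" for i unfolding F_def by (rule subspace_localize[OF subspace_order_ge])
    have F_mult: "y * z \<in> F (i + k)" if "y \<in> F i" "z \<in> F k" for i k y z
      using localize_mult[OF order_ge_mult] that unfolding F_def by blast
    have F_power: "loc a ^ i \<in> F (j * i)" for i
    proof (induction i)
      case 0
      show ?case using loc_in_localize[of 1 "order_ge 0"] by (simp add: F_def order_ge_def loc.one)
    next
      case (Suc i)
      have "loc a \<in> F j" unfolding F_def by (rule loc_in_localize[OF aj])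
      from F_mult[OF this Suc] show ?case by simp
    qed
    have "u ^ n = - (\<Sum>i = 1..n. c i * u ^ (n - i))"
      using n(3) by (simp add: eq_neg_iff_add_eq_0)
    then have "loc s ^ n * u ^ n = (\<Sum>i = 1..n. - (loc s ^ n * (c i * u ^ (n - i))))"
      by (simp add: sum_distrib_left sum_negf)
    also have "\<dots> = (\<Sum>i = 1..n. - (loc s ^ i) * (c i * loc a ^ (n - i)))"
    proof (intro sum.cong refl)
      fix i assume "i \<in> {1..n}"
      then have "loc s ^ n = loc s ^ i * loc s ^ (n - i)" by (simp flip: power_add)
      then show "- (loc s ^ n * (c i * u ^ (n - i))) = - (loc s ^ i) * (c i * loc a ^ (n - i))"
        by (simp add: a(2)[symmetric] power_mult_distrib mult_ac)
    qed
    also have "\<dots> \<in> F (n * j + 1)"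
    proof (rule ideal.subspace_sum[OF F], rule ideal.subspace_scale[OF F])
      fix i assume i: "i \<in> {1..n}"
      have "c i \<in> F (d * i)"
        using n(2)[OF i] ideal_power_subset_localize_order_ge[OF I] unfolding F_def by blast
      from F_mult[OF this F_power] have "c i * loc a ^ (n - i) \<in> F (d * i + j * (n - i))" .
      \<comment> \<open>Compared with j i, the order d i of c_i gains at least i, and i is at least
        1.\<close>
      moreover have "n * j + 1 \<le> d * i + j * (n - i)"
      proof -
        have "n * j = j * i + j * (n - i)" using i by (simp flip: distrib_left)
        moreover have "(j + 1) * i \<le> d * i" using jd by (intro mult_le_mono1) simp
        ultimately show ?thesis using i by (simp add: distrib_right)
      qed
      ultimately show "c i * loc a ^ (n - i) \<in> F (n * j + 1)"
        using localize_mono[OF order_ge_mono] unfolding F_def by blast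
    qed
    also have "loc s ^ n * u ^ n = loc (a ^ n)"
      by (simp add: loc.power a(2)[symmetric] power_mult_distrib mult.commute)
    finally have "loc (a ^ n) \<in> localize (order_ge (n * j + 1))" by (simp add: F_def)
    then obtain t h where "lookup t 0 \<noteq> 0" "h \<in> order_ge (n * j + 1)" "diag_poly dvd t * a ^ n - h"
      by (rule loc_in_localizeD[OF char])
    then show False using leading_form_contradiction[OF char _ aj j] jd d by simp
  qed
  then show "u \<in> localize (order_ge d)" using a by (rule localizeI)
qed

theorem mainTheorem5:
  fixes \<tau> :: "'k::field diag_local set"
  assumes "CHAR('k) = 3"
    and "\<tau> = test_ideal"
  shows "\<not> integrally_closed \<tau> \<and>
         integral_closure \<tau> = ideal_power local_max_ideal 4 \<and>
         ideal_power local_max_ideal 4 \<noteq> \<tau> \<and>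
         local_var 1 * local_var 2 ^ 3 \<in> ideal_power local_max_ideal 4 - \<tau>"
proof -
  note char = assms(1)
  have "integral_closure \<tau> \<subseteq> localize (order_ge 4)"
    unfolding assms(2) by (rule integral_closure_subset_localize_order_ge[OF char _ test_ideal_subset[OF char]]) simp
  then have closure: "integral_closure \<tau> = ideal_power local_max_ideal 4"
    using localize_order_ge_subset local_max_power4_subset_integral_closure[OF char] assms(2) by blast
  have witness: "local_var 1 * local_var 2 ^ 3 \<in> ideal_power local_max_ideal 4 - \<tau>"
    using x1_x2_cube_in_local_max_power x1_x2_cube_notin_test_ideal[OF char] assms(2) by blast
  then have "ideal_power local_max_ideal 4 \<noteq> \<tau>" by blast
  with closure witness show ?thesis by (simp add: integrally_closed_def)
qed

end
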